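(* Let $d\ge2$ and $n\ge1$. Let $\mathcal Z_{d;\mathrm{sym}}(n)$ be the number of equivalence classes of permutations $\sigma\in S_{dn}$ under $\sigma\sim\gamma_1\sigma\gamma_2$ with $\gamma_1,\gamma_2\in S_n[S_d]$, i.e. the cardinality of $S_n[S_d]\backslash S_{dn}/S_n[S_d]$, where $S_n[S_d]\subset S_{dn}$ is the wreath product. Then $$\mathcal Z_{d;\mathrm{sym}}(n)=\sum_{p\vdash dn}\Big(\mathrm{Coeff}\big[\mathcal Z_d^{S_\infty[S_d]}(t,\vec x),\ t^nx_1^{p_1}x_2^{p_2}\cdots x_{dn}^{p_{dn}}\big]\Big)^2\,\mathrm{Sym}(p),$$ where $$\mathcal Z_d^{S_\infty[S_d]}(t,\vec x)=\exp\left(\sum_{i=1}^\infty\frac{t^i}{i}\Big[\sum_{q\vdash d}\ \prod_{\ell=1}^d\Big(\frac{x_{i\ell}}{\ell}\Big)^{\nu_\ell}\frac1{\nu_\ell!}\Big]\right).$$ For all sufficiently large $N$ this number equals the dimension of the space of invariants of $U(N)$ acting diagonally on $\mathrm{Sym}^n(\mathrm{Sym}^d(V))\otimes\mathrm{Sym}^n(\mathrm{Sym}^d(\bar V))$, where $V=\mathbb C^N$ is the fundamental representation of $U(N)$.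
   Context: A partition $p\vdash m$ is written $p=(p_1,\dots,p_m)$ with $p_i$ the number of parts equal to $i$, $\sum_iip_i=m$, and $\mathrm{Sym}(p)=\prod_ii^{p_i}p_i!$; similarly $q=(\nu_1,\dots,\nu_d)\vdash d$ means $\sum_\ell\ell\nu_\ell=d$. $\vec x=(x_1,x_2,\dots)$ are formal variables and $\mathrm{Coeff}[F,m]$ is the coefficient of the monomial $m$ in the formal power series $F$. Regard $S_{dn}$ as the permutation group of the $dn$ pairs $(a,\alpha)$, $a\in\{1,\dots,n\}$, $\alpha\in\{1,\dots,d\}$; the wreath product $S_n[S_d]=S_n\ltimes(S_d)^n$ is the subgroup of permutations $(a,\alpha)\mapsto(\gamma(a),\gamma_a(\alpha))$ with $\gamma\in S_n$ and $\gamma_1,\dots,\gamma_n\in S_d$. $\mathrm{Sym}^k(U)$ denotes the symmetric part of $U^{\otimes k}$, and $\bar V$ is the complex conjugate of $V$. *)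

theory Defs
  imports
    "HOL-Library.Poly_Mapping"
    "HOL-Library.Function_Algebras"
    "HOL-Library.FuncSet"
    "HOL-Combinatorics.Permutations"
    "HOL-Computational_Algebra.Formal_Power_Series"
    "Jordan_Normal_Form.Schur_Decomposition"
begin

subsection \<open>Double cosets of the wreath product\<close>

definition perms :: "nat \<Rightarrow> nat \<Rightarrow> (nat \<times> nat \<Rightarrow> nat \<times> nat) set" where
  "perms d n = {\<sigma>. \<sigma> permutes ({1..n} \<times> {1..d})}"

definition wreath :: "nat \<Rightarrow> nat \<Rightarrow> (nat \<times> nat \<Rightarrow> nat \<times> nat) set" where
  "wreath d n = {\<sigma> \<in> perms d n.
     \<exists>\<gamma> \<delta>. \<gamma> permutes {1..n} \<and> (\<forall>a\<in>{1..n}. \<delta> a permutes {1..d}) \<and>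
       (\<forall>a\<in>{1..n}. \<forall>\<alpha>\<in>{1..d}. \<sigma> (a, \<alpha>) = (\<gamma> a, \<delta> a \<alpha>))}"

definition dcoset_rel :: "nat \<Rightarrow> nat \<Rightarrow> (nat \<times> nat \<Rightarrow> nat \<times> nat) rel" where
  "dcoset_rel d n = {(\<sigma>, \<tau>). \<sigma> \<in> perms d n \<and> \<tau> \<in> perms d n \<and>
     (\<exists>\<gamma>\<^sub>1\<in>wreath d n. \<exists>\<gamma>\<^sub>2\<in>wreath d n. \<tau> = \<gamma>\<^sub>1 \<circ> \<sigma> \<circ> \<gamma>\<^sub>2)}"

definition Z_sym :: "nat \<Rightarrow> nat \<Rightarrow> nat" where
  "Z_sym d n = card (perms d n // dcoset_rel d n)"

lemma wreath_id: "id \<in> wreath d n"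
  unfolding wreath_def perms_def
  by (auto simp: permutes_id intro!: exI[of _ id] exI[of _ "\<lambda>_. id"])

lemma wreath_comp:
  assumes "\<sigma> \<in> wreath d n" "\<tau> \<in> wreath d n"
  shows "\<sigma> \<circ> \<tau> \<in> wreath d n"
proof -
  from assms(1) obtain \<gamma> \<delta> where 1: "\<sigma> \<in> perms d n" "\<gamma> permutes {1..n}"
    "\<And>a. a \<in> {1..n} \<Longrightarrow> \<delta> a permutes {1..d}"
    "\<And>a \<alpha>. a \<in> {1..n} \<Longrightarrow> \<alpha> \<in> {1..d} \<Longrightarrow> \<sigma> (a, \<alpha>) = (\<gamma> a, \<delta> a \<alpha>)"
    unfolding wreath_def by blast
  from assms(2) obtain \<gamma>' \<delta>' where 2: "\<tau> \<in> perms d n" "\<gamma>' permutes {1..n}"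
    "\<And>a. a \<in> {1..n} \<Longrightarrow> \<delta>' a permutes {1..d}"
    "\<And>a \<alpha>. a \<in> {1..n} \<Longrightarrow> \<alpha> \<in> {1..d} \<Longrightarrow> \<tau> (a, \<alpha>) = (\<gamma>' a, \<delta>' a \<alpha>)"
    unfolding wreath_def by blast
  have in1: "\<gamma>' a \<in> {1..n}" if "a \<in> {1..n}" for a
    using that permutes_in_image[OF 2(2)] by blast
  have in2: "\<delta>' a \<alpha> \<in> {1..d}" if "a \<in> {1..n}" "\<alpha> \<in> {1..d}" for a \<alpha>
    using that permutes_in_image[OF 2(3)] by blast
  have "\<sigma> \<circ> \<tau> \<in> perms d n"
    using 1(1) 2(1) unfolding perms_def by (auto intro: permutes_compose)
  moreover have "\<gamma> \<circ> \<gamma>' permutes {1..n}"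
    using 1(2) 2(2) by (rule permutes_compose[rotated])
  moreover have "\<delta> (\<gamma>' a) \<circ> \<delta>' a permutes {1..d}" if "a \<in> {1..n}" for a
    using 2(3)[OF that] 1(3)[OF in1[OF that]] by (rule permutes_compose)
  moreover have "(\<sigma> \<circ> \<tau>) (a, \<alpha>) = ((\<gamma> \<circ> \<gamma>') a, (\<delta> (\<gamma>' a) \<circ> \<delta>' a) \<alpha>)"
    if "a \<in> {1..n}" "\<alpha> \<in> {1..d}" for a \<alpha>
    using 2(4)[OF that] 1(4)[OF in1[OF that(1)] in2[OF that]] by simp
  ultimately show ?thesis
    unfolding wreath_def mem_Collect_eq
    by (intro conjI exI[of _ "\<gamma> \<circ> \<gamma>'"] exI[of _ "\<lambda>a. \<delta> (\<gamma>' a) \<circ> \<delta>' a"]) auto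
qed

lemma finite_perms: "finite (perms d n)"
  unfolding perms_def by (rule finite_permutations) simp

lemma wreath_inv:
  assumes "\<sigma> \<in> wreath d n"
  shows "inv_into UNIV \<sigma> \<in> wreath d n"
proof -
  from assms obtain \<gamma> \<delta> where 1: "\<sigma> \<in> perms d n" "\<gamma> permutes {1..n}"
    "\<And>a. a \<in> {1..n} \<Longrightarrow> \<delta> a permutes {1..d}"
    "\<And>a \<alpha>. a \<in> {1..n} \<Longrightarrow> \<alpha> \<in> {1..d} \<Longrightarrow> \<sigma> (a, \<alpha>) = (\<gamma> a, \<delta> a \<alpha>)"
    unfolding wreath_def by blast
  have p: "\<sigma> permutes ({1..n} \<times> {1..d})" using 1(1) by (simp add: perms_def)
  have g: "inv_into UNIV \<gamma> permutes {1..n}" using 1(2) by (rule permutes_inv)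
  have ig: "inv_into UNIV \<gamma> a \<in> {1..n}" if "a \<in> {1..n}" for a
    using that permutes_in_image[OF g] by blast
  have dp: "inv_into UNIV (\<delta> (inv_into UNIV \<gamma> a)) permutes {1..d}" if "a \<in> {1..n}" for a
    using 1(3)[OF ig[OF that]] by (rule permutes_inv)
  have eq: "inv_into UNIV \<sigma> (a, \<alpha>) = (inv_into UNIV \<gamma> a, inv_into UNIV (\<delta> (inv_into UNIV \<gamma> a)) \<alpha>)"
    if a: "a \<in> {1..n}" and \<alpha>: "\<alpha> \<in> {1..d}" for a \<alpha>
  proof -
    have "inv_into UNIV (\<delta> (inv_into UNIV \<gamma> a)) \<alpha> \<in> {1..d}"
      using \<alpha> permutes_in_image[OF dp[OF a]] by blast
    then have "\<sigma> (inv_into UNIV \<gamma> a, inv_into UNIV (\<delta> (inv_into UNIV \<gamma> a)) \<alpha>) = (a, \<alpha>)"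
      using 1(4)[OF ig[OF a]] permutes_inverses(1)[OF 1(2)]
        permutes_inverses(1)[OF 1(3)[OF ig[OF a]]] by simp
    then show ?thesis using permutes_inverses(2)[OF p] by metis
  qed
  have "inv_into UNIV \<sigma> \<in> perms d n" using permutes_inv[OF p] by (simp add: perms_def)
  then show ?thesis
    unfolding wreath_def mem_Collect_eq
    using g dp eq by (intro conjI exI[of _ "inv_into UNIV \<gamma>"] exI[of _ "\<lambda>a. inv_into UNIV (\<delta> (inv_into UNIV \<gamma> a))"]) auto
qed

lemma equiv_dcoset_rel: "equiv (perms d n) (dcoset_rel d n)"
proof (rule equivI)
  show "dcoset_rel d n \<subseteq> perms d n \<times> perms d n"
    by (auto simp: dcoset_rel_def)
  show "refl_on (perms d n) (dcoset_rel d n)"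
    by (rule refl_onI) (auto simp: dcoset_rel_def intro!: bexI[OF _ wreath_id])
  show "sym (dcoset_rel d n)"
  proof (rule symI)
    fix \<sigma> \<tau> assume "(\<sigma>, \<tau>) \<in> dcoset_rel d n"
    then obtain g h where *: "\<sigma> \<in> perms d n" "\<tau> \<in> perms d n" "g \<in> wreath d n"
      "h \<in> wreath d n" "\<tau> = g \<circ> \<sigma> \<circ> h"
      unfolding dcoset_rel_def by blast
    have "bij g" "bij h"
      using *(3,4) by (auto simp: wreath_def perms_def intro: permutes_bij)
    then have "\<sigma> = inv_into UNIV g \<circ> \<tau> \<circ> inv_into UNIV h"
      unfolding *(5) by (auto simp: fun_eq_iff bij_is_inj bij_is_surj surj_f_inv_f)
    then show "(\<tau>, \<sigma>) \<in> dcoset_rel d n"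
      using * wreath_inv unfolding dcoset_rel_def by blast
  qed
  show "trans (dcoset_rel d n)"
  proof (rule transI)
    fix \<rho> \<sigma> \<tau> assume "(\<rho>, \<sigma>) \<in> dcoset_rel d n" "(\<sigma>, \<tau>) \<in> dcoset_rel d n"
    then obtain g h g' h' where *: "\<rho> \<in> perms d n" "\<tau> \<in> perms d n" "g \<in> wreath d n"
      "h \<in> wreath d n" "g' \<in> wreath d n" "h' \<in> wreath d n"
      "\<tau> = g' \<circ> (g \<circ> \<rho> \<circ> h) \<circ> h'"
      unfolding dcoset_rel_def by blast
    then have "\<tau> = (g' \<circ> g) \<circ> \<rho> \<circ> (h \<circ> h')" by (simp add: comp_assoc)
    then show "(\<rho>, \<tau>) \<in> dcoset_rel d n"
      using * wreath_comp unfolding dcoset_rel_def by blast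
  qed
qed

subsection \<open>Partitions and the generating series\<close>

text \<open>
  A partition is given by its multiplicities: \<open>lookup p i\<close> is the number of parts equal
  to \<open>i\<close>. As an element of \<^typ>\<open>nat \<Rightarrow>\<^sub>0 nat\<close> it is at the same time the exponent of the
  monomial \<open>\<Prod>i. x\<^sub>i ^ p\<^sub>i\<close>.
\<close>

definition partitions :: "nat \<Rightarrow> (nat \<Rightarrow>\<^sub>0 nat) set" where
  "partitions m = {p. Poly_Mapping.keys p \<subseteq> {1..m} \<and>
     (\<Sum>i = 1..m. i * Poly_Mapping.lookup p i) = m}"

definition Sym :: "nat \<Rightarrow> (nat \<Rightarrow>\<^sub>0 nat) \<Rightarrow> nat" where
  "Sym m p = (\<Prod>i = 1..m. i ^ Poly_Mapping.lookup p i * fact (Poly_Mapping.lookup p i))"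

text \<open>
  Each power of \<open>t\<close> occurs in the generating series with a polynomial in the \<open>x\<^sub>j\<close> as its
  coefficient, so the series lives in \<open>\<rat>[x\<^sub>1, x\<^sub>2, \<dots>][[t]]\<close>, a subring of the ring of all
  formal power series in \<open>t\<close> and the \<open>x\<^sub>j\<close>.
\<close>

type_synonym xpoly = "(nat \<Rightarrow>\<^sub>0 nat) \<Rightarrow>\<^sub>0 rat"

definition xconst :: "rat \<Rightarrow> xpoly" where
  "xconst c = Poly_Mapping.single 0 c"

definition xvar :: "nat \<Rightarrow> xpoly" where
  "xvar j = Poly_Mapping.single (Poly_Mapping.single j 1) 1"

definition Z_exponent :: "nat \<Rightarrow> xpoly fps" where
  "Z_exponent d = Abs_fps (\<lambda>i. if i = 0 then 0 else xconst (1 / of_nat i) *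
     (\<Sum>q\<in>partitions d. \<Prod>l = 1..d.
        (xconst (1 / of_nat l) * xvar (i * l)) ^ Poly_Mapping.lookup q l
          * xconst (1 / fact (Poly_Mapping.lookup q l))))"

text \<open>
  The library's \<^const>\<open>fps_exp\<close> needs a field of coefficients. The composition below is the
  formal exponential because \<open>Z_exponent d\<close> has no constant term in \<open>t\<close>.
\<close>

definition exp_series :: "xpoly fps" where
  "exp_series = Abs_fps (\<lambda>k. xconst (1 / fact k))"

definition Z_series :: "nat \<Rightarrow> xpoly fps" where
  "Z_series d = fps_compose exp_series (Z_exponent d)"

text \<open>\<open>coeff_tx F n p\<close> is the coefficient of \<open>t ^ n * (\<Prod>i. x\<^sub>i ^ p\<^sub>i)\<close>.\<close>

definition coeff_tx :: "xpoly fps \<Rightarrow> nat \<Rightarrow> (nat \<Rightarrow>\<^sub>0 nat) \<Rightarrow> rat" where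
  "coeff_tx F n p = Poly_Mapping.lookup (fps_nth F n) p"

lemma finite_partitions: "finite (partitions m)"
proof -
  have le: "Poly_Mapping.lookup p i \<le> m" if p: "p \<in> partitions m" and i: "i \<in> {1..m}" for p i
  proof -
    have "Poly_Mapping.lookup p i \<le> i * Poly_Mapping.lookup p i" using i by simp
    also have "\<dots> \<le> (\<Sum>i = 1..m. i * Poly_Mapping.lookup p i)"
      using i by (rule member_le_sum[of i "{1..m}" "\<lambda>i. i * Poly_Mapping.lookup p i"]) simp_all
    also have "\<dots> = m" using p by (simp add: partitions_def)
    finally show ?thesis .
  qed
  have zero: "Poly_Mapping.lookup p i = 0" if "p \<in> partitions m" "i \<notin> {1..m}" for p i
  proof -
    from that have "i \<notin> Poly_Mapping.keys p" unfolding partitions_def by blast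
    then show ?thesis by (simp only: in_keys_iff not_not)
  qed
  have "Poly_Mapping.lookup ` partitions m
      \<subseteq> {f. \<forall>i. (i \<in> {1..m} \<longrightarrow> f i \<in> {..m}) \<and> (i \<notin> {1..m} \<longrightarrow> f i = 0)}"
  proof (rule image_subsetI)
    fix p assume "p \<in> partitions m"
    then show "Poly_Mapping.lookup p
        \<in> {f. \<forall>i. (i \<in> {1..m} \<longrightarrow> f i \<in> {..m}) \<and> (i \<notin> {1..m} \<longrightarrow> f i = 0)}"
      using le[of p] zero[of p] unfolding mem_Collect_eq atMost_iff by (intro allI conjI impI)
  qed
  moreover have "finite {f. \<forall>i. (i \<in> {1..m} \<longrightarrow> f i \<in> {..m}) \<and> (i \<notin> {1..m} \<longrightarrow> f i = (0::nat))}"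
    by (rule finite_set_of_finite_funs) auto
  ultimately have "finite (Poly_Mapping.lookup ` partitions m)" by (rule finite_subset)
  then show ?thesis
    by (rule finite_imageD) (rule inj_onI, rule poly_mapping_eqI, simp)
qed

subsection \<open>Tensor constructions over the complex numbers\<close>

text \<open>
  Vector spaces are spaces of complex functions on an index type, with pointwise operations.
  For \<open>U \<subseteq> \<complex>\<^sup>I\<close> and \<open>W \<subseteq> \<complex>\<^sup>J\<close> the tensor product is the span of the functions
  \<open>(i, j) \<mapsto> u i * w j\<close>, and the \<open>k\<close>-fold tensor power is the analogous space of functions
  on lists of length \<open>k\<close>, extended by \<open>0\<close> to all lists.
\<close>

definition fscale :: "complex \<Rightarrow> ('i \<Rightarrow> complex) \<Rightarrow> 'i \<Rightarrow> complex" where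
  "fscale c v = (\<lambda>i. c * v i)"

global_interpretation cfun: vector_space fscale
  by unfold_locales (auto simp: fscale_def fun_eq_iff algebra_simps)

definition pure_power :: "nat \<Rightarrow> (nat \<Rightarrow> 'i \<Rightarrow> complex) \<Rightarrow> 'i list \<Rightarrow> complex" where
  "pure_power k u = (\<lambda>js. if length js = k then \<Prod>l<k. u l (js ! l) else 0)"

definition tensor_power :: "nat \<Rightarrow> ('i \<Rightarrow> complex) set \<Rightarrow> ('i list \<Rightarrow> complex) set" where
  "tensor_power k U = cfun.span {pure_power k u |u. \<forall>l<k. u l \<in> U}"

definition sym_power :: "nat \<Rightarrow> ('i \<Rightarrow> complex) set \<Rightarrow> ('i list \<Rightarrow> complex) set" where
  "sym_power k U = {T \<in> tensor_power k U.
     \<forall>\<pi> js. \<pi> permutes {..<k} \<and> length js = k \<longrightarrow> T (permute_list \<pi> js) = T js}"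

definition pure_prod :: "('i \<Rightarrow> complex) \<Rightarrow> ('j \<Rightarrow> complex) \<Rightarrow> 'i \<times> 'j \<Rightarrow> complex" where
  "pure_prod u w = (\<lambda>(i, j). u i * w j)"

definition tensor_prod ::
    "('i \<Rightarrow> complex) set \<Rightarrow> ('j \<Rightarrow> complex) set \<Rightarrow> ('i \<times> 'j \<Rightarrow> complex) set" where
  "tensor_prod U W = cfun.span {pure_prod u w |u w. u \<in> U \<and> w \<in> W}"

text \<open>
  Linear operators are given by matrices \<open>A i j\<close> over the index type and act on finitely
  supported functions. \<open>power_op\<close> and \<open>prod_op\<close> are the operators
  \<open>A \<otimes> \<dots> \<otimes> A\<close> and \<open>A \<otimes> B\<close>, see \<open>op_apply_pure_power\<close> and \<open>op_apply_pure_prod\<close>.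
\<close>

definition op_apply :: "('i \<Rightarrow> 'i \<Rightarrow> complex) \<Rightarrow> ('i \<Rightarrow> complex) \<Rightarrow> 'i \<Rightarrow> complex" where
  "op_apply A v = (\<lambda>i. \<Sum>j | v j \<noteq> 0. A i j * v j)"

definition power_op :: "nat \<Rightarrow> ('i \<Rightarrow> 'i \<Rightarrow> complex) \<Rightarrow> 'i list \<Rightarrow> 'i list \<Rightarrow> complex" where
  "power_op k A = (\<lambda>is js. if length is = k \<and> length js = k
     then \<Prod>l<k. A (is ! l) (js ! l) else 0)"

definition prod_op :: "('i \<Rightarrow> 'i \<Rightarrow> complex) \<Rightarrow> ('j \<Rightarrow> 'j \<Rightarrow> complex)
    \<Rightarrow> 'i \<times> 'j \<Rightarrow> 'i \<times> 'j \<Rightarrow> complex" where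
  "prod_op A B = (\<lambda>(i, i') (j, j'). A i j * B i' j')"

lemma op_apply_pure_power:
  assumes fin: "\<And>l. l < k \<Longrightarrow> finite {j. u l j \<noteq> 0}"
  shows "op_apply (power_op k A) (pure_power k u) = pure_power k (\<lambda>l. op_apply A (u l))"
proof
  fix "is" :: "'a list"
  show "op_apply (power_op k A) (pure_power k u) is = pure_power k (\<lambda>l. op_apply A (u l)) is"
  proof (cases "length is = k")
    case False
    then show ?thesis by (simp add: op_apply_def power_op_def pure_power_def)
  next
    case True
    define S where "S = {js. length js = k \<and> (\<forall>l<k. u l (js ! l) \<noteq> 0)}"
    have S: "{js. pure_power k u js \<noteq> 0} = S"
      by (auto simp: S_def pure_power_def)
    have "op_apply (power_op k A) (pure_power k u) is
        = (\<Sum>js\<in>S. \<Prod>l<k. A (is ! l) (js ! l) * u l (js ! l))"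
      unfolding op_apply_def S
      by (rule sum.cong) (auto simp: S_def power_op_def pure_power_def True prod.distrib)
    also have "\<dots> = (\<Sum>g\<in>PiE {..<k} (\<lambda>l. {j. u l j \<noteq> 0}). \<Prod>l<k. A (is ! l) (g l) * u l (g l))"
    proof (rule sum.reindex_bij_witness[of _ "\<lambda>g. map g [0..<k]" "\<lambda>js. restrict (\<lambda>l. js ! l) {..<k}"])
      fix js assume js: "js \<in> S"
      show "map (restrict (\<lambda>l. js ! l) {..<k}) [0..<k] = js"
        using js by (intro nth_equalityI) (auto simp: S_def)
      show "restrict (\<lambda>l. js ! l) {..<k} \<in> PiE {..<k} (\<lambda>l. {j. u l j \<noteq> 0})"
        using js by (simp add: S_def)
      show "(\<Prod>l<k. A (is ! l) (restrict (\<lambda>l. js ! l) {..<k} l) * u l (restrict (\<lambda>l. js ! l) {..<k} l))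
          = (\<Prod>l<k. A (is ! l) (js ! l) * u l (js ! l))"
        by (rule prod.cong) simp_all
    next
      fix g assume g: "g \<in> PiE {..<k} (\<lambda>l. {j. u l j \<noteq> 0})"
      show "restrict (\<lambda>l. map g [0..<k] ! l) {..<k} = g"
        using g by (intro ext) (auto simp: PiE_def extensional_def)
      show "map g [0..<k] \<in> S"
        using g by (auto simp: S_def PiE_def Pi_def)
    qed
    also have "\<dots> = (\<Prod>l<k. \<Sum>j | u l j \<noteq> 0. A (is ! l) j * u l j)"
      by (rule prod_sum_PiE[symmetric]) (auto simp: fin)
    also have "\<dots> = pure_power k (\<lambda>l. op_apply A (u l)) is"
      by (simp add: pure_power_def op_apply_def True)
    finally show ?thesis .
  qed
qed

lemma op_apply_pure_prod:
  "op_apply (prod_op A B) (pure_prod u w) = pure_prod (op_apply A u) (op_apply B w)"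
proof -
  have S: "{p. pure_prod u w p \<noteq> 0} = {i. u i \<noteq> 0} \<times> {j. w j \<noteq> 0}"
    by (auto simp: pure_prod_def)
  have "(\<Sum>p\<in>{i. u i \<noteq> 0} \<times> {j. w j \<noteq> 0}. prod_op A B (i, j) p * pure_prod u w p)
      = (\<Sum>x | u x \<noteq> 0. A i x * u x) * (\<Sum>y | w y \<noteq> 0. B j y * w y)" for i j
    unfolding sum_product sum.cartesian_product
    by (rule sum.cong) (simp_all add: prod_op_def pure_prod_def split_beta)
  then show ?thesis
    unfolding op_apply_def S by (simp add: fun_eq_iff) (simp add: pure_prod_def)
qed

subsection \<open>The representation of the unitary group\<close>

definition unitary_group :: "nat \<Rightarrow> complex mat set" where
  "unitary_group N = {g \<in> carrier_mat N N. g * mat_adjoint g = 1\<^sub>m N}"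

definition std_space :: "nat \<Rightarrow> (nat \<Rightarrow> complex) set" where
  "std_space N = {v. \<forall>i\<ge>N. v i = 0}"

definition mat_op :: "nat \<Rightarrow> complex mat \<Rightarrow> nat \<Rightarrow> nat \<Rightarrow> complex" where
  "mat_op N g = (\<lambda>i j. if i < N \<and> j < N then g $$ (i, j) else 0)"

text \<open>
  Complex conjugation of coordinates identifies the conjugate space of \<open>\<complex>\<^sup>N\<close> linearly with
  \<open>\<complex>\<^sup>N\<close>; under this identification \<open>g\<close> acts through the matrix of conjugated entries.
\<close>

definition sym_sym_space :: "nat \<Rightarrow> nat \<Rightarrow> nat \<Rightarrow> (nat list list \<times> nat list list \<Rightarrow> complex) set" where
  "sym_sym_space d n N =
     tensor_prod (sym_power n (sym_power d (std_space N))) (sym_power n (sym_power d (std_space N)))"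

definition sym_sym_action ::
    "nat \<Rightarrow> nat \<Rightarrow> nat \<Rightarrow> complex mat \<Rightarrow> (nat list list \<times> nat list list \<Rightarrow> complex)
      \<Rightarrow> nat list list \<times> nat list list \<Rightarrow> complex" where
  "sym_sym_action d n N g = op_apply
     (prod_op (power_op n (power_op d (mat_op N g)))
       (power_op n (power_op d (mat_op N (map_mat cnj g)))))"

definition invariants :: "nat \<Rightarrow> nat \<Rightarrow> nat \<Rightarrow> (nat list list \<times> nat list list \<Rightarrow> complex) set" where
  "invariants d n N =
     {T \<in> sym_sym_space d n N. \<forall>g\<in>unitary_group N. sym_sym_action d n N g T = T}"

end

(*
By Burnside's lemma the number of double cosets of H = S_n[S_d] in S_(dn) is |H|^(-2) times the
number of triples (h, k, s) in H x H x S_(dn) with s h = k s. For given h and k the number of s is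
Sym(p) if h and k have the same cycle type p, and 0 otherwise. It remains to identify the
coefficients of the generating series with the proportions of the cycle types in H, i.e. to compute
the cycle index of the wreath product. Removing a block from the cycle of blocks in which it lies
and adding its weight to that of the next block yields the recursion
m W_m = y_1 W_(m-1) + ... + y_m W_0 satisfied by the coefficients of exp(sum_i y_i t^i / i).

Sym^n(Sym^d V) consists of the functions of multisets of multisets of indices, so an invariant is a
function of two index maps {1..n} x {1..d} -> {0..<N} that is constant on the H-orbits of each.
For N >= dn an invariant is determined by its values at pairs (f, f o s), with a fixed injective f
and permutations s: diagonal matrices force equal index contents, permutation matrices move every
injective map to f, and the derivative of a plane rotation expresses a value with a repeated index
by values with one repetition fewer. Hence the tensors [J = I o s], summed over the double cosets,
form a basis.
*)
theory Submission
  imports Defs "HOL-Combinatorics.Orbits"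
begin

subsection \<open>The cycle index polynomials and their recursion\<close>

text \<open>The recursion of \<open>cyc_ind\<close> is the common interface: differentiation yields
  it for the exponential series, contraction for S_n and for the wreath product. No conjugacy class
  is counted by hand; the order of the wreath product, the centralizer order \<open>Sym\<close> and
  the fact that a cycle type is a partition are all read off from coefficients. Contraction spoils
  uniformity, since the receiver of a deleted weight differs from its neighbours. Hence arbitrary
  weights are carried along and the induction keeps one marked point. A block of weight i that is
  mapped to itself contributes cycles of weight i*l, the source of the variables x_(il). A block
  mapped elsewhere loses its inner permutation when it is contracted, which costs a factor d!. To
  bound the invariants only monomial matrices and rotations of coordinate planes are used; unitarity
  in general enters only where the permutation tensors are shown to be invariant.\<close>

lemma xconst_simps [simp]:
  "xconst 0 = 0" "xconst 1 = 1" "xconst (a * b) = xconst a * xconst b"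
  "xconst (of_nat k) = of_nat k"
  by (simp_all add: xconst_def mult_single)

lemma of_nat_xconst_inverse: "k > 0 \<Longrightarrow> of_nat k * xconst (1 / of_nat k) = 1"
  by (simp flip: xconst_simps(2-4))

definition cyc_term :: "(nat \<Rightarrow> xpoly) \<Rightarrow> nat \<Rightarrow> nat \<Rightarrow> xpoly" where
  "cyc_term y l k = (xconst (1 / of_nat l) * y l) ^ k * xconst (1 / fact k)"

text \<open>The cycle index of the symmetric group on m points, with \<open>y l\<close> substituted
  for the variable of the l-cycles. The substitution is left arbitrary so that cycle indices can be
  nested.\<close>

definition cyc_ind :: "(nat \<Rightarrow> xpoly) \<Rightarrow> nat \<Rightarrow> xpoly" where
  "cyc_ind y m = (\<Sum>q\<in>partitions m. \<Prod>l = 1..m. cyc_term y l (Poly_Mapping.lookup q l))"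

lemma cyc_term_0 [simp]: "cyc_term y l 0 = 1"
  by (simp add: cyc_term_def)

lemma cyc_term_Suc:
  assumes "l > 0"
  shows "of_nat (l * Suc k) * cyc_term y l (Suc k) = y l * cyc_term y l k"
proof -
  have "xconst (1 / fact (Suc k)) = xconst (1 / of_nat (Suc k)) * xconst (1 / fact k)"
    by (simp flip: xconst_simps(3))
  then have "of_nat (l * Suc k) * cyc_term y l (Suc k)
     = (of_nat l * xconst (1 / of_nat l)) * (of_nat (Suc k) * xconst (1 / of_nat (Suc k))) *
       (y l * cyc_term y l k)"
    unfolding cyc_term_def power_Suc of_nat_mult by (simp only: mult_ac)
  then show ?thesis using assms by (simp only: of_nat_xconst_inverse zero_less_Suc mult_1)
qed

lemma partitions_keys:
  "p \<in> partitions m \<Longrightarrow> i \<notin> {1..m} \<Longrightarrow> Poly_Mapping.lookup p i = 0"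
  unfolding partitions_def mem_Collect_eq by (metis in_keys_iff subsetD)

text \<open>Partitions of different numbers have to be compared over one range of part sizes. No
  part exceeds the number that is partitioned, so every bound \<open>M\<close> with
  \<open>m \<le> M\<close> describes the same set.\<close>

lemma partitions_iff:
  assumes "m \<le> M"
  shows "p \<in> partitions m \<longleftrightarrow> Poly_Mapping.keys p \<subseteq> {1..M} \<and>
     (\<Sum>i = 1..M. i * Poly_Mapping.lookup p i) = m"
proof
  assume p: "p \<in> partitions m"
  have "(\<Sum>i = 1..M. i * Poly_Mapping.lookup p i) = (\<Sum>i = 1..m. i * Poly_Mapping.lookup p i)"
    using assms partitions_keys[OF p] by (intro sum.mono_neutral_right) auto
  then show "Poly_Mapping.keys p \<subseteq> {1..M} \<and> (\<Sum>i = 1..M. i * Poly_Mapping.lookup p i) = m"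
    using p assms unfolding partitions_def by auto
next
  assume p: "Poly_Mapping.keys p \<subseteq> {1..M} \<and> (\<Sum>i = 1..M. i * Poly_Mapping.lookup p i) = m"
  have le: "i \<le> m" if i: "i \<in> Poly_Mapping.keys p" for i
  proof -
    have "i * 1 \<le> i * Poly_Mapping.lookup p i"
      using i by (intro mult_le_mono) (simp_all add: in_keys_iff)
    also have "\<dots> \<le> (\<Sum>i = 1..M. i * Poly_Mapping.lookup p i)"
      using i p by (intro member_le_sum[of i "{1..M}" "\<lambda>i. i * Poly_Mapping.lookup p i"]) auto
    finally show ?thesis using p by simp
  qed
  then have k: "Poly_Mapping.keys p \<subseteq> {1..m}" using p by auto
  have "(\<Sum>i = 1..M. i * Poly_Mapping.lookup p i) = (\<Sum>i = 1..m. i * Poly_Mapping.lookup p i)"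
    using assms k by (intro sum.mono_neutral_right) (auto simp: in_keys_iff)
  then show "p \<in> partitions m" using k p by (simp add: partitions_def)
qed

lemma cyc_ind_bound:
  assumes "m \<le> M"
  shows "cyc_ind y m = (\<Sum>q\<in>partitions m. \<Prod>l = 1..M. cyc_term y l (Poly_Mapping.lookup q l))"
  unfolding cyc_ind_def
proof (rule sum.cong[OF refl])
  fix q assume q: "q \<in> partitions m"
  show "(\<Prod>l = 1..m. cyc_term y l (Poly_Mapping.lookup q l))
      = (\<Prod>l = 1..M. cyc_term y l (Poly_Mapping.lookup q l))"
    using assms partitions_keys[OF q] by (intro prod.mono_neutral_left) auto
qed

lemma partitions_add_part:
  assumes "l \<in> {1..m}"
  shows "bij_betw (\<lambda>q. q + Poly_Mapping.single l 1) (partitions (m - l))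
           {q \<in> partitions m. Poly_Mapping.lookup q l > 0}"
proof (rule bij_betw_byWitness[where f' = "\<lambda>q. q - Poly_Mapping.single l 1"])
  have eq: "(\<Sum>i = 1..m. i * Poly_Mapping.lookup (q + Poly_Mapping.single l 1) i)
      = (\<Sum>i = 1..m. i * Poly_Mapping.lookup q i) + l" for q
  proof -
    have "(\<Sum>i = 1..m. i * Poly_Mapping.lookup (q + Poly_Mapping.single l 1) i)
      = (\<Sum>i = 1..m. i * Poly_Mapping.lookup q i + (if i = l then l else 0))"
      by (rule sum.cong) (auto simp: lookup_add lookup_single when_def algebra_simps)
    then show ?thesis using assms by (simp add: sum.distrib)
  qed
  show "(\<lambda>q. q + Poly_Mapping.single l 1) ` partitions (m - l)
    \<subseteq> {q \<in> partitions m. Poly_Mapping.lookup q l > 0}"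
  proof (rule image_subsetI)
    fix q assume "q \<in> partitions (m - l)"
    then have q: "Poly_Mapping.keys q \<subseteq> {1..m}" "(\<Sum>i = 1..m. i * Poly_Mapping.lookup q i) = m - l"
      using partitions_iff[of "m - l" m q] by auto
    have "Poly_Mapping.keys (q + Poly_Mapping.single l 1) \<subseteq> {1..m}"
      using Poly_Mapping.keys_add[of q "Poly_Mapping.single l 1"] q(1) assms by auto
    then show "q + Poly_Mapping.single l 1 \<in> {q \<in> partitions m. Poly_Mapping.lookup q l > 0}"
      using eq[of q] q(2) assms by (simp add: partitions_def lookup_add)
  qed
  have dec: "q - Poly_Mapping.single l 1 + Poly_Mapping.single l 1 = q"
    if "Poly_Mapping.lookup q l > 0" for q :: "nat \<Rightarrow>\<^sub>0 nat"
    using that by (intro poly_mapping_eqI) (auto simp: lookup_add lookup_minus lookup_single when_def)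
  show "(\<lambda>q. q - Poly_Mapping.single l 1) ` {q \<in> partitions m. Poly_Mapping.lookup q l > 0}
    \<subseteq> partitions (m - l)"
  proof (rule image_subsetI)
    fix q assume q: "q \<in> {q \<in> partitions m. Poly_Mapping.lookup q l > 0}"
    let ?r = "q - Poly_Mapping.single l 1"
    have "Poly_Mapping.keys ?r \<subseteq> Poly_Mapping.keys q"
      by (auto simp: in_keys_iff lookup_minus)
    then have "Poly_Mapping.keys ?r \<subseteq> {1..m}" using q by (auto simp: partitions_def)
    moreover have "(\<Sum>i = 1..m. i * Poly_Mapping.lookup ?r i) = m - l"
      using eq[of ?r] q dec[of q] by (simp add: partitions_def)
    ultimately show "?r \<in> partitions (m - l)"
      using partitions_iff[of "m - l" m ?r] by simp
  qed
  show "\<forall>q\<in>partitions (m - l). q + Poly_Mapping.single l 1 - Poly_Mapping.single l 1 = q"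
    by simp
  show "\<forall>q\<in>{q \<in> partitions m. Poly_Mapping.lookup q l > 0}.
     q - Poly_Mapping.single l 1 + Poly_Mapping.single l 1 = q"
    using dec by simp
qed

lemma cyc_ind_0 [simp]: "cyc_ind y 0 = 1"
proof -
  have "partitions 0 = {0}" by (auto simp: partitions_def)
  then show ?thesis by (simp add: cyc_ind_def)
qed

text \<open>Multiplying by m, the sum of all \<open>l * lookup q l\<close>, amounts to marking a
  part of \<open>q\<close> together with one of its units. Removing the marked part l leaves a
  partition of \<open>m - l\<close>, and by \<open>cyc_term_Suc\<close> the weight
  \<open>l * lookup q l\<close> is exactly what turns the term of \<open>q\<close> into
  \<open>y l\<close> times the smaller term.\<close>

lemma cyc_ind_rec:
  "of_nat m * cyc_ind y m = (\<Sum>l = 1..m. y l * cyc_ind y (m - l))"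
proof -
  define \<tau> where "\<tau> q = (\<Prod>l = 1..m. cyc_term y l (Poly_Mapping.lookup q l))" for q
  have "of_nat m * cyc_ind y m
      = (\<Sum>q\<in>partitions m. \<Sum>l = 1..m. of_nat (l * Poly_Mapping.lookup q l) * \<tau> q)"
    unfolding cyc_ind_def sum_distrib_left \<tau>_def[symmetric]
  proof (rule sum.cong[OF refl])
    fix q assume "q \<in> partitions m"
    then have "m = (\<Sum>l = 1..m. l * Poly_Mapping.lookup q l)" by (simp add: partitions_def)
    then have "(of_nat m :: xpoly) = (\<Sum>l = 1..m. of_nat (l * Poly_Mapping.lookup q l))"
      by (metis of_nat_sum)
    then show "of_nat m * \<tau> q = (\<Sum>l = 1..m. of_nat (l * Poly_Mapping.lookup q l) * \<tau> q)"
      by (simp only: sum_distrib_right)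
  qed
  also have "\<dots> = (\<Sum>l = 1..m. \<Sum>q\<in>partitions m. of_nat (l * Poly_Mapping.lookup q l) * \<tau> q)"
    by (rule sum.swap)
  also have "\<dots> = (\<Sum>l = 1..m. y l * cyc_ind y (m - l))"
  proof (rule sum.cong[OF refl])
    fix l assume l: "l \<in> {1..m}"
    have "(\<Sum>q\<in>partitions m. of_nat (l * Poly_Mapping.lookup q l) * \<tau> q)
        = (\<Sum>q\<in>{q \<in> partitions m. Poly_Mapping.lookup q l > 0}.
            of_nat (l * Poly_Mapping.lookup q l) * \<tau> q)"
      by (rule sum.mono_neutral_right) (auto simp: finite_partitions)
    also have "\<dots> = (\<Sum>q\<in>partitions (m - l).
        of_nat (l * Poly_Mapping.lookup (q + Poly_Mapping.single l 1) l) *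
        \<tau> (q + Poly_Mapping.single l 1))"
      by (rule sum.reindex_bij_betw[OF partitions_add_part[OF l], symmetric])
    also have "\<dots> = (\<Sum>q\<in>partitions (m - l). y l * \<tau> q)"
    proof (rule sum.cong[OF refl])
      fix q :: "nat \<Rightarrow>\<^sub>0 nat"
      let ?q = "q + Poly_Mapping.single l 1"
      have rest: "(\<Prod>i\<in>{1..m} - {l}. cyc_term y i (Poly_Mapping.lookup ?q i))
          = (\<Prod>i\<in>{1..m} - {l}. cyc_term y i (Poly_Mapping.lookup q i))"
        by (rule prod.cong) (auto simp: lookup_add lookup_single)
      have "of_nat (l * Poly_Mapping.lookup ?q l) * \<tau> ?q
          = (of_nat (l * Suc (Poly_Mapping.lookup q l)) * cyc_term y l (Suc (Poly_Mapping.lookup q l)))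
            * (\<Prod>i\<in>{1..m} - {l}. cyc_term y i (Poly_Mapping.lookup q i))"
        unfolding \<tau>_def using l rest
        by (subst prod.remove[of _ l]) (auto simp: lookup_add mult_ac)
      also have "\<dots> = y l * \<tau> q"
        unfolding \<tau>_def cyc_term_Suc[of l, OF l[unfolded atLeastAtMost_iff, THEN conjunct1, unfolded One_nat_def Suc_le_eq]]
        using l by (subst (2) prod.remove[of _ l]) (auto simp: mult_ac)
      finally show "of_nat (l * Poly_Mapping.lookup ?q l) * \<tau> ?q = y l * \<tau> q" .
    qed
    also have "\<dots> = y l * cyc_ind y (m - l)"
      by (simp add: cyc_ind_bound[of "m - l" m] \<tau>_def sum_distrib_left)
    finally show "(\<Sum>q\<in>partitions m. of_nat (l * Poly_Mapping.lookup q l) * \<tau> q)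
        = y l * cyc_ind y (m - l)" .
  qed
  finally show ?thesis .
qed

text \<open>Multiplication by a positive integer is injective on \<open>xpoly\<close>, so the
  recursion determines each value from the earlier ones.\<close>

lemma cyc_ind_unique:
  assumes "f 0 = 1" and rec: "\<And>m. m > 0 \<Longrightarrow> of_nat m * f m = (\<Sum>l = 1..m. y l * f (m - l))"
  shows "f m = cyc_ind y m"
proof (induction m rule: less_induct)
  case (less m)
  show ?case
  proof (cases "m = 0")
    case False
    have "of_nat m * f m = of_nat m * cyc_ind y m"
      unfolding cyc_ind_rec rec[OF False[unfolded neq0_conv]]
      by (rule sum.cong) (use less in auto)
    then show ?thesis using False by simp
  qed (use assms in simp)
qed

text \<open>Logarithmic differentiation: F = exp E satisfies F' = E' F, and in E' the factor 1/i
  cancels, leaving the inner cycle index as the i-th coefficient of the recursion.\<close>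

lemma Z_series_eq_cyc_ind:
  "fps_nth (Z_series d) n = cyc_ind (\<lambda>i. cyc_ind (\<lambda>l. xvar (i * l)) d) n"
proof (rule cyc_ind_unique[where f = "fps_nth (Z_series d)"])
  show "fps_nth (Z_series d) 0 = 1"
    by (simp add: Z_series_def exp_series_def)
next
  fix m :: nat assume m: "m > 0"
  define b where "b i = cyc_ind (\<lambda>l. xvar (i * l)) d" for i
  have E: "fps_nth (Z_exponent d) i = (if i = 0 then 0 else xconst (1 / of_nat i) * b i)" for i
    by (simp add: Z_exponent_def b_def cyc_ind_def cyc_term_def)
  have "fps_deriv exp_series = exp_series"
  proof (rule fps_ext)
    fix k
    have "xconst (1 / fact (Suc k)) = xconst (1 / of_nat (Suc k)) * xconst (1 / fact k)"
      by (simp flip: xconst_simps(3))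
    then have "of_nat (Suc k) * xconst (1 / fact (Suc k))
       = (of_nat (Suc k) * xconst (1 / of_nat (Suc k))) * xconst (1 / fact k)"
      by (simp only: mult_ac)
    then have "of_nat (Suc k) * xconst (1 / fact (Suc k)) = xconst (1 / fact k)"
      by (simp only: of_nat_xconst_inverse zero_less_Suc mult_1)
    then show "fps_nth (fps_deriv exp_series) k = fps_nth exp_series k"
      by (simp add: exp_series_def)
  qed
  then have "fps_deriv (Z_series d) = fps_deriv (Z_exponent d) * Z_series d"
    unfolding Z_series_def by (subst fps_compose_deriv) (simp_all add: E mult.commute)
  then have "fps_nth (fps_deriv (Z_series d)) (m - 1)
      = fps_nth (fps_deriv (Z_exponent d) * Z_series d) (m - 1)" by simp
  then have "of_nat m * fps_nth (Z_series d) m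
      = (\<Sum>i = 0..m - 1. of_nat (Suc i) * fps_nth (Z_exponent d) (Suc i)
           * fps_nth (Z_series d) (m - 1 - i))"
    using m by (simp add: fps_mult_nth)
  also have "\<dots> = (\<Sum>i = 0..m - 1. b (Suc i) * fps_nth (Z_series d) (m - Suc i))"
  proof (rule sum.cong[OF refl])
    fix i
    have "of_nat (Suc i) * fps_nth (Z_exponent d) (Suc i)
       = (of_nat (Suc i) * xconst (1 / of_nat (Suc i))) * b (Suc i)"
      by (simp only: E mult.assoc nat.distinct if_False)
    then have "of_nat (Suc i) * fps_nth (Z_exponent d) (Suc i) = b (Suc i)"
      by (simp only: of_nat_xconst_inverse zero_less_Suc mult_1)
    then show "of_nat (Suc i) * fps_nth (Z_exponent d) (Suc i) * fps_nth (Z_series d) (m - 1 - i)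
       = b (Suc i) * fps_nth (Z_series d) (m - Suc i)" by simp
  qed
  also have "\<dots> = (\<Sum>l = 1..m. b l * fps_nth (Z_series d) (m - l))"
    using m sum.shift_bounds_cl_Suc_ivl[of "\<lambda>l. b l * fps_nth (Z_series d) (m - l)" 0 "m - 1"]
    by simp
  finally show "of_nat m * fps_nth (Z_series d) m
      = (\<Sum>l = 1..m. b l * fps_nth (Z_series d) (m - l))" .
qed

text \<open>At the variables themselves different partitions give different monomials, so nothing is
  collected and each coefficient is a single reciprocal.\<close>

lemma lookup_cyc_ind_xvar:
  "Poly_Mapping.lookup (cyc_ind xvar m) p = (if p \<in> partitions m then 1 / of_nat (Sym m p) else 0)"
proof -
  have pw: "xvar l ^ k = Poly_Mapping.single (Poly_Mapping.single l k) 1" for l k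
    by (induction k) (simp_all add: xvar_def mult_single flip: single_add)
  have tm: "cyc_term xvar l k
     = Poly_Mapping.single (Poly_Mapping.single l k) (1 / of_nat (l ^ k * fact k))" for l k
  proof -
    have "xconst c ^ k = xconst (c ^ k)" for c by (induction k) simp_all
    then show ?thesis
      by (simp add: cyc_term_def power_mult_distrib pw)
        (simp add: xconst_def mult_single power_one_over)
  qed
  have "(\<Prod>l\<in>S. cyc_term xvar l (Poly_Mapping.lookup q l))
      = Poly_Mapping.single (\<Sum>l\<in>S. Poly_Mapping.single l (Poly_Mapping.lookup q l))
         (1 / of_nat (\<Prod>l\<in>S. l ^ Poly_Mapping.lookup q l * fact (Poly_Mapping.lookup q l)))"
    if "finite S" for S q
    using that by induction (simp_all add: tm mult_single)
  moreover have "(\<Sum>l = 1..m. Poly_Mapping.single l (Poly_Mapping.lookup q l)) = q"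
    if q: "q \<in> partitions m" for q
    using partitions_keys[OF q]
    by (intro poly_mapping_eqI) (auto simp: lookup_sum lookup_single when_def)
  ultimately have "cyc_ind xvar m = (\<Sum>q\<in>partitions m. Poly_Mapping.single q (1 / of_nat (Sym m q)))"
    by (simp add: cyc_ind_def Sym_def)
  then have "Poly_Mapping.lookup (cyc_ind xvar m) p
      = (\<Sum>q\<in>partitions m. if q = p then 1 / of_nat (Sym m q) else 0)"
    by (simp add: lookup_sum lookup_single when_def)
  also have "\<dots> = (if p \<in> partitions m then 1 / of_nat (Sym m p) else 0)"
    by (simp add: sum.delta' finite_partitions)
  finally show ?thesis .
qed

subsection \<open>Products over the cycles of a permutation\<close>

text \<open>The product runs over the set of orbits, so a cycle counts once whatever its length.
  With all weights 1 a cycle contributes \<open>y\<close> of its length; other weights arise when a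
  point also stands for points deleted before it.\<close>

definition cyc_prod :: "(nat \<Rightarrow> 'r::comm_monoid_mult) \<Rightarrow> ('a \<Rightarrow> nat) \<Rightarrow> 'a set \<Rightarrow> ('a \<Rightarrow> 'a) \<Rightarrow> 'r"
  where "cyc_prod y w A h = (\<Prod>c\<in>orbit h ` A. y (sum w c))"

lemma orbit_subset_invariant:
  assumes "h ` A \<subseteq> A" "x \<in> A"
  shows "orbit h x \<subseteq> A"
proof
  fix z assume "z \<in> orbit h x"
  then show "z \<in> A" by induction (use assms in auto)
qed

lemma orbit_permutes_self:
  assumes "finite A" "h permutes A"
  shows "x \<in> orbit h x"
  by (rule permutation_self_in_orbit, unfold permutation_permutes) (use assms in blast)

lemma orbit_permutes_eq:
  assumes "finite A" "h permutes A" "z \<in> orbit h x"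
  shows "orbit h z = orbit h x"
proof -
  have "permutation h" unfolding permutation_permutes using assms(1,2) by blast
  note eq = permutation_orbit_step[OF this]
  show ?thesis using assms(3) by induction (simp_all add: eq)
qed

lemma orbit_permutes_disjoint:
  assumes "finite A" "h permutes A" "z \<in> orbit h x" "z \<in> orbit h x'"
  shows "orbit h x = orbit h x'"
  using orbit_permutes_eq[OF assms(1,2)] assms(3,4) by metis

lemma cyc_prod_cong:
  assumes "h ` A \<subseteq> A" "\<And>x. x \<in> A \<Longrightarrow> h x = h' x" "\<And>x. x \<in> A \<Longrightarrow> w x = w' x"
  shows "cyc_prod y w A h = cyc_prod y w' A h'"
proof -
  have "orbit h x = orbit h' x" if "x \<in> A" for x
    by (rule orbit_cong0[OF that]) (use assms in auto)
  then have "orbit h ` A = orbit h' ` A" by (intro image_cong) auto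
  moreover have "sum w c = sum w' c" if "c \<in> orbit h ` A" for c
    using that orbit_subset_invariant[OF assms(1)] assms(3) by (intro sum.cong) auto
  ultimately show ?thesis unfolding cyc_prod_def by (intro prod.cong) auto
qed

lemma cyc_prod_Un:
  assumes "finite A" "finite B" "A \<inter> B = {}" "h permutes A \<union> B" "h ` A \<subseteq> A" "h ` B \<subseteq> B"
  shows "cyc_prod y w (A \<union> B) h = cyc_prod y w A h * cyc_prod y w B h"
proof -
  have "orbit h ` A \<inter> orbit h ` B = {}"
  proof (rule ccontr)
    assume "orbit h ` A \<inter> orbit h ` B \<noteq> {}"
    then obtain a b where ab: "a \<in> A" "b \<in> B" "orbit h a = orbit h b" by blast
    have "h a \<in> orbit h a" by (rule orbit.base)
    then show False
      using ab orbit_subset_invariant[OF assms(5) ab(1)] orbit_subset_invariant[OF assms(6) ab(2)]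
        assms(3) by blast
  qed
  then show ?thesis
    unfolding cyc_prod_def image_Un using assms(1,2) by (intro prod.union_disjoint) auto
qed

lemma cyc_prod_image:
  assumes inj: "inj_on f A" and h: "h ` A \<subseteq> A" and k: "\<And>x. x \<in> A \<Longrightarrow> k (f x) = f (h x)"
  shows "cyc_prod y w (f ` A) k = cyc_prod y (w \<circ> f) A h"
proof -
  have orb: "orbit k (f x) = f ` orbit h x" if x: "x \<in> A" for x
  proof -
    have sub: "orbit h x \<subseteq> A" by (rule orbit_subset_invariant[OF h x])
    have "z \<in> f ` orbit h x" if "z \<in> orbit k (f x)" for z
      using that
    proof induction
      case base
      show ?case using k[OF x] by (auto intro: orbit.base)
    next
      case (step z)
      then show ?case using k sub by (auto intro: orbit.step)
    qed
    moreover have "f z \<in> orbit k (f x)" if "z \<in> orbit h x" for z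
      using that
    proof induction
      case base
      show ?case using k[OF x] orbit.base[of k "f x"] by simp
    next
      case (step z)
      then show ?case using k[of z] sub orbit.step[of "f z" k "f x"] by auto
    qed
    ultimately show ?thesis by blast
  qed
  have "orbit k ` f ` A = (`) f ` (orbit h ` A)"
    using orb by (auto simp: image_image)
  moreover have "inj_on ((`) f) (orbit h ` A)"
    using orbit_subset_invariant[OF h] by (intro inj_onI) (metis (no_types, lifting) imageE inj inj_on_image_eq_iff)
  moreover have "sum w (f ` c) = sum (w \<circ> f) c" if "c \<in> orbit h ` A" for c
    using that orbit_subset_invariant[OF h] inj
    by (intro sum.reindex) (auto intro: inj_on_subset)
  ultimately show ?thesis
    unfolding cyc_prod_def by (simp add: prod.reindex)
qed

text \<open>Since no point of \<open>X\<close> is followed by another one, no cycle lies inside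
  \<open>X\<close>, and one further step of \<open>h\<close> always leaves \<open>X\<close>. So
  \<open>h'\<close> runs through the same cycles with \<open>X\<close> skipped, and handing each
  deleted weight to the next point preserves the total weight of every cycle.\<close>

lemma cyc_prod_contract:
  assumes fin: "finite A" and h: "h permutes A" and X: "X \<subseteq> A" "h ` X \<inter> X = {}"
    and h': "\<And>p. p \<in> A - X \<Longrightarrow> h' p = (if h p \<in> X then h (h p) else h p)"
    and w': "\<And>p. p \<in> A - X \<Longrightarrow> w' p = w p + sum w {x \<in> X. h x = p}"
  shows "cyc_prod y w A h = cyc_prod y w' (A - X) h'"
proof -
  note self = orbit_permutes_self[OF fin h]
  have subA: "orbit h p \<subseteq> A" if "p \<in> A" for p
    by (rule orbit_subset_invariant[OF _ that]) (simp add: permutes_image[OF h])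
  have orb: "orbit h' p = orbit h p - X" if p: "p \<in> A - X" for p
  proof -
    have sub: "z \<in> orbit h p - X \<and> z \<in> A" if "z \<in> orbit h' p" for z
      using that
    proof induction
      case base
      show ?case using h'[OF p] X subA[of p] p orbit.base[of h p] orbit.step[OF orbit.base, of h p]
        by auto
    next
      case (step z)
      then have "z \<in> A - X" by blast
      then show ?case using h'[of z] X subA[of p] p step orbit.step[of z h p] orbit.step[of "h z" h p]
        by auto
    qed
    \<comment> \<open>A deleted point never lies on an orbit of \<open>h'\<close>; the induction
      along \<open>h\<close> therefore records its successor in its place.\<close>
    have "(z \<notin> X \<longrightarrow> z \<in> orbit h' p) \<and> (z \<in> X \<longrightarrow> h z \<in> orbit h' p)" if "z \<in> orbit h p" for z
      using that
    proof induction
      case base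
      show ?case using h'[OF p] orbit.base[of h' p] X by auto
    next
      case (step z)
      have zA: "z \<in> A" using step.hyps subA p by blast
      show ?case
      proof (cases "z \<in> X")
        case True
        then show ?thesis using step.IH X by auto
      next
        case False
        then have z: "h' z \<in> orbit h' p" using step.IH by (auto intro: orbit.step)
        show ?thesis using h'[of z] z zA False X by (auto split: if_splits)
      qed
    qed
    then show ?thesis using sub by blast
  qed
  have "orbit h ` A = orbit h ` (A - X)"
  proof -
    have "orbit h x \<in> orbit h ` (A - X)" if x: "x \<in> X" for x
    proof -
      have "h x \<in> A - X" using x X permutes_in_image[OF h] by blast
      moreover have "orbit h (h x) = orbit h x" by (rule orbit_permutes_eq[OF fin h orbit.base])
      ultimately show ?thesis by (metis image_eqI)
    qed
    then show ?thesis using X by blast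
  qed
  then have img: "orbit h' ` (A - X) = (\<lambda>c. c - X) ` (orbit h ` A)"
    using orb by (simp add: image_image)
  have inj: "inj_on (\<lambda>c. c - X) (orbit h ` A)"
    unfolding \<open>orbit h ` A = orbit h ` (A - X)\<close>
  proof (rule inj_onI)
    fix c c' assume c: "c \<in> orbit h ` (A - X)" "c' \<in> orbit h ` (A - X)" "c - X = c' - X"
    then obtain p p' where p: "c = orbit h p" "c' = orbit h p'" "p \<in> A - X" by blast
    then have "p \<in> c - X" using self[of p] by blast
    then show "c = c'" using c p orbit_permutes_disjoint[OF fin h, of p p p'] by blast
  qed
  have "sum w' (c - X) = sum w c" if c: "c \<in> orbit h ` A" for c
  proof -
    obtain q where q: "q \<in> A" "c = orbit h q" using c by blast
    have cA: "c \<subseteq> A" using c subA by blast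
    then have finc: "finite c" using fin finite_subset by blast
    have inc: "h x \<in> c" if "x \<in> c" for x using that q by (auto intro: orbit.step)
    have incD: "x \<in> c" if "h x \<in> c" for x
      using that q self orbit_permutes_eq[OF fin h, of "h x" q] orbit_permutes_eq[OF fin h orbit.base, of x]
      by metis
    have "sum w' (c - X) = sum w (c - X) + (\<Sum>p\<in>c - X. sum w {x \<in> X \<inter> c. h x = p})"
      unfolding sum.distrib[symmetric]
    proof (rule sum.cong[OF refl])
      fix p assume p: "p \<in> c - X"
      have "{x \<in> X. h x = p} = {x \<in> X \<inter> c. h x = p}" using p incD by auto
      then show "w' p = w p + sum w {x \<in> X \<inter> c. h x = p}" using p cA w'[of p] by auto
    qed
    also have "(\<Sum>p\<in>c - X. sum w {x \<in> X \<inter> c. h x = p}) = sum w (X \<inter> c)"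
      by (rule sum.group) (use finc inc X in auto)
    also have "sum w (c - X) + sum w (X \<inter> c) = sum w c"
      using sum.Int_Diff[OF finc, of w X] by (simp add: Int_commute add.commute)
    finally show ?thesis .
  qed
  then show ?thesis
    unfolding cyc_prod_def img by (subst prod.reindex[OF inj]) (intro prod.cong refl, simp)
qed

text \<open>A cycle through l points of weight i has total weight \<open>i * l\<close>; this is
  where the variables x_(il) of the generating series originate.\<close>

lemma cyc_prod_const_weight:
  "cyc_prod y (\<lambda>_. i) A h = cyc_prod (\<lambda>l. y (i * l)) (\<lambda>_. 1) A h"
  by (simp add: cyc_prod_def mult.commute)

section \<open>Weighted cycle sums over a symmetric group\<close>

definition cyc_sum :: "(nat \<Rightarrow> 'r::comm_semiring_1) \<Rightarrow> 'a set \<Rightarrow> ('a \<Rightarrow> nat) \<Rightarrow> 'r" where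
  "cyc_sum y A w = (\<Sum>h | h permutes A. cyc_prod y w A h)"

text \<open>Every permutation of \<open>insert a A\<close> is \<open>transpose a b \<circ> q\<close>
  with \<open>q\<close> a permutation of \<open>A\<close>. For b = a the new point is a cycle of its
  own. Otherwise it is inserted into a cycle of \<open>q\<close> immediately before b, and
  contracting it returns \<open>q\<close> with the weight of \<open>a\<close> passed on to
  b.\<close>

lemma cyc_sum_insert:
  assumes fin: "finite A" and a: "a \<notin> A"
  shows "cyc_sum y (insert a A) w = y (w a) * cyc_sum y A w
    + (\<Sum>b\<in>A. cyc_sum y A (w(b := w b + w a)))"
proof -
  have "cyc_sum y (insert a A) w
    = (\<Sum>q | q permutes A. cyc_prod y w (insert a A) (transpose a a \<circ> q))
    + (\<Sum>b\<in>A. \<Sum>q | q permutes A. cyc_prod y w (insert a A) (transpose a b \<circ> q))"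
    unfolding cyc_sum_def sum_over_permutations_insert[OF fin a] using fin a by simp
  also have "(\<Sum>q | q permutes A. cyc_prod y w (insert a A) (transpose a a \<circ> q))
     = y (w a) * cyc_sum y A w"
    unfolding cyc_sum_def sum_distrib_left
  proof (rule sum.cong[OF refl], clarify)
    fix q assume q: "q permutes A"
    then have qa: "q a = a" using a by (simp add: permutes_not_in)
    have "q permutes {a} \<union> A" using q by (rule permutes_subset) auto
    then have "cyc_prod y w ({a} \<union> A) q = cyc_prod y w {a} q * cyc_prod y w A q"
      using fin a qa permutes_image[OF q] by (intro cyc_prod_Un) auto
    moreover have "orbit q a = {a}" using qa by (simp add: orbit_eq_singleton_iff)
    ultimately show "cyc_prod y w (insert a A) (transpose a a \<circ> q) = y (w a) * cyc_prod y w A q"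
      by (simp add: cyc_prod_def)
  qed
  also have "(\<Sum>b\<in>A. \<Sum>q | q permutes A. cyc_prod y w (insert a A) (transpose a b \<circ> q))
     = (\<Sum>b\<in>A. cyc_sum y A (w(b := w b + w a)))"
    unfolding cyc_sum_def
  proof (intro sum.cong[OF refl], clarify)
    fix b q assume b: "b \<in> A" and q: "q permutes A"
    let ?h = "transpose a b \<circ> q"
    have ab: "a \<noteq> b" using a b by blast
    have qa: "q a = a" using a q by (simp add: permutes_not_in)
    have h: "?h permutes insert a A"
      using b q by (intro permutes_compose permutes_swap_id) (auto intro: permutes_subset)
    have "cyc_prod y w (insert a A) ?h = cyc_prod y (w(b := w b + w a)) (insert a A - {a}) q"
    proof (rule cyc_prod_contract[OF _ h])
      fix p assume p: "p \<in> insert a A - {a}"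
      then have "q p \<in> A" "q p \<noteq> a" using permutes_in_image[OF q] a by auto
      then show "q p = (if ?h p \<in> {a} then ?h (?h p) else ?h p)"
        using qa ab by (auto simp: transpose_def)
      have "{x \<in> {a}. ?h x = p} = (if p = b then {a} else {})" using qa by auto
      then show "(w(b := w b + w a)) p = w p + sum w {x \<in> {a}. ?h x = p}" by simp
    qed (use fin qa ab in auto)
    then show "cyc_prod y w (insert a A) ?h = cyc_prod y (w(b := w b + w a)) A q"
      using a by simp
  qed
  finally show ?thesis .
qed

subsection \<open>Permutations respecting blocks\<close>

definition block_perms :: "'a set \<Rightarrow> 'b set \<Rightarrow> ('a \<times> 'b \<Rightarrow> 'a \<times> 'b) set" where
  "block_perms A F = {h. h permutes A \<times> F \<and>
     (\<forall>a\<in>A. \<forall>\<alpha>\<in>F. \<forall>\<beta>\<in>F. fst (h (a, \<alpha>)) = fst (h (a, \<beta>)))}"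

lemma block_permsI:
  assumes "h permutes A \<times> F"
    and "\<And>a \<alpha> \<beta>. a \<in> A \<Longrightarrow> \<alpha> \<in> F \<Longrightarrow> \<beta> \<in> F \<Longrightarrow> fst (h (a, \<alpha>)) = fst (h (a, \<beta>))"
  shows "h \<in> block_perms A F"
  unfolding block_perms_def mem_Collect_eq by (intro conjI ballI assms)

lemma block_perms_permutes: "h \<in> block_perms A F \<Longrightarrow> h permutes A \<times> F"
  unfolding block_perms_def by blast

lemma block_perms_fst:
  "h \<in> block_perms A F \<Longrightarrow> a \<in> A \<Longrightarrow> \<alpha> \<in> F \<Longrightarrow> \<beta> \<in> F \<Longrightarrow> fst (h (a, \<alpha>)) = fst (h (a, \<beta>))"
  unfolding block_perms_def by blast

text \<open>For a \<noteq> b this is an involution exchanging two blocks. For a = b the first test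
  wins and \<delta> acts inside the block. Exchanging a with b and inverting \<delta> gives the
  inverse in both cases, so no case distinction is needed later.\<close>

definition block_swap :: "'b set \<Rightarrow> 'a \<Rightarrow> 'a \<Rightarrow> ('b \<Rightarrow> 'b) \<Rightarrow> 'a \<times> 'b \<Rightarrow> 'a \<times> 'b" where
  "block_swap F a b \<delta> = (\<lambda>(c, \<alpha>). if \<alpha> \<in> F \<and> c = a then (b, \<delta> \<alpha>)
     else if \<alpha> \<in> F \<and> c = b then (a, inv_into UNIV \<delta> \<alpha>) else (c, \<alpha>))"

lemma block_swap_inverse:
  assumes "\<delta> permutes F"
  shows "block_swap F a b \<delta> \<circ> block_swap F b a (inv_into UNIV \<delta>) = id"
proof -
  note d = permutes_inverses[OF assms] permutes_in_image[OF assms]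
    permutes_in_image[OF permutes_inv[OF assms]] permutes_inv_inv[OF assms]
  show ?thesis
    by (auto simp: block_swap_def fun_eq_iff d)
qed

lemma block_swap_inverse':
  assumes "\<delta> permutes F"
  shows "block_swap F b a (inv_into UNIV \<delta>) \<circ> block_swap F a b \<delta> = id"
  using block_swap_inverse[OF permutes_inv[OF assms], of b a] by (simp add: permutes_inv_inv[OF assms])

lemma block_swap_permutes:
  assumes "\<delta> permutes F" "a \<in> A" "b \<in> A"
  shows "block_swap F a b \<delta> permutes A \<times> F"
proof (rule bij_imp_permutes)
  have maps: "block_swap F a b \<delta> \<in> A \<times> F \<rightarrow> A \<times> F" if "\<delta> permutes F" "a \<in> A" "b \<in> A" for \<delta> a b
    using that permutes_in_image[OF that(1)] permutes_in_image[OF permutes_inv[OF that(1)]]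
    by (auto simp: block_swap_def)
  show "bij_betw (block_swap F a b \<delta>) (A \<times> F) (A \<times> F)"
  proof (rule bij_betw_byWitness[where f' = "block_swap F b a (inv_into UNIV \<delta>)"])
    show "\<forall>x\<in>A \<times> F. block_swap F b a (inv_into UNIV \<delta>) (block_swap F a b \<delta> x) = x"
      using block_swap_inverse'[OF assms(1), THEN fun_cong, of b a] by simp
    show "\<forall>x\<in>A \<times> F. block_swap F a b \<delta> (block_swap F b a (inv_into UNIV \<delta>) x) = x"
      using block_swap_inverse[OF assms(1), THEN fun_cong, of a b] by simp
  qed (rule funcset_image[OF maps[OF assms]]
      funcset_image[OF maps[OF permutes_inv[OF assms(1)] assms(3,2)]])+
  show "block_swap F a b \<delta> x = x" if "x \<notin> A \<times> F" for x
    using that assms(2,3) by (cases x) (auto simp: block_swap_def)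
qed

lemma block_swap_fst:
  "\<alpha> \<in> F \<Longrightarrow> \<beta> \<in> F \<Longrightarrow> fst (block_swap F a b \<delta> (c, \<alpha>)) = fst (block_swap F a b \<delta> (c, \<beta>))"
  by (auto simp: block_swap_def)

lemma block_perms_in:
  assumes "h \<in> block_perms A F" "a \<in> A" "\<alpha> \<in> F"
  shows "fst (h (a, \<alpha>)) \<in> A" "snd (h (a, \<alpha>)) \<in> F"
proof -
  have "h (a, \<alpha>) \<in> A \<times> F"
    using assms permutes_in_image[OF block_perms_permutes[OF assms(1)]] by blast
  then show "fst (h (a, \<alpha>)) \<in> A" "snd (h (a, \<alpha>)) \<in> F" by auto
qed

lemma block_perms_comp:
  assumes "h \<in> block_perms A F" "k \<in> block_perms A F"
  shows "h \<circ> k \<in> block_perms A F"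
proof (rule block_permsI)
  show "h \<circ> k permutes A \<times> F"
    using assms by (intro permutes_compose block_perms_permutes)
next
  fix a \<alpha> \<beta> assume a: "a \<in> A" "\<alpha> \<in> F" "\<beta> \<in> F"
  have eq: "fst (k (a, \<alpha>)) = fst (k (a, \<beta>))" by (rule block_perms_fst[OF assms(2) a])
  have "fst (h (k (a, \<alpha>))) = fst (h (fst (k (a, \<alpha>)), snd (k (a, \<beta>))))"
    using block_perms_fst[OF assms(1) block_perms_in(1)[OF assms(2) a(1,2)]
        block_perms_in(2)[OF assms(2) a(1,2)] block_perms_in(2)[OF assms(2) a(1,3)]] by simp
  then show "fst ((h \<circ> k) (a, \<alpha>)) = fst ((h \<circ> k) (a, \<beta>))" unfolding eq by simp
qed

lemma block_perms_mono:
  assumes "h \<in> block_perms A F" "A \<subseteq> B"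
  shows "h \<in> block_perms B F"
proof -
  have h: "h permutes A \<times> F" using assms(1) by (rule block_perms_permutes)
  have out: "h (a, \<alpha>) = (a, \<alpha>)" if "a \<notin> A" for a \<alpha>
    using permutes_not_in[OF h] that by auto
  show ?thesis
  proof (rule block_permsI)
    show "h permutes B \<times> F" using h assms(2) by (auto intro: permutes_subset)
    fix a \<alpha> \<beta> assume "\<alpha> \<in> F" "\<beta> \<in> F"
    then show "fst (h (a, \<alpha>)) = fst (h (a, \<beta>))"
      using block_perms_fst[OF assms(1), of a \<alpha> \<beta>] out[of a] by (cases "a \<in> A") auto
  qed
qed

lemma block_swap_in_block_perms:
  assumes "\<delta> permutes F" "a \<in> A" "b \<in> A"
  shows "block_swap F a b \<delta> \<in> block_perms A F"
  using block_swap_permutes[OF assms] block_swap_fst by (rule block_permsI)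

text \<open>A coset decomposition for the pointwise stabilizer of block \<open>a\<close>: the pair
  (b, \<delta>) records where the block goes and how its points are permuted on the way, and undoing
  this leaves a block permutation that moves only the blocks in \<open>A\<close>.\<close>

lemma block_perms_insert:
  assumes fin: "finite F" and ne: "F \<noteq> {}" and a: "a \<notin> A"
  shows "bij_betw (\<lambda>(b, \<delta>, h). block_swap F a b \<delta> \<circ> h)
    (insert a A \<times> {\<delta>. \<delta> permutes F} \<times> block_perms A F) (block_perms (insert a A) F)"
proof (rule bij_betw_byWitness[where f' = "\<lambda>h.
    let b = fst (h (a, SOME \<alpha>. \<alpha> \<in> F)); \<delta> = (\<lambda>\<alpha>. if \<alpha> \<in> F then snd (h (a, \<alpha>)) else \<alpha>)
    in (b, \<delta>, block_swap F b a (inv_into UNIV \<delta>) \<circ> h)"])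
  \<comment> \<open>All points of block \<open>a\<close> have images in the same block, so any
    element of \<open>F\<close> may be used to read off b. Outside \<open>F\<close> the map \<delta>
    is completed by the identity, as \<open>permutes\<close> demands.\<close>
  define \<alpha>0 where "\<alpha>0 = (SOME \<alpha>. \<alpha> \<in> F)"
  have \<alpha>0: "\<alpha>0 \<in> F" unfolding \<alpha>0_def using ne by (simp add: some_in_eq)
  show "\<forall>x\<in>insert a A \<times> {\<delta>. \<delta> permutes F} \<times> block_perms A F.
     (let b = fst ((case x of (b, \<delta>, h) \<Rightarrow> block_swap F a b \<delta> \<circ> h) (a, SOME \<alpha>. \<alpha> \<in> F));
          \<delta> = \<lambda>\<alpha>. if \<alpha> \<in> F then snd ((case x of (b, \<delta>, h) \<Rightarrow> block_swap F a b \<delta> \<circ> h) (a, \<alpha>)) else \<alpha>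
      in (b, \<delta>, block_swap F b a (inv_into UNIV \<delta>) \<circ> (case x of (b, \<delta>, h) \<Rightarrow> block_swap F a b \<delta> \<circ> h))) = x"
    unfolding \<alpha>0_def[symmetric]
  proof clarify
    fix b \<delta> h assume d: "\<delta> permutes F" and h: "h \<in> block_perms A F"
    have "h permutes A \<times> F" using h by (rule block_perms_permutes)
    then have ha: "h (a, \<alpha>) = (a, \<alpha>)" for \<alpha> using permutes_not_in a by fastforce
    have d': "(\<lambda>\<alpha>. if \<alpha> \<in> F then snd ((block_swap F a b \<delta> \<circ> h) (a, \<alpha>)) else \<alpha>) = \<delta>"
      using permutes_not_in[OF d] by (auto simp: ha block_swap_def fun_eq_iff)
    have "block_swap F b a (inv_into UNIV \<delta>) \<circ> (block_swap F a b \<delta> \<circ> h) = h"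
      using block_swap_inverse'[OF d, of b a] by (simp flip: comp_assoc)
    then show "(let b' = fst ((block_swap F a b \<delta> \<circ> h) (a, \<alpha>0));
          \<delta>' = \<lambda>\<alpha>. if \<alpha> \<in> F then snd ((block_swap F a b \<delta> \<circ> h) (a, \<alpha>)) else \<alpha>
      in (b', \<delta>', block_swap F b' a (inv_into UNIV \<delta>') \<circ> (block_swap F a b \<delta> \<circ> h))) = (b, \<delta>, h)"
      unfolding d' Let_def using \<alpha>0 by (simp add: ha block_swap_def)
  qed
  show "(\<lambda>(b, \<delta>, h). block_swap F a b \<delta> \<circ> h) ` (insert a A \<times> {\<delta>. \<delta> permutes F} \<times> block_perms A F)
    \<subseteq> block_perms (insert a A) F"
    by (auto intro!: block_perms_comp block_swap_in_block_perms
        intro: block_perms_mono[OF _ subset_insertI])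
  have key: "b \<in> insert a A \<and> \<delta> permutes F \<and> block_swap F b a (inv_into UNIV \<delta>) \<circ> h \<in> block_perms A F"
    if h: "h \<in> block_perms (insert a A) F" and b: "b = fst (h (a, \<alpha>0))"
      and \<delta>: "\<delta> = (\<lambda>\<alpha>. if \<alpha> \<in> F then snd (h (a, \<alpha>)) else \<alpha>)" for h b \<delta>
  proof -
    have hp: "h permutes insert a A \<times> F" using h by (rule block_perms_permutes)
    have bA: "b \<in> insert a A" using block_perms_in(1)[OF h _ \<alpha>0, of a] b by simp
    have "fst (h (a, \<alpha>)) = b" if "\<alpha> \<in> F" for \<alpha>
      unfolding b by (rule block_perms_fst[OF h _ that \<alpha>0]) simp
    then have ha: "h (a, \<alpha>) = (b, \<delta> \<alpha>)" if "\<alpha> \<in> F" for \<alpha>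
      using that by (simp add: \<delta> prod_eq_iff)
    have "inj_on \<delta> F"
    proof (rule inj_onI)
      fix \<alpha> \<beta> assume "\<alpha> \<in> F" "\<beta> \<in> F" "\<delta> \<alpha> = \<delta> \<beta>"
      then have "h (a, \<alpha>) = h (a, \<beta>)" by (simp add: ha)
      then show "\<alpha> = \<beta>" using permutes_inj[OF hp] by (auto dest: injD)
    qed
    moreover have "\<delta> ` F \<subseteq> F" using block_perms_in(2)[OF h] by (auto simp: \<delta>)
    ultimately have d: "\<delta> permutes F"
      using fin by (intro bij_imp_permutes) (simp_all add: bij_betw_def endo_inj_surj, simp add: \<delta>)
    let ?k = "block_swap F b a (inv_into UNIV \<delta>) \<circ> h"
    have k: "?k \<in> block_perms (insert a A) F"
      by (rule block_perms_comp[OF block_swap_in_block_perms h]) (use permutes_inv[OF d] bA in auto)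
    have "?k permutes A \<times> F"
    proof (rule permutes_superset)
      show "?k permutes insert a A \<times> F" using k by (rule block_perms_permutes)
      fix x assume x: "x \<in> insert a A \<times> F - A \<times> F"
      then obtain \<alpha> where "x = (a, \<alpha>)" "\<alpha> \<in> F" by auto
      then show "?k x = x"
        using permutes_in_image[OF d] permutes_inverses[OF d] by (simp add: ha block_swap_def)
    qed
    then have "?k \<in> block_perms A F" by (rule block_permsI) (rule block_perms_fst[OF k], auto)
    then show ?thesis using bA d by blast
  qed
  show "(\<lambda>h. let b = fst (h (a, SOME \<alpha>. \<alpha> \<in> F)); \<delta> = \<lambda>\<alpha>. if \<alpha> \<in> F then snd (h (a, \<alpha>)) else \<alpha>
      in (b, \<delta>, block_swap F b a (inv_into UNIV \<delta>) \<circ> h)) ` block_perms (insert a A) F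
    \<subseteq> insert a A \<times> {\<delta>. \<delta> permutes F} \<times> block_perms A F"
    unfolding \<alpha>0_def[symmetric] Let_def
    by (rule image_subsetI, drule key[OF _ refl refl]) simp
  show "\<forall>h\<in>block_perms (insert a A) F.
     (case let b = fst (h (a, SOME \<alpha>. \<alpha> \<in> F)); \<delta> = \<lambda>\<alpha>. if \<alpha> \<in> F then snd (h (a, \<alpha>)) else \<alpha>
           in (b, \<delta>, block_swap F b a (inv_into UNIV \<delta>) \<circ> h) of
       (b, \<delta>, h) \<Rightarrow> block_swap F a b \<delta> \<circ> h) = h"
    unfolding \<alpha>0_def[symmetric] Let_def prod.case
  proof
    fix h assume h: "h \<in> block_perms (insert a A) F"
    let ?b = "fst (h (a, \<alpha>0))" and ?d = "\<lambda>\<alpha>. if \<alpha> \<in> F then snd (h (a, \<alpha>)) else \<alpha>"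
    have "?d permutes F" using key[OF h refl refl] by blast
    then have "block_swap F a ?b ?d \<circ> block_swap F ?b a (inv_into UNIV ?d) = id"
      by (rule block_swap_inverse)
    then show "block_swap F a ?b ?d \<circ> (block_swap F ?b a (inv_into UNIV ?d) \<circ> h) = h"
      by (simp only: comp_assoc[symmetric] id_comp)
  qed
qed

section \<open>Weighted cycle sums over block permutations\<close>

definition block_cyc_sum ::
    "(nat \<Rightarrow> 'r::comm_semiring_1) \<Rightarrow> 'b set \<Rightarrow> 'a set \<Rightarrow> ('a \<Rightarrow> nat) \<Rightarrow> 'r" where
  "block_cyc_sum y F A w = (\<Sum>h\<in>block_perms A F. cyc_prod y (w \<circ> fst) (A \<times> F) h)"

text \<open>If block \<open>a\<close> is mapped to itself, its cycles are those of \<delta> on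
  points of weight \<open>w a\<close>, and they split off as a factor. If it is mapped to another
  block b, the whole block is contracted at once: its image does not meet it, each point of b
  receives weight \<open>w a\<close>, and the result no longer depends on \<delta>, whence the
  factorial.\<close>

lemma block_cyc_sum_insert:
  assumes finA: "finite A" and fin: "finite F" and ne: "F \<noteq> {}" and a: "a \<notin> A"
  shows "block_cyc_sum y F (insert a A) w
    = cyc_sum y F (\<lambda>_. w a) * block_cyc_sum y F A w
      + fact (card F) * (\<Sum>b\<in>A. block_cyc_sum y F A (w(b := w b + w a)))"
proof -
  define C where "C h = cyc_prod y (w \<circ> fst) (insert a A \<times> F) h" for h
  have finX: "finite (insert a A \<times> F)" using finA fin by (intro finite_cartesian_product) auto
  have same: "C (block_swap F a a \<delta> \<circ> h)
      = cyc_prod y (\<lambda>_. w a) F \<delta> * cyc_prod y (w \<circ> fst) (A \<times> F) h"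
    if d: "\<delta> permutes F" and h: "h \<in> block_perms A F" for \<delta> h
  proof -
    let ?k = "block_swap F a a \<delta> \<circ> h"
    have hp: "h permutes A \<times> F" using h by (rule block_perms_permutes)
    have ha: "h (a, \<alpha>) = (a, \<alpha>)" for \<alpha> using permutes_not_in[OF hp] a by fastforce
    have kA: "?k x = h x" if "x \<in> A \<times> F" for x
    proof -
      have "h x \<in> A \<times> F" using that permutes_in_image[OF hp] by blast
      then show ?thesis using a by (auto simp: block_swap_def split: prod.splits)
    qed
    have ka: "?k (a, \<alpha>) = (a, \<delta> \<alpha>)" if "\<alpha> \<in> F" for \<alpha>
      using that by (simp add: ha block_swap_def)
    have "h permutes insert a A \<times> F" using hp by (rule permutes_subset) auto
    then have kp: "?k permutes ({a} \<times> F) \<union> (A \<times> F)"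
      using permutes_compose[OF _ block_swap_permutes[OF d insertI1 insertI1]]
      by (simp add: Sigma_Un_distrib1[symmetric])
    have "cyc_prod y (w \<circ> fst) (({a} \<times> F) \<union> (A \<times> F)) ?k
       = cyc_prod y (w \<circ> fst) ({a} \<times> F) ?k * cyc_prod y (w \<circ> fst) (A \<times> F) ?k"
    proof (rule cyc_prod_Un[OF _ _ _ kp])
      show "?k ` (A \<times> F) \<subseteq> A \<times> F"
        using kA permutes_in_image[OF hp] by (metis image_subsetI)
      show "?k ` ({a} \<times> F) \<subseteq> {a} \<times> F"
        using ka permutes_in_image[OF d] by (auto simp del: comp_apply)
    qed (use fin finA a in auto)
    also have "cyc_prod y (w \<circ> fst) (A \<times> F) ?k = cyc_prod y (w \<circ> fst) (A \<times> F) h"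
    proof (rule cyc_prod_cong[symmetric])
      show "h ` (A \<times> F) \<subseteq> A \<times> F" by (simp add: permutes_image[OF hp])
    qed (simp_all only: kA)
    also have "cyc_prod y (w \<circ> fst) ({a} \<times> F) ?k = cyc_prod y (\<lambda>_. w a) F \<delta>"
    proof -
      have "cyc_prod y (w \<circ> fst) (Pair a ` F) ?k = cyc_prod y ((w \<circ> fst) \<circ> Pair a) F \<delta>"
        by (rule cyc_prod_image) (auto simp: inj_on_def ka[unfolded o_def] permutes_in_image[OF d])
      moreover have "Pair a ` F = {a} \<times> F" by auto
      ultimately show ?thesis by (simp add: comp_def)
    qed
    also have "({a} \<times> F) \<union> (A \<times> F) = insert a A \<times> F" by auto
    finally show ?thesis unfolding C_def .
  qed
  have other: "C (block_swap F a b \<delta> \<circ> h)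
      = cyc_prod y (w(b := w b + w a) \<circ> fst) (A \<times> F) h"
    if d: "\<delta> permutes F" and h: "h \<in> block_perms A F" and b: "b \<in> A" for \<delta> h b
  proof -
    let ?k = "block_swap F a b \<delta> \<circ> h" and ?X = "{a} \<times> F"
    have ab: "a \<noteq> b" using a b by blast
    have hp: "h permutes A \<times> F" using h by (rule block_perms_permutes)
    have ha: "h (a, \<alpha>) = (a, \<alpha>)" for \<alpha> using permutes_not_in[OF hp] a by fastforce
    have ka: "?k (a, \<alpha>) = (b, \<delta> \<alpha>)" if "\<alpha> \<in> F" for \<alpha>
      using that by (simp add: ha block_swap_def)
    have "h permutes insert a A \<times> F" using hp by (rule permutes_subset) auto
    then have kp: "?k permutes insert a A \<times> F"
      using permutes_compose[OF _ block_swap_permutes[OF d, of a "insert a A" b]] b by simp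
    note d' = permutes_inverses[OF d] permutes_in_image[OF d] permutes_in_image[OF permutes_inv[OF d]]
    have "cyc_prod y (w \<circ> fst) (insert a A \<times> F) ?k
        = cyc_prod y (w(b := w b + w a) \<circ> fst) (insert a A \<times> F - ?X) h"
    proof (rule cyc_prod_contract[OF finX kp])
      show "?k ` ?X \<inter> ?X = {}" using ka ab by force
      fix p assume p: "p \<in> insert a A \<times> F - ?X"
      then have "h p \<in> A \<times> F" using permutes_in_image[OF hp] by auto
      then obtain c \<alpha> where c: "h p = (c, \<alpha>)" "c \<in> A" "\<alpha> \<in> F" "c \<noteq> a" using a by (cases "h p") auto
      then show "h p = (if ?k p \<in> ?X then ?k (?k p) else ?k p)"
        using ab d' by (auto simp: block_swap_def ha)
      obtain e \<beta> where e: "p = (e, \<beta>)" "\<beta> \<in> F" using p by auto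
      have "{x \<in> ?X. ?k x = p} = (if e = b then {(a, inv_into UNIV \<delta> \<beta>)} else {})"
        using e d' ka by (auto simp del: comp_apply)
      then show "(w(b := w b + w a) \<circ> fst) p = (w \<circ> fst) p + sum (w \<circ> fst) {x \<in> ?X. ?k x = p}"
        using e by simp
    qed (use b in auto)
    moreover have "insert a A \<times> F - ?X = A \<times> F" using a by auto
    ultimately show ?thesis by (simp add: C_def)
  qed
  have "block_cyc_sum y F (insert a A) w
    = (\<Sum>(b, \<delta>, h)\<in>insert a A \<times> {\<delta>. \<delta> permutes F} \<times> block_perms A F. C (block_swap F a b \<delta> \<circ> h))"
    unfolding block_cyc_sum_def C_def[symmetric]
    by (subst sum.reindex_bij_betw[OF block_perms_insert[OF fin ne a], symmetric])
      (simp add: split_beta)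
  also have "\<dots> = (\<Sum>b\<in>insert a A. \<Sum>\<delta> | \<delta> permutes F. \<Sum>h\<in>block_perms A F. C (block_swap F a b \<delta> \<circ> h))"
    by (simp add: sum.cartesian_product)
  also have "\<dots> = (\<Sum>\<delta> | \<delta> permutes F. \<Sum>h\<in>block_perms A F. C (block_swap F a a \<delta> \<circ> h))
     + (\<Sum>b\<in>A. \<Sum>\<delta> | \<delta> permutes F. \<Sum>h\<in>block_perms A F. C (block_swap F a b \<delta> \<circ> h))"
    using finA a by simp
  also have "(\<Sum>\<delta> | \<delta> permutes F. \<Sum>h\<in>block_perms A F. C (block_swap F a a \<delta> \<circ> h))
     = cyc_sum y F (\<lambda>_. w a) * block_cyc_sum y F A w"
    unfolding cyc_sum_def block_cyc_sum_def sum_product by (intro sum.cong refl same) auto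
  also have "(\<Sum>b\<in>A. \<Sum>\<delta> | \<delta> permutes F. \<Sum>h\<in>block_perms A F. C (block_swap F a b \<delta> \<circ> h))
     = (\<Sum>b\<in>A. \<Sum>\<delta> | \<delta> permutes F. block_cyc_sum y F A (w(b := w b + w a)))"
    unfolding block_cyc_sum_def by (intro sum.cong refl other) auto
  also have "\<dots> = fact (card F) * (\<Sum>b\<in>A. block_cyc_sum y F A (w(b := w b + w a)))"
    by (simp add: card_permutations[OF refl fin] sum_distrib_left)
  finally show ?thesis .
qed

text \<open>Removing the points of the cycle through \<open>a\<close> one by one moves their weight to the next point,
  so that a cycle of length \<open>i\<close> finally contributes \<open>y i\<close>.\<close>

lemma contraction_recursion:
  fixes f :: "'a set \<Rightarrow> ('a \<Rightarrow> nat) \<Rightarrow> xpoly"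
  assumes empty: "\<And>w. f {} w = 1"
    and insert: "\<And>a A w. finite A \<Longrightarrow> a \<notin> A \<Longrightarrow>
      f (insert a A) w = K * (y (w a) * f A w + (\<Sum>b\<in>A. f A (w(b := w b + w a))))"
    and cong: "\<And>A w w'. (\<And>a. a \<in> A \<Longrightarrow> w a = w' a) \<Longrightarrow> f A w = f A w'"
    and fin: "finite A"
  shows "f A (\<lambda>_. 1) = K ^ card A * fact (card A) * cyc_ind y (card A)"
proof -
  \<comment> \<open>Contracting a point of weight 1 makes its successor heavier, so constant weights
    are not preserved, but one marked point with weight \<open>Suc j\<close> is. In the sum, i is
    the length of the cycle through the marked point, whose total weight is then
    \<open>i + j\<close>.\<close>
  have "(\<forall>a\<in>A. \<forall>j. f A ((\<lambda>_. 1)(a := Suc j)) = K ^ card A * fact (card A - 1)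
        * (\<Sum>i = 1..card A. y (i + j) * cyc_ind y (card A - i)))
    \<and> f A (\<lambda>_. 1) = K ^ card A * fact (card A) * cyc_ind y (card A)"
    using fin
  proof (induction "card A" arbitrary: A rule: less_induct)
    case less
    define W where "W = cyc_ind y"
    have marked: "f A ((\<lambda>_. 1)(a := Suc j)) = K ^ card A * fact (card A - 1)
        * (\<Sum>i = 1..card A. y (i + j) * cyc_ind y (card A - i))" if a: "a \<in> A" for a j
    proof -
      define B where "B = A - {a}"
      define m where "m = card B"
      have B: "A = insert a B" "a \<notin> B" "finite B"
        using a less.prems by (auto simp: B_def)
      have cA: "card A = Suc m" unfolding B(1) m_def using B(2,3) by simp
      have "f A ((\<lambda>_. 1)(a := Suc j)) = K * (y (Suc j) * f B ((\<lambda>_. 1)(a := Suc j))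
          + (\<Sum>b\<in>B. f B (((\<lambda>_. 1)(a := Suc j))(b := ((\<lambda>_. 1)(a := Suc j)) b + Suc j))))"
        unfolding B(1) by (subst insert[OF B(3,2)]) simp
      also have "f B ((\<lambda>_. 1)(a := Suc j)) = f B (\<lambda>_. 1)" by (rule cong) (use B(2) in auto)
      also have "f B (\<lambda>_. 1) = K ^ m * fact m * W m"
        unfolding m_def W_def using less.hyps[of B] B cA m_def by auto
      also have "(\<Sum>b\<in>B. f B (((\<lambda>_. 1)(a := Suc j))(b := ((\<lambda>_. 1)(a := Suc j)) b + Suc j)))
          = (\<Sum>b\<in>B. K ^ m * fact (m - 1) * (\<Sum>i = 1..m. y (i + Suc j) * W (m - i)))"
      proof (rule sum.cong[OF refl])
        fix b assume b: "b \<in> B"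
        then have "b \<noteq> a" using B(2) by blast
        then have "f B (((\<lambda>_. 1)(a := Suc j))(b := ((\<lambda>_. 1)(a := Suc j)) b + Suc j))
            = f B ((\<lambda>_. 1)(b := Suc (Suc j)))"
          by (intro cong) (use B(2) in auto)
        also have "\<dots> = K ^ m * fact (m - 1) * (\<Sum>i = 1..m. y (i + Suc j) * W (m - i))"
          unfolding m_def W_def using less.hyps[of B] B cA m_def b by auto
        finally show "f B (((\<lambda>_. 1)(a := Suc j))(b := ((\<lambda>_. 1)(a := Suc j)) b + Suc j))
            = K ^ m * fact (m - 1) * (\<Sum>i = 1..m. y (i + Suc j) * W (m - i))" .
      qed
      \<comment> \<open>The m equal summands turn the factorial of \<open>m - 1\<close> into that of
        \<open>m\<close>; for \<open>m = 0\<close> both sides vanish because the inner sum is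
        empty.\<close>
      also have "\<dots> = K ^ m * fact m * (\<Sum>i = 1..m. y (i + Suc j) * W (m - i))"
        by (cases m) (simp_all add: m_def[symmetric] algebra_simps)
      also have "(\<Sum>i = 1..m. y (i + Suc j) * W (m - i))
          = (\<Sum>i = Suc 1..Suc m. y (i + j) * W (Suc m - i))"
        by (simp add: sum.shift_bounds_cl_Suc_ivl del: sum.cl_ivl_Suc)
      finally have "f A ((\<lambda>_. 1)(a := Suc j)) = K ^ Suc m * fact m *
          (y (1 + j) * W (Suc m - 1) + (\<Sum>i = Suc 1..Suc m. y (i + j) * W (Suc m - i)))"
        by (simp add: algebra_simps fun_upd_def del: sum.cl_ivl_Suc)
      also have "y (1 + j) * W (Suc m - 1) + (\<Sum>i = Suc 1..Suc m. y (i + j) * W (Suc m - i))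
          = (\<Sum>i = 1..Suc m. y (i + j) * W (Suc m - i))"
        by (rule sum.atLeast_Suc_atMost[symmetric]) simp
      finally show "f A ((\<lambda>_. 1)(a := Suc j)) = K ^ card A * fact (card A - 1)
          * (\<Sum>i = 1..card A. y (i + j) * cyc_ind y (card A - i))"
        by (simp only: cA W_def diff_Suc_1)
    qed
    have "f A (\<lambda>_. 1) = K ^ card A * fact (card A) * cyc_ind y (card A)"
    proof (cases "A = {}")
      case False
      then obtain a where a: "a \<in> A" by blast
      then have "card A > 0" using less.prems by (auto simp: card_gt_0_iff)
      then have fc: "(fact (card A) :: xpoly) = fact (card A - 1) * of_nat (card A)"
        by (cases "card A") simp_all
      \<comment> \<open>Constant weight 1 is the marked case j = 0 at any point, so the second claim
        for \<open>A\<close> follows from the first by the recursion of the cycle index.\<close>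
      have "(\<lambda>_. 1) = (\<lambda>_. 1)(a := Suc 0)" by auto
      then have "f A (\<lambda>_. 1) = f A ((\<lambda>_. 1)(a := Suc 0))" by (rule arg_cong)
      also have "\<dots> = K ^ card A * fact (card A - 1) * (of_nat (card A) * cyc_ind y (card A))"
        using marked[OF a, of 0] by (simp add: cyc_ind_rec)
      finally show ?thesis by (simp add: fc mult.assoc)
    qed (simp add: empty)
    then show ?case using marked by blast
  qed
  then show ?thesis by blast
qed

lemma cyc_sum_eq_cyc_ind:
  assumes "finite A"
  shows "cyc_sum y A (\<lambda>_. 1) = fact (card A) * cyc_ind y (card A)"
proof -
  have "cyc_sum y A (\<lambda>_. 1) = 1 ^ card A * fact (card A) * cyc_ind y (card A)"
  proof (rule contraction_recursion[where f = "cyc_sum y"])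
    show "cyc_sum y {} w = 1" for w :: "'a \<Rightarrow> nat" by (simp add: cyc_sum_def cyc_prod_def)
    show "cyc_sum y (insert a A) w = 1 * (y (w a) * cyc_sum y A w
       + (\<Sum>b\<in>A. cyc_sum y A (w(b := w b + w a))))" if "finite A" "a \<notin> A" for a A and w :: "'a \<Rightarrow> nat"
      using cyc_sum_insert[OF that] by simp
    show "cyc_sum y A w = cyc_sum y A w'" if "\<And>a. a \<in> A \<Longrightarrow> w a = w' a"
      for A and w w' :: "'a \<Rightarrow> nat"
      unfolding cyc_sum_def by (intro sum.cong refl cyc_prod_cong) (auto simp: permutes_in_image that)
  qed fact
  then show ?thesis by simp
qed

text \<open>Each insertion of a block costs the same factor \<open>fact (card F)\<close>: for a
  block mapped to itself it comes from the sum over its inner permutations, otherwise from the free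
  choice of \<delta>. This makes the step fit the contraction recursion with an inner cycle index in
  the role of \<open>y\<close>.\<close>

lemma block_cyc_sum_eq_cyc_ind:
  assumes finF: "finite F" and "F \<noteq> {}" "finite A"
  shows "block_cyc_sum y F A (\<lambda>_. 1) = fact (card F) ^ card A * fact (card A)
     * cyc_ind (\<lambda>i. cyc_ind (\<lambda>l. y (i * l)) (card F)) (card A)"
proof (rule contraction_recursion[where f = "block_cyc_sum y F"])
  have "block_perms {} F = {id :: 'b \<times> 'a \<Rightarrow> 'b \<times> 'a}" by (auto simp: block_perms_def)
  then show "block_cyc_sum y F {} w = 1" for w :: "'b \<Rightarrow> nat"
    by (simp add: block_cyc_sum_def cyc_prod_def)
  show "block_cyc_sum y F (insert a A) w = fact (card F) *
      (cyc_ind (\<lambda>l. y (w a * l)) (card F) * block_cyc_sum y F A w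
       + (\<Sum>b\<in>A. block_cyc_sum y F A (w(b := w b + w a))))"
    if "finite A" "a \<notin> A" for a A and w :: "'b \<Rightarrow> nat"
  proof -
    have "cyc_sum y F (\<lambda>_. w a) = cyc_sum (\<lambda>l. y (w a * l)) F (\<lambda>_. 1)"
      unfolding cyc_sum_def by (rule sum.cong[OF refl cyc_prod_const_weight])
    also have "\<dots> = fact (card F) * cyc_ind (\<lambda>l. y (w a * l)) (card F)"
      by (rule cyc_sum_eq_cyc_ind[OF finF])
    finally show ?thesis
      using block_cyc_sum_insert[OF that(1) assms(1,2) that(2), of y w]
      by (simp add: algebra_simps)
  qed
  show "block_cyc_sum y F A w = block_cyc_sum y F A w'" if "\<And>a. a \<in> A \<Longrightarrow> w a = w' a"
    for A and w w' :: "'b \<Rightarrow> nat"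
    unfolding block_cyc_sum_def
    by (intro sum.cong refl cyc_prod_cong) (auto simp: that dest!: block_perms_permutes permutes_image)
qed fact

subsection \<open>Cycle types and conjugation\<close>

text \<open>Written as an exponent vector, so that \<open>cyc_prod xvar\<close> is a single monomial
  and counting permutations by type means reading a coefficient.\<close>

definition cycle_type :: "'a set \<Rightarrow> ('a \<Rightarrow> 'a) \<Rightarrow> nat \<Rightarrow>\<^sub>0 nat" where
  "cycle_type A h = (\<Sum>c\<in>orbit h ` A. Poly_Mapping.single (card c) 1)"

lemma cyc_prod_xvar:
  assumes "finite A"
  shows "cyc_prod xvar (\<lambda>_. 1) A h = Poly_Mapping.single (cycle_type A h) 1"
proof -
  have "(\<Prod>c\<in>S. xvar (card c)) = Poly_Mapping.single (\<Sum>c\<in>S. Poly_Mapping.single (card c) 1) 1"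
    if "finite S" for S :: "'a set set"
    using that by induction (simp_all add: xvar_def mult_single)
  then show ?thesis using assms by (simp add: cyc_prod_def cycle_type_def)
qed

lemma lookup_cycle_type:
  assumes "finite A"
  shows "Poly_Mapping.lookup (cycle_type A h) l = card {c \<in> orbit h ` A. card c = l}"
proof -
  have "Poly_Mapping.lookup (cycle_type A h) l = (\<Sum>c\<in>orbit h ` A. if card c = l then 1 else 0)"
    by (simp add: cycle_type_def lookup_sum lookup_single when_def cong: if_cong)
  also have "\<dots> = card {c \<in> orbit h ` A. card c = l}"
    unfolding card_eq_sum using assms by (intro sum.inter_filter[symmetric]) simp
  finally show ?thesis .
qed

lemma lookup_of_nat_mult:
  fixes F :: "'a::monoid_add \<Rightarrow>\<^sub>0 'b::semiring_1"
  shows "Poly_Mapping.lookup (of_nat c * F) p = of_nat c * Poly_Mapping.lookup F p"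
  by (induction c) (simp_all add: lookup_add algebra_simps)

lemma lookup_sum_single:
  assumes "finite S"
  shows "Poly_Mapping.lookup (\<Sum>h\<in>S. Poly_Mapping.single (t h) (1::rat)) p = of_nat (card {h \<in> S. t h = p})"
proof -
  have "Poly_Mapping.lookup (\<Sum>h\<in>S. Poly_Mapping.single (t h) (1::rat)) p
      = (\<Sum>h\<in>S. if t h = p then 1 else 0)"
    by (simp add: lookup_sum lookup_single when_def)
  also have "\<dots> = of_nat (card {h \<in> S. t h = p})"
    using assms by (simp flip: sum.inter_filter)
  finally show ?thesis .
qed

section \<open>Conjugacy classes and centralizers\<close>

lemma funpow_eq_iff_mod_orbit:
  assumes "x \<in> orbit f x"
  shows "(f ^^ i) x = (f ^^ j) x \<longleftrightarrow> i mod card (orbit f x) = j mod card (orbit f x)"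
proof -
  define m where "m = funpow_dist1 f x x"
  have card: "card (orbit f x) = m"
    unfolding orbit_conv_funpow_dist1[OF assms] m_def
    using card_image[OF inj_on_funpow_dist1[OF assms]] by simp
  have "(f ^^ m) x = x" unfolding m_def by (rule funpow_dist1_prop[OF assms])
  then have red: "(f ^^ (i mod m)) x = (f ^^ i) x" for i by (rule funpow_mod_eq)
  have m: "m > 0" by (simp add: m_def)
  have "(f ^^ (i mod m)) x = (f ^^ (j mod m)) x \<longleftrightarrow> i mod m = j mod m"
    using inj_on_funpow_dist1[OF assms] m unfolding m_def[symmetric] by (intro inj_on_eq_iff) auto
  then show ?thesis by (simp add: card red)
qed

lemma bij_betw_fibrewise:
  assumes fin: "finite S" "finite T"
    and eq: "\<And>l. card {c \<in> S. g c = l} = card {c \<in> T. g' c = l}"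
  obtains b where "bij_betw b S T" "\<And>c. c \<in> S \<Longrightarrow> g' (b c) = g c"
proof -
  have "\<exists>b. bij_betw b {c \<in> S. g c = l} {c \<in> T. g' c = l}" for l
    by (rule finite_same_card_bij) (use fin eq in auto)
  then obtain b where b: "\<And>l. bij_betw (b l) {c \<in> S. g c = l} {c \<in> T. g' c = l}" by metis
  have b_in: "b (g c) c \<in> {c' \<in> T. g' c' = g c}" if "c \<in> S" for c
    using bij_betw_apply[OF b[of "g c"], of c] that by simp
  have "bij_betw (\<lambda>c. b (g c) c) S T"
    unfolding bij_betw_def
  proof
    show "inj_on (\<lambda>c. b (g c) c) S"
    proof (rule inj_onI)
      fix c c' assume c: "c \<in> S" "c' \<in> S" "b (g c) c = b (g c') c'"
      then have "g c = g c'" using b_in[of c] b_in[of c'] by auto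
      then show "c = c'" using c inj_onD[OF bij_betw_imp_inj_on[OF b[of "g c"]], of c c'] by simp
    qed
    have "c \<in> (\<lambda>c. b (g c) c) ` S" if "c \<in> T" for c
    proof -
      have "c \<in> b (g' c) ` {c' \<in> S. g c' = g' c}"
        using that bij_betw_imp_surj_on[OF b[of "g' c"]] by simp
      then obtain x where "x \<in> S" "g x = g' c" "c = b (g' c) x" by blast
      then show ?thesis by (intro image_eqI[of _ _ x]) simp_all
    qed
    then show "(\<lambda>c. b (g c) c) ` S = T" using b_in by blast
  qed
  then show thesis by (rule that) (use b_in in simp)
qed

text \<open>Matching cycles of equal length and, in each cycle, the points at equal distance from a
  base point conjugates one permutation into the other.\<close>

lemma cycle_type_eq_imp_conjugate:
  assumes fin: "finite A" and h: "h permutes A" and k: "k permutes A"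
    and type: "cycle_type A h = cycle_type A k"
  obtains \<sigma> where "\<sigma> permutes A" "\<sigma> \<circ> h = k \<circ> \<sigma>"
proof -
  have eq: "card {c \<in> orbit h ` A. card c = l} = card {c \<in> orbit k ` A. card c = l}" for l
    using type by (simp flip: lookup_cycle_type[OF fin])
  obtain b where b: "bij_betw b (orbit h ` A) (orbit k ` A)"
    and bc: "\<And>c. c \<in> orbit h ` A \<Longrightarrow> card (b c) = card c"
    using bij_betw_fibrewise[OF finite_imageI[OF fin] finite_imageI[OF fin] eq] by blast
  define r where "r c = (SOME x. x \<in> c)" for c :: "'a set"
  have r: "r c \<in> c \<and> c = orbit f (r c)" if "c \<in> orbit f ` A" "f permutes A" for c f
  proof -
    obtain x where x: "c = orbit f x" using \<open>c \<in> orbit f ` A\<close> by blast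
    then have "x \<in> c" using orbit_permutes_self[OF fin that(2)] by simp
    then have "r c \<in> c" unfolding r_def by (rule someI)
    then show ?thesis using orbit_permutes_eq[OF fin that(2), of "r c" x] x by simp
  qed
  define \<sigma> where "\<sigma> x = (if x \<in> A then (k ^^ funpow_dist h (r (orbit h x)) x) (r (b (orbit h x))) else x)" for x
  \<comment> \<open>The distance used in \<sigma> agrees with i only modulo the length of the cycle.
    Matched cycles have equal length, so the two powers of \<open>k\<close> still coincide at the
    base point.\<close>
  have \<sigma>_pow: "\<sigma> ((h ^^ i) a) = (k ^^ i) (r (b c))" if c: "c \<in> orbit h ` A" and a: "a = r c" for i a c
  proof -
    have ac: "a \<in> c" "c = orbit h a" using r[OF c h] a by auto
    have cA: "c \<subseteq> A" using c orbit_subset_invariant[of h A] permutes_image[OF h] by blast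
    have xc: "(h ^^ i) a \<in> c" using ac funpow_in_orbit[of a h a i] by simp
    then have "orbit h ((h ^^ i) a) = c" using orbit_permutes_eq[OF fin h, of "(h ^^ i) a" a] ac by simp
    then have "\<sigma> ((h ^^ i) a) = (k ^^ funpow_dist h a ((h ^^ i) a)) (r (b c))"
      unfolding \<sigma>_def using xc cA a by auto
    moreover have "(h ^^ funpow_dist h a ((h ^^ i) a)) a = (h ^^ i) a"
      using xc ac by (intro funpow_dist_prop) simp
    then have "funpow_dist h a ((h ^^ i) a) mod card c = i mod card c"
      using funpow_eq_iff_mod_orbit[of a h] ac by simp
    moreover have bk: "b c \<in> orbit k ` A" using bij_betw_apply[OF b c] .
    then have "r (b c) \<in> orbit k (r (b c))" "card (orbit k (r (b c))) = card c"
      using r[OF bk k] bc[OF c] by auto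
    ultimately show ?thesis
      using funpow_eq_iff_mod_orbit[of "r (b c)" k] by simp
  qed
  have pow_in: "(f ^^ i) x \<in> A" if "f permutes A" "x \<in> A" for f i x
    using that(2) permutes_in_image[OF that(1)] by (induction i) auto
  have rep: "\<exists>c\<in>orbit h ` A. \<exists>i. x = (h ^^ i) (r c)" if "x \<in> A" for x
  proof -
    have c: "orbit h x \<in> orbit h ` A" using that by blast
    then have "x \<in> orbit h (r (orbit h x))"
      using r[OF c h] orbit_permutes_self[OF fin h, of x] by simp
    then have "x = (h ^^ funpow_dist h (r (orbit h x)) x) (r (orbit h x))"
      using funpow_dist_prop by metis
    then show ?thesis using c by blast
  qed
  have comm: "\<sigma> (h x) = k (\<sigma> x)" for x
  proof (cases "x \<in> A")
    case True
    then obtain c i where "c \<in> orbit h ` A" "x = (h ^^ i) (r c)" using rep by blast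
    then show ?thesis using \<sigma>_pow[of c "r c" i] \<sigma>_pow[of c "r c" "Suc i"] by simp
  next
    case False
    then show ?thesis using permutes_not_in[OF h] permutes_not_in[OF k] by (simp add: \<sigma>_def)
  qed
  have "A \<subseteq> \<sigma> ` A"
  proof
    fix y assume y: "y \<in> A"
    then have "orbit k y \<in> b ` orbit h ` A" using bij_betw_imp_surj_on[OF b] by simp
    then obtain c where c: "c \<in> orbit h ` A" "orbit k y = b c" by blast
    then have bk: "b c \<in> orbit k ` A" using y by auto
    have "y \<in> orbit k (r (b c))"
      using r[OF bk k] c(2) orbit_permutes_self[OF fin k, of y] by simp
    then obtain i where "y = (k ^^ i) (r (b c))" using funpow_dist_prop by metis
    then have "y = \<sigma> ((h ^^ i) (r c))" using \<sigma>_pow[OF c(1) refl] by simp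
    moreover have "r c \<in> A"
      using r[OF c(1) h] c(1) orbit_subset_invariant[of h A] permutes_image[OF h] by blast
    then have "(h ^^ i) (r c) \<in> A" by (rule pow_in[OF h])
    ultimately show "y \<in> \<sigma> ` A" by blast
  qed
  moreover have "\<sigma> ` A \<subseteq> A"
  proof (rule image_subsetI)
    fix x assume "x \<in> A"
    then obtain c i where c: "c \<in> orbit h ` A" "x = (h ^^ i) (r c)" using rep by blast
    have bk: "b c \<in> orbit k ` A" using bij_betw_apply[OF b c(1)] .
    then have "r (b c) \<in> A"
      using r[OF bk k] orbit_subset_invariant[of k A] permutes_image[OF k] by blast
    then show "\<sigma> x \<in> A" using c \<sigma>_pow[OF c(1) refl] pow_in[OF k] by simp
  qed
  ultimately have "\<sigma> ` A = A" by blast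
  then have "bij_betw \<sigma> A A"
    using fin by (simp add: bij_betw_def eq_card_imp_inj_on)
  then have "\<sigma> permutes A" by (rule bij_imp_permutes) (simp add: \<sigma>_def)
  moreover have "\<sigma> \<circ> h = k \<circ> \<sigma>" using comm by (simp add: fun_eq_iff)
  ultimately show thesis by (rule that)
qed

text \<open>\<sigma> carries the cycles of \<open>h\<close> to those of \<open>k\<close>, so both
  have the same monomial \<open>cyc_prod xvar\<close>, and a monomial determines its
  exponents.\<close>

lemma conjugate_imp_cycle_type_eq:
  assumes fin: "finite A" and h: "h permutes A" and \<sigma>: "\<sigma> permutes A" and c: "\<sigma> \<circ> h = k \<circ> \<sigma>"
  shows "cycle_type A h = cycle_type A k"
proof -
  have "cyc_prod xvar (\<lambda>_. 1) (\<sigma> ` A) k = cyc_prod xvar ((\<lambda>_. 1) \<circ> \<sigma>) A h"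
    by (rule cyc_prod_image)
      (use h \<sigma> c in \<open>auto simp: permutes_image fun_eq_iff intro: permutes_inj_on\<close>)
  then have "Poly_Mapping.single (cycle_type A k) (1::rat) = Poly_Mapping.single (cycle_type A h) 1"
    unfolding permutes_image[OF \<sigma>] comp_def cyc_prod_xvar[OF fin] .
  then have "Poly_Mapping.lookup (Poly_Mapping.single (cycle_type A k) (1::rat)) (cycle_type A h) = 1"
    by simp
  then show ?thesis by (simp add: lookup_single when_def split: if_splits)
qed

lemma card_cycle_type:
  assumes fin: "finite A"
  shows "of_nat (card {h. h permutes A \<and> cycle_type A h = p})
    = (if p \<in> partitions (card A) then fact (card A) / of_nat (Sym (card A) p) else (0::rat))"
proof -
  have "(\<Sum>h | h permutes A. Poly_Mapping.single (cycle_type A h) (1::rat))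
      = of_nat (fact (card A)) * cyc_ind xvar (card A)"
    using cyc_sum_eq_cyc_ind[OF fin, of xvar] by (simp only: cyc_sum_def cyc_prod_xvar[OF fin] of_nat_fact)
  then have "Poly_Mapping.lookup (\<Sum>h | h permutes A. Poly_Mapping.single (cycle_type A h) (1::rat)) p
      = Poly_Mapping.lookup (of_nat (fact (card A)) * cyc_ind xvar (card A)) p"
    by simp
  then have "of_nat (card {h \<in> {h. h permutes A}. cycle_type A h = p})
      = of_nat (fact (card A)) * (Poly_Mapping.lookup (cyc_ind xvar (card A)) p)"
    unfolding lookup_sum_single[OF finite_permutations[OF fin]] lookup_of_nat_mult .
  then show ?thesis by (simp add: lookup_cyc_ind_xvar)
qed

text \<open>By \<open>card_cycle_type\<close> no permutation has a type outside
  \<open>partitions\<close>, but \<open>h\<close> is one with its own type.\<close>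

lemma cycle_type_in_partitions:
  assumes fin: "finite A" and h: "h permutes A"
  shows "cycle_type A h \<in> partitions (card A)"
proof -
  have "finite {k. k permutes A \<and> cycle_type A k = cycle_type A h}"
    by (rule finite_subset[OF _ finite_permutations[OF fin]]) auto
  then have "card {k. k permutes A \<and> cycle_type A k = cycle_type A h} \<noteq> 0"
    using h by auto
  then have "(of_nat (card {k. k permutes A \<and> cycle_type A k = cycle_type A h}) :: rat) \<noteq> 0"
    by (simp only: of_nat_eq_0_iff not_False_eq_True)
  then show ?thesis unfolding card_cycle_type[OF fin] by (auto split: if_splits)
qed

lemma Sym_pos: "Sym m p > 0"
  unfolding Sym_def by (intro prod_pos) auto

text \<open>For each \<open>k'\<close> in the class \<open>T\<close> of \<open>h\<close>, the
  conjugators from \<open>h\<close> to \<open>k'\<close> form a coset of the centralizer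
  \<open>N h\<close>. These cosets partition the symmetric group, so the order of the group is the
  size of \<open>T\<close> times that of \<open>N h\<close>. The size of \<open>T\<close> is already
  known from the cycle index, and cancelling it leaves \<open>Sym\<close>.\<close>

lemma card_conjugators:
  assumes fin: "finite A" and h: "h permutes A" and k: "k permutes A"
  shows "card {\<sigma>. \<sigma> permutes A \<and> \<sigma> \<circ> h = k \<circ> \<sigma>}
    = (if cycle_type A h = cycle_type A k then Sym (card A) (cycle_type A h) else 0)"
proof (cases "cycle_type A h = cycle_type A k")
  case False
  then have "{\<sigma>. \<sigma> permutes A \<and> \<sigma> \<circ> h = k \<circ> \<sigma>} = {}"
    using conjugate_imp_cycle_type_eq[OF fin h] by blast
  then show ?thesis using False by (simp only: card.empty if_False)
next
  case True
  define N where "N k = {\<sigma>. \<sigma> permutes A \<and> \<sigma> \<circ> h = k \<circ> \<sigma>}" for k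
  define T where "T = {k. k permutes A \<and> cycle_type A k = cycle_type A h}"
  have finN: "finite (N k)" for k
    unfolding N_def by (rule finite_subset[OF _ finite_permutations[OF fin]]) auto
  have finT: "finite T"
    unfolding T_def by (rule finite_subset[OF _ finite_permutations[OF fin]]) auto
  have eq: "card (N k') = card (N h)" if k': "k' \<in> T" for k'
  proof -
    have k'p: "k' permutes A" and "cycle_type A h = cycle_type A k'" using k' by (auto simp: T_def)
    then obtain \<tau> where \<tau>: "\<tau> permutes A" "\<tau> \<circ> h = k' \<circ> \<tau>"
      using cycle_type_eq_imp_conjugate[OF fin h] by blast
    let ?i = "inv_into UNIV \<tau>"
    have i: "?i \<circ> \<tau> = id" "\<tau> \<circ> ?i = id" using permutes_inv_o[OF \<tau>(1)] by auto
    have ik: "?i \<circ> k' = h \<circ> ?i"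
    proof -
      have "?i \<circ> k' = ?i \<circ> (k' \<circ> \<tau>) \<circ> ?i" by (simp only: comp_assoc i comp_id)
      also have "\<dots> = (?i \<circ> \<tau>) \<circ> h \<circ> ?i" by (simp only: \<tau>(2)[symmetric] comp_assoc)
      finally show ?thesis by (simp only: i id_comp)
    qed
    have "bij_betw (\<lambda>\<sigma>. \<tau> \<circ> \<sigma>) (N h) (N k')"
    proof (rule bij_betw_byWitness[where f' = "\<lambda>\<sigma>. ?i \<circ> \<sigma>"])
      show "\<forall>\<sigma>\<in>N h. ?i \<circ> (\<tau> \<circ> \<sigma>) = \<sigma>" by (simp only: comp_assoc[symmetric] i id_comp) simp
      show "\<forall>\<sigma>\<in>N k'. \<tau> \<circ> (?i \<circ> \<sigma>) = \<sigma>" by (simp only: comp_assoc[symmetric] i id_comp) simp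
      show "(\<lambda>\<sigma>. \<tau> \<circ> \<sigma>) ` N h \<subseteq> N k'"
      proof (rule image_subsetI)
        fix \<sigma> assume "\<sigma> \<in> N h"
        then have s: "\<sigma> permutes A" "\<sigma> \<circ> h = h \<circ> \<sigma>" by (auto simp: N_def)
        have "\<tau> \<circ> \<sigma> \<circ> h = k' \<circ> (\<tau> \<circ> \<sigma>)"
          by (simp only: comp_assoc s(2)) (simp only: comp_assoc[symmetric] \<tau>(2))
        then show "\<tau> \<circ> \<sigma> \<in> N k'" using s(1) \<tau>(1) by (simp add: N_def permutes_compose)
      qed
      show "(\<lambda>\<sigma>. ?i \<circ> \<sigma>) ` N k' \<subseteq> N h"
      proof (rule image_subsetI)
        fix \<sigma> assume "\<sigma> \<in> N k'"
        then have s: "\<sigma> permutes A" "\<sigma> \<circ> h = k' \<circ> \<sigma>" by (auto simp: N_def)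
        have "?i \<circ> \<sigma> \<circ> h = h \<circ> (?i \<circ> \<sigma>)"
          by (simp only: comp_assoc s(2)) (simp only: comp_assoc[symmetric] ik)
        then show "?i \<circ> \<sigma> \<in> N h"
          using s(1) permutes_inv[OF \<tau>(1)] by (simp add: N_def permutes_compose)
      qed
    qed
    then show ?thesis by (simp add: bij_betw_same_card)
  qed
  have "{\<sigma>. \<sigma> permutes A} = (\<Union>k'\<in>T. N k')"
  proof
    show "(\<Union>k'\<in>T. N k') \<subseteq> {\<sigma>. \<sigma> permutes A}" by (auto simp: N_def)
    show "{\<sigma>. \<sigma> permutes A} \<subseteq> (\<Union>k'\<in>T. N k')"
    proof clarify
      fix \<sigma> assume s: "\<sigma> permutes A"
      let ?k = "\<sigma> \<circ> h \<circ> inv_into UNIV \<sigma>"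
      have c: "\<sigma> \<circ> h = ?k \<circ> \<sigma>" by (simp only: comp_assoc permutes_inv_o[OF s] comp_id)
      have "?k permutes A" using s h permutes_inv[OF s] by (intro permutes_compose)
      then have "?k \<in> T" using conjugate_imp_cycle_type_eq[OF fin h s c] by (simp add: T_def)
      then show "\<sigma> \<in> (\<Union>k'\<in>T. N k')" using s c by (auto simp: N_def)
    qed
  qed
  moreover have "N k1 \<inter> N k2 = {}" if "k1 \<noteq> k2" for k1 k2
  proof (rule ccontr)
    assume "N k1 \<inter> N k2 \<noteq> {}"
    then obtain \<sigma> where "\<sigma> \<in> N k1" "\<sigma> \<in> N k2" by blast
    then have s: "\<sigma> permutes A" "k1 \<circ> \<sigma> = k2 \<circ> \<sigma>" unfolding N_def mem_Collect_eq by metis+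
    then have "k1 \<circ> (\<sigma> \<circ> inv_into UNIV \<sigma>) = k2 \<circ> (\<sigma> \<circ> inv_into UNIV \<sigma>)"
      by (simp only: comp_assoc[symmetric])
    then show False using that by (simp only: permutes_inv_o[OF s(1)] comp_id)
  qed
  ultimately have "card {\<sigma>. \<sigma> permutes A} = (\<Sum>k'\<in>T. card (N k'))"
    using finT finN by (simp only:) (intro card_UN_disjoint, auto)
  then have f: "fact (card A) = card T * card (N h)"
    using eq by (simp add: card_permutations[OF refl fin])
  have S: "(of_nat (Sym (card A) (cycle_type A h)) :: rat) \<noteq> 0" using Sym_pos by simp
  have "of_nat (card T) = (fact (card A) :: rat) / of_nat (Sym (card A) (cycle_type A h))"
    unfolding T_def card_cycle_type[OF fin] using cycle_type_in_partitions[OF fin h] by simp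
  then have "of_nat (card T) * of_nat (Sym (card A) (cycle_type A h)) = (fact (card A) :: rat)"
    using S by (simp add: field_simps)
  then have "of_nat (card T * Sym (card A) (cycle_type A h)) = (of_nat (fact (card A)) :: rat)"
    by simp
  then have "card T * Sym (card A) (cycle_type A h) = fact (card A)" by (simp only: of_nat_eq_iff)
  then have "card T * Sym (card A) (cycle_type A h) = card T * card (N h)" using f by simp
  moreover have "card T \<noteq> 0" using finT h by (auto simp: T_def)
  ultimately have "card (N h) = Sym (card A) (cycle_type A h)" by simp
  moreover have "card (N k) = card (N h)" by (rule eq) (use k True in \<open>simp add: T_def\<close>)
  ultimately show ?thesis using True by (simp add: N_def)
qed

subsection \<open>Counting the double cosets\<close>

lemma wreath_eq_block_perms:
  assumes "d \<ge> 1"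
  shows "wreath d n = block_perms {1..n} {1..d}"
proof
  show "wreath d n \<subseteq> block_perms {1..n} {1..d}"
  proof
    fix h assume "h \<in> wreath d n"
    then obtain \<gamma> \<delta> where h: "h permutes {1..n} \<times> {1..d}"
      "\<And>a \<alpha>. a \<in> {1..n} \<Longrightarrow> \<alpha> \<in> {1..d} \<Longrightarrow> h (a, \<alpha>) = (\<gamma> a, \<delta> a \<alpha>)"
      unfolding wreath_def perms_def by blast
    show "h \<in> block_perms {1..n} {1..d}"
      by (rule block_permsI) (use h in auto)
  qed
  show "block_perms {1..n} {1..d} \<subseteq> wreath d n"
  proof
    fix h assume h: "h \<in> block_perms {1..n} {1..d}"
    define \<gamma> where "\<gamma> a = (if a \<in> {1..n} then fst (h (a, 1)) else a)" for a
    define \<delta> where "\<delta> a \<alpha> = (if \<alpha> \<in> {1..d} then snd (h (a, \<alpha>)) else \<alpha>)" for a \<alpha>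
    have d: "(1::nat) \<in> {1..d}" using assms by simp
    have hp: "h permutes {1..n} \<times> {1..d}" by (rule block_perms_permutes[OF h])
    have eq: "h (a, \<alpha>) = (\<gamma> a, \<delta> a \<alpha>)" if "a \<in> {1..n}" "\<alpha> \<in> {1..d}" for a \<alpha>
      using block_perms_fst[OF h that(1) d that(2)] that by (simp add: \<gamma>_def \<delta>_def prod_eq_iff)
    have "{1..n} \<subseteq> \<gamma> ` {1..n}"
    proof
      fix b assume "b \<in> {1..n}"
      then have "(b, 1) \<in> h ` ({1..n} \<times> {1..d})" using d permutes_image[OF hp] by blast
      then obtain a \<alpha> where "a \<in> {1..n}" "\<alpha> \<in> {1..d}" "(b, 1) = h (a, \<alpha>)" by blast
      then show "b \<in> \<gamma> ` {1..n}" using eq[of a \<alpha>] by simp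
    qed
    moreover have "\<gamma> ` {1..n} \<subseteq> {1..n}"
      using block_perms_in(1)[OF h _ d] by (intro image_subsetI) (simp add: \<gamma>_def)
    ultimately have "\<gamma> ` {1..n} = {1..n}" by blast
    then have "\<gamma> permutes {1..n}"
      by (intro bij_imp_permutes) (auto simp: bij_betw_def eq_card_imp_inj_on \<gamma>_def)
    moreover have "\<delta> a permutes {1..d}" if a: "a \<in> {1..n}" for a
    proof -
      have "inj_on (\<delta> a) {1..d}"
      proof (rule inj_onI)
        fix \<alpha> \<beta> assume "\<alpha> \<in> {1..d}" "\<beta> \<in> {1..d}" "\<delta> a \<alpha> = \<delta> a \<beta>"
        then have "h (a, \<alpha>) = h (a, \<beta>)" using eq[OF a] by simp
        then show "\<alpha> = \<beta>" using permutes_inj[OF hp] by (auto dest: injD)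
      qed
      moreover have "\<delta> a ` {1..d} \<subseteq> {1..d}"
        using block_perms_in(2)[OF h a] by (intro image_subsetI) (simp add: \<delta>_def)
      ultimately show ?thesis
        by (intro bij_imp_permutes) (simp_all add: bij_betw_def endo_inj_surj, auto simp: \<delta>_def)
    qed
    ultimately show "h \<in> wreath d n"
      using hp eq unfolding wreath_def perms_def by blast
  qed
qed

lemma wreath_bij: "h \<in> wreath d n \<Longrightarrow> bij h"
  by (auto simp: wreath_def perms_def intro: permutes_bij)

lemma wreath_inverses:
  assumes "h \<in> wreath d n"
  shows "h \<circ> inv_into UNIV h = id" "inv_into UNIV h \<circ> h = id"
  using wreath_bij[OF assms] by (auto simp: fun_eq_iff bij_is_inj bij_is_surj surj_f_inv_f)

lemma finite_wreath: "finite (wreath d n)"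
  by (rule finite_subset[OF _ finite_perms[of d n]]) (auto simp: wreath_def)

section \<open>Burnside's count for the two-sided action\<close>

lemma sum_quotient:
  fixes f :: "'a \<Rightarrow> 'b::comm_monoid_add"
  assumes "finite A" "equiv A r"
  shows "sum f A = (\<Sum>C\<in>A // r. sum f C)"
proof -
  have "\<forall>C\<in>A // r. finite C"
    using in_quotient_imp_subset[OF assms(2)] finite_subset assms(1) by blast
  moreover have "\<forall>C\<in>A // r. \<forall>D\<in>A // r. C \<noteq> D \<longrightarrow> C \<inter> D = {}"
    using quotient_disj[OF assms(2)] by blast
  ultimately have "sum f (\<Union>(A // r)) = (\<Sum>C\<in>A // r. sum f C)"
    by (subst sum.Union_disjoint) simp_all
  then show ?thesis by (simp add: Union_quotient[OF assms(2)])
qed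

text \<open>Orbit counting within one double coset. If \<sigma> = a \<tau> b, then (g, g') \<mapsto>
  (g a, b g') maps the pairs fixing \<sigma> bijectively to the pairs with g \<tau> g' = \<sigma>.
  Every pair (g, g') takes \<tau> to exactly one element of \<open>C\<close>, so summing over
  \<sigma> counts all pairs once.\<close>

lemma dcoset_class_count:
  assumes C: "C \<in> perms d n // dcoset_rel d n"
  shows "(\<Sum>\<sigma>\<in>C. card {(g, g') \<in> wreath d n \<times> wreath d n. g \<circ> \<sigma> \<circ> g' = \<sigma>}) = (card (wreath d n))\<^sup>2"
proof -
  let ?H = "wreath d n"
  obtain \<tau> where \<tau>: "\<tau> \<in> perms d n" "C = dcoset_rel d n `` {\<tau>}"
    using C by (rule quotientE) blast
  have "card {(g, g') \<in> ?H \<times> ?H. g \<circ> \<sigma> \<circ> g' = \<sigma>} = card {(g, g') \<in> ?H \<times> ?H. g \<circ> \<tau> \<circ> g' = \<sigma>}"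
    if "\<sigma> \<in> C" for \<sigma>
  proof -
    have "(\<tau>, \<sigma>) \<in> dcoset_rel d n" using that \<tau>(2) by simp
    then obtain a b where ab: "a \<in> ?H" "b \<in> ?H" "\<sigma> = a \<circ> \<tau> \<circ> b"
      unfolding dcoset_rel_def by blast
    let ?a = "inv_into UNIV a" and ?b = "inv_into UNIV b"
    note i = wreath_inverses[OF ab(1)] wreath_inverses[OF ab(2)]
    have pw: "?a (a x) = x" "a (?a x) = x" "?b (b x) = x" "b (?b x) = x" for x
      using i[THEN fun_cong] by simp_all
    have "bij_betw (\<lambda>(g, g'). (g \<circ> a, b \<circ> g'))
       {(g, g') \<in> ?H \<times> ?H. g \<circ> \<sigma> \<circ> g' = \<sigma>} {(g, g') \<in> ?H \<times> ?H. g \<circ> \<tau> \<circ> g' = \<sigma>}"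
    proof (rule bij_betw_byWitness[where f' = "\<lambda>(g, g'). (g \<circ> ?a, ?b \<circ> g')"])
      show "(\<lambda>(g, g'). (g \<circ> a, b \<circ> g')) ` {(g, g') \<in> ?H \<times> ?H. g \<circ> \<sigma> \<circ> g' = \<sigma>}
        \<subseteq> {(g, g') \<in> ?H \<times> ?H. g \<circ> \<tau> \<circ> g' = \<sigma>}"
        using ab wreath_comp by (auto simp: comp_assoc)
      have "g \<circ> ?a \<circ> \<sigma> \<circ> (?b \<circ> g') = g \<circ> \<tau> \<circ> g'" for g g' :: "nat \<times> nat \<Rightarrow> nat \<times> nat"
        by (simp add: fun_eq_iff ab(3) pw)
      then show "(\<lambda>(g, g'). (g \<circ> ?a, ?b \<circ> g')) ` {(g, g') \<in> ?H \<times> ?H. g \<circ> \<tau> \<circ> g' = \<sigma>}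
        \<subseteq> {(g, g') \<in> ?H \<times> ?H. g \<circ> \<sigma> \<circ> g' = \<sigma>}"
        using ab(1,2) wreath_comp wreath_inv by (intro image_subsetI) (simp add: split_beta)
    qed (auto simp: fun_eq_iff pw)
    then show ?thesis by (rule bij_betw_same_card)
  qed
  then have "(\<Sum>\<sigma>\<in>C. card {(g, g') \<in> ?H \<times> ?H. g \<circ> \<sigma> \<circ> g' = \<sigma>})
     = (\<Sum>\<sigma>\<in>C. card {(g, g') \<in> ?H \<times> ?H. g \<circ> \<tau> \<circ> g' = \<sigma>})"
    by (rule sum.cong[OF refl])
  also have "\<dots> = (\<Sum>\<sigma>\<in>C. sum (\<lambda>_. 1) {x \<in> ?H \<times> ?H. (\<lambda>(g, g'). g \<circ> \<tau> \<circ> g') x = \<sigma>})"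
  proof -
    have "{(g, g') \<in> ?H \<times> ?H. g \<circ> \<tau> \<circ> g' = \<sigma>}
        = {x \<in> ?H \<times> ?H. (\<lambda>(g, g'). g \<circ> \<tau> \<circ> g') x = \<sigma>}" for \<sigma> by auto
    then show ?thesis by (simp only: card_eq_sum)
  qed
  also have "\<dots> = sum (\<lambda>_. 1) (?H \<times> ?H)"
  proof (rule sum.group)
    show "finite (?H \<times> ?H)" using finite_wreath by blast
    show "finite C"
      using in_quotient_imp_subset[OF equiv_dcoset_rel C] finite_perms finite_subset by blast
    show "(\<lambda>(g, g'). g \<circ> \<tau> \<circ> g') ` (?H \<times> ?H) \<subseteq> C"
    proof (rule image_subsetI, clarify)
      fix g g' assume g: "g \<in> ?H" "g' \<in> ?H"
      then have "g \<circ> \<tau> \<circ> g' \<in> perms d n"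
        using \<tau>(1) by (auto simp: wreath_def perms_def intro!: permutes_compose)
      then show "g \<circ> \<tau> \<circ> g' \<in> C" using \<tau> g by (auto simp: dcoset_rel_def)
    qed
  qed
  also have "\<dots> = (card ?H)\<^sup>2" by (simp add: power2_eq_square card_cartesian_product)
  finally show ?thesis .
qed

lemma Z_sym_count:
  "Z_sym d n * (card (wreath d n))\<^sup>2
    = (\<Sum>h\<in>wreath d n. \<Sum>k\<in>wreath d n. card {\<sigma> \<in> perms d n. \<sigma> \<circ> h = k \<circ> \<sigma>})"
proof -
  let ?H = "wreath d n" and ?P = "perms d n"
  have "Z_sym d n * (card ?H)\<^sup>2 = (\<Sum>C\<in>?P // dcoset_rel d n. (card ?H)\<^sup>2)"
    by (simp add: Z_sym_def)
  also have "\<dots> = (\<Sum>C\<in>?P // dcoset_rel d n. \<Sum>\<sigma>\<in>C. card {(g, g') \<in> ?H \<times> ?H. g \<circ> \<sigma> \<circ> g' = \<sigma>})"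
    by (rule sum.cong[OF refl dcoset_class_count[symmetric]])
  also have "\<dots> = (\<Sum>\<sigma>\<in>?P. card {(g, g') \<in> ?H \<times> ?H. g \<circ> \<sigma> \<circ> g' = \<sigma>})"
    by (rule sum_quotient[OF finite_perms equiv_dcoset_rel, symmetric])
  also have "\<dots> = (\<Sum>\<sigma>\<in>?P. \<Sum>x\<in>?H \<times> ?H. if fst x \<circ> \<sigma> \<circ> snd x = \<sigma> then 1 else 0)"
  proof (intro sum.cong refl)
    fix \<sigma>
    have eq: "{(g, g') \<in> ?H \<times> ?H. g \<circ> \<sigma> \<circ> g' = \<sigma>} = {x \<in> ?H \<times> ?H. fst x \<circ> \<sigma> \<circ> snd x = \<sigma>}" by auto
    show "card {(g, g') \<in> ?H \<times> ?H. g \<circ> \<sigma> \<circ> g' = \<sigma>}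
        = (\<Sum>x\<in>?H \<times> ?H. if fst x \<circ> \<sigma> \<circ> snd x = \<sigma> then 1 else 0)"
      unfolding eq by (simp add: finite_wreath flip: sum.inter_filter)
  qed
  also have "\<dots> = (\<Sum>x\<in>?H \<times> ?H. \<Sum>\<sigma>\<in>?P. if fst x \<circ> \<sigma> \<circ> snd x = \<sigma> then 1 else 0)"
    by (rule sum.swap)
  also have "\<dots> = (\<Sum>x\<in>?H \<times> ?H. card {\<sigma> \<in> ?P. fst x \<circ> \<sigma> \<circ> snd x = \<sigma>})"
    by (intro sum.cong refl) (simp add: finite_perms flip: sum.inter_filter)
  also have "\<dots> = (\<Sum>k\<in>?H. \<Sum>g\<in>?H. card {\<sigma> \<in> ?P. k \<circ> \<sigma> \<circ> g = \<sigma>})"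
    by (simp add: sum.cartesian_product split_beta)
  also have "\<dots> = (\<Sum>g\<in>?H. \<Sum>k\<in>?H. card {\<sigma> \<in> ?P. k \<circ> \<sigma> \<circ> g = \<sigma>})"
    by (rule sum.swap)
  \<comment> \<open>With h the inverse of g the fixed point equation becomes the conjugation
    equation counted by \<open>card_conjugators\<close>.\<close>
  also have "\<dots> = (\<Sum>h\<in>?H. \<Sum>k\<in>?H. card {\<sigma> \<in> ?P. \<sigma> \<circ> h = k \<circ> \<sigma>})"
  proof (rule sum.reindex_bij_witness[of _ "inv_into UNIV" "inv_into UNIV"])
    fix g assume g: "g \<in> ?H"
    show "inv_into UNIV (inv_into UNIV g) = g" by (rule inv_inv_eq[OF wreath_bij[OF g]])
    then show "inv_into UNIV (inv_into UNIV g) = g" .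
    show "inv_into UNIV g \<in> ?H" by (rule wreath_inv[OF g])
    then show "inv_into UNIV g \<in> ?H" .
    have "k \<circ> \<sigma> \<circ> g = \<sigma> \<longleftrightarrow> \<sigma> \<circ> inv_into UNIV g = k \<circ> \<sigma>"
      for k \<sigma> :: "nat \<times> nat \<Rightarrow> nat \<times> nat"
    proof
      assume "k \<circ> \<sigma> \<circ> g = \<sigma>"
      then have "\<sigma> \<circ> inv_into UNIV g = k \<circ> \<sigma> \<circ> g \<circ> inv_into UNIV g" by simp
      then show "\<sigma> \<circ> inv_into UNIV g = k \<circ> \<sigma>" by (simp only: comp_assoc wreath_inverses[OF g] comp_id)
    next
      assume "\<sigma> \<circ> inv_into UNIV g = k \<circ> \<sigma>"
      then have "k \<circ> \<sigma> \<circ> g = \<sigma> \<circ> inv_into UNIV g \<circ> g" by simp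
      then show "k \<circ> \<sigma> \<circ> g = \<sigma>" by (simp only: comp_assoc wreath_inverses[OF g] comp_id)
    qed
    then show "(\<Sum>k\<in>?H. card {\<sigma> \<in> ?P. \<sigma> \<circ> inv_into UNIV g = k \<circ> \<sigma>})
       = (\<Sum>k\<in>?H. card {\<sigma> \<in> ?P. k \<circ> \<sigma> \<circ> g = \<sigma>})" by simp
  qed
  finally show ?thesis .
qed

section \<open>Cycle types in the wreath product\<close>

lemma cyc_ind_one: "cyc_ind (\<lambda>_. 1) m = 1"
  by (rule cyc_ind_unique[symmetric]) simp_all

lemma wreath_cycle_index:
  assumes "d \<ge> 1"
  shows "(\<Sum>h\<in>wreath d n. cyc_prod y (\<lambda>_. 1) ({1..n} \<times> {1..d}) h)
    = of_nat (fact d ^ n * fact n) * cyc_ind (\<lambda>i. cyc_ind (\<lambda>l. y (i * l)) d) n"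
  using block_cyc_sum_eq_cyc_ind[of "{1..d}" "{1..n}" y] assms
  by (simp add: block_cyc_sum_def wreath_eq_block_perms comp_def)

text \<open>At y = 1 every group element contributes 1 to the cycle sum and every cycle index is 1,
  so the prefactor is the order of the group.\<close>

lemma card_wreath:
  assumes "d \<ge> 1"
  shows "card (wreath d n) = fact d ^ n * fact n"
proof -
  have "(of_nat (card (wreath d n)) :: xpoly) = of_nat (fact d ^ n * fact n)"
    using wreath_cycle_index[OF assms, of "\<lambda>_. 1" n] by (simp add: cyc_prod_def cyc_ind_one)
  then show ?thesis by (simp only: of_nat_eq_iff)
qed

lemma card_wreath_cycle_type:
  assumes "d \<ge> 1"
  shows "of_nat (card {h \<in> wreath d n. cycle_type ({1..n} \<times> {1..d}) h = p})
    = of_nat (card (wreath d n)) * coeff_tx (Z_series d) n p"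
proof -
  have fin: "finite ({1..n} \<times> {1..d})" by simp
  have "(\<Sum>h\<in>wreath d n. Poly_Mapping.single (cycle_type ({1..n} \<times> {1..d}) h) (1::rat))
     = of_nat (card (wreath d n)) * fps_nth (Z_series d) n"
    using wreath_cycle_index[OF assms, of xvar n]
    by (simp only: cyc_prod_xvar[OF fin] card_wreath[OF assms] Z_series_eq_cyc_ind)
  then have "Poly_Mapping.lookup (\<Sum>h\<in>wreath d n. Poly_Mapping.single (cycle_type ({1..n} \<times> {1..d}) h) (1::rat)) p
     = Poly_Mapping.lookup (of_nat (card (wreath d n)) * fps_nth (Z_series d) n) p"
    by simp
  then show ?thesis
    unfolding lookup_sum_single[OF finite_wreath] lookup_of_nat_mult coeff_tx_def .
qed

lemma Z_sym_formula:
  assumes d: "d \<ge> 1"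
  shows "of_nat (Z_sym d n) =
     (\<Sum>p\<in>partitions (d * n). (coeff_tx (Z_series d) n p)\<^sup>2 * of_nat (Sym (d * n) p))"
proof -
  define A where "A = {1..n} \<times> {1..d}"
  define H where "H = wreath d n"
  define N where "N p = {h \<in> H. cycle_type A h = p}" for p
  have fin: "finite A" and cA: "card A = d * n" by (simp_all add: A_def card_cartesian_product)
  have finH: "finite H" unfolding H_def by (rule finite_wreath)
  have perm: "h permutes A" if "h \<in> H" for h
    using that by (simp add: H_def A_def wreath_def perms_def)
  have "Z_sym d n * (card H)\<^sup>2 = (\<Sum>h\<in>H. \<Sum>k\<in>H.
      if cycle_type A h = cycle_type A k then Sym (d * n) (cycle_type A h) else 0)"
    unfolding H_def Z_sym_count
  proof (intro sum.cong refl)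
    fix h k assume "h \<in> wreath d n" "k \<in> wreath d n"
    then have "h permutes A" "k permutes A" using perm by (simp_all add: H_def)
    from card_conjugators[OF fin this, unfolded cA]
    show "card {\<sigma> \<in> perms d n. \<sigma> \<circ> h = k \<circ> \<sigma>}
       = (if cycle_type A h = cycle_type A k then Sym (d * n) (cycle_type A h) else 0)"
      unfolding perms_def mem_Collect_eq A_def[symmetric] .
  qed
  also have "\<dots> = (\<Sum>h\<in>H. card (N (cycle_type A h)) * Sym (d * n) (cycle_type A h))"
  proof (intro sum.cong refl)
    fix h
    have "(\<Sum>k\<in>H. if cycle_type A h = cycle_type A k then Sym (d * n) (cycle_type A h) else 0)
       = (\<Sum>k\<in>{k \<in> H. cycle_type A h = cycle_type A k}. Sym (d * n) (cycle_type A h))"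
      by (rule sum.inter_filter[OF finH, symmetric])
    moreover have "{k \<in> H. cycle_type A h = cycle_type A k} = N (cycle_type A h)"
      by (auto simp: N_def)
    ultimately show "(\<Sum>k\<in>H. if cycle_type A h = cycle_type A k then Sym (d * n) (cycle_type A h) else 0)
       = card (N (cycle_type A h)) * Sym (d * n) (cycle_type A h)"
      by simp
  qed
  also have "\<dots> = (\<Sum>p\<in>partitions (d * n). \<Sum>h\<in>N p. card (N (cycle_type A h)) * Sym (d * n) (cycle_type A h))"
    unfolding N_def
    by (rule sum.group[symmetric])
      (use finH finite_partitions cycle_type_in_partitions[OF fin perm] cA in auto)
  also have "\<dots> = (\<Sum>p\<in>partitions (d * n). (card (N p))\<^sup>2 * Sym (d * n) p)"
    by (intro sum.cong refl) (simp add: N_def power2_eq_square)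
  finally have "(of_nat (Z_sym d n * (card H)\<^sup>2) :: rat)
      = of_nat (\<Sum>p\<in>partitions (d * n). (card (N p))\<^sup>2 * Sym (d * n) p)" by (rule arg_cong)
  also have "\<dots> = (\<Sum>p\<in>partitions (d * n). (of_nat (card (N p)))\<^sup>2 * of_nat (Sym (d * n) p))"
    by simp
  also have "\<dots> = (\<Sum>p\<in>partitions (d * n). (of_nat (card H) * coeff_tx (Z_series d) n p)\<^sup>2 * of_nat (Sym (d * n) p))"
    unfolding N_def H_def A_def card_wreath_cycle_type[OF d] ..
  also have "\<dots> = (\<Sum>p\<in>partitions (d * n). (coeff_tx (Z_series d) n p)\<^sup>2 * of_nat (Sym (d * n) p)) * (of_nat (card H))\<^sup>2"
    by (simp add: power_mult_distrib sum_distrib_left mult_ac)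
  finally show ?thesis
    using card_wreath[OF d, of n] by (simp add: H_def)
qed

subsection \<open>Symmetric powers as spaces of functions\<close>

lemma fun_sum_apply: "(sum f S) x = (\<Sum>i\<in>S. f i x)"
  for f :: "'a \<Rightarrow> 'b \<Rightarrow> 'c::comm_monoid_add"
  by (induction S rule: infinite_finite_induct) auto

text \<open>Every space in the construction has this form: \<complex>^N with the key
  \<open>id\<close>, tensor powers with the keys taken entrywise, symmetric powers with the multiset
  of keys, tensor products with the pair of keys. The nested symmetric powers are therefore obtained
  by applying one rule twice.\<close>

definition class_funs :: "'i set \<Rightarrow> ('i \<Rightarrow> 'k) \<Rightarrow> ('i \<Rightarrow> complex) set" where
  "class_funs F \<kappa> = {u. (\<forall>x. x \<notin> F \<longrightarrow> u x = 0) \<and> (\<forall>x\<in>F. \<forall>y\<in>F. \<kappa> x = \<kappa> y \<longrightarrow> u x = u y)}"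

lemma class_funsI:
  assumes "\<And>x. x \<notin> F \<Longrightarrow> u x = 0" "\<And>x y. x \<in> F \<Longrightarrow> y \<in> F \<Longrightarrow> \<kappa> x = \<kappa> y \<Longrightarrow> u x = u y"
  shows "u \<in> class_funs F \<kappa>"
  unfolding class_funs_def mem_Collect_eq by (intro conjI allI impI ballI assms)

lemma class_funs_outside: "u \<in> class_funs F \<kappa> \<Longrightarrow> x \<notin> F \<Longrightarrow> u x = 0"
  unfolding class_funs_def by blast

lemma class_funs_eq:
  "u \<in> class_funs F \<kappa> \<Longrightarrow> x \<in> F \<Longrightarrow> y \<in> F \<Longrightarrow> \<kappa> x = \<kappa> y \<Longrightarrow> u x = u y"
  unfolding class_funs_def by blast

definition class_ind :: "'i set \<Rightarrow> ('i \<Rightarrow> 'k) \<Rightarrow> 'k \<Rightarrow> 'i \<Rightarrow> complex" where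
  "class_ind F \<kappa> c = (\<lambda>x. if x \<in> F \<and> \<kappa> x = c then 1 else 0)"

lemma class_ind_in_class_funs: "class_ind F \<kappa> c \<in> class_funs F \<kappa>"
  by (rule class_funsI) (auto simp: class_ind_def)

lemma subspace_class_funs: "cfun.subspace (class_funs F \<kappa>)"
  unfolding cfun.subspace_def
proof (intro conjI ballI allI)
  show "0 \<in> class_funs F \<kappa>" by (rule class_funsI) auto
  fix u v assume u: "u \<in> class_funs F \<kappa>" "v \<in> class_funs F \<kappa>"
  show "u + v \<in> class_funs F \<kappa>"
  proof (rule class_funsI)
    fix x y assume "x \<in> F" "y \<in> F" "\<kappa> x = \<kappa> y"
    then show "(u + v) x = (u + v) y"
      using class_funs_eq[OF u(1), of x y] class_funs_eq[OF u(2), of x y] by simp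
  qed (simp add: class_funs_outside[OF u(1)] class_funs_outside[OF u(2)])
next
  fix c u assume u: "u \<in> class_funs F \<kappa>"
  show "fscale c u \<in> class_funs F \<kappa>"
  proof (rule class_funsI)
    fix x y assume "x \<in> F" "y \<in> F" "\<kappa> x = \<kappa> y"
    then show "fscale c u x = fscale c u y"
      using class_funs_eq[OF u, of x y] by (simp add: fscale_def)
  qed (simp add: class_funs_outside[OF u] fscale_def)
qed

lemma class_funs_subset_span:
  assumes "finite F"
  shows "class_funs F \<kappa> \<subseteq> cfun.span (class_ind F \<kappa> ` \<kappa> ` F)"
proof
  fix u assume u: "u \<in> class_funs F \<kappa>"
  have eq: "(\<Sum>c\<in>\<kappa> ` F. fscale (u (inv_into F \<kappa> c)) (class_ind F \<kappa> c)) = u"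
  proof
    fix x
    have "(\<Sum>c\<in>\<kappa> ` F. fscale (u (inv_into F \<kappa> c)) (class_ind F \<kappa> c)) x
        = (\<Sum>c\<in>\<kappa> ` F. if c = \<kappa> x then (if x \<in> F then u (inv_into F \<kappa> c) else 0) else 0)"
      unfolding fun_sum_apply by (rule sum.cong) (auto simp: fscale_def class_ind_def)
    also have "\<dots> = u x"
    proof (cases "x \<in> F")
      case True
      then have "u (inv_into F \<kappa> (\<kappa> x)) = u x"
        by (intro class_funs_eq[OF u] inv_into_into f_inv_into_f) auto
      then show ?thesis using True assms by (simp add: sum.delta')
    next
      case False
      then show ?thesis using class_funs_outside[OF u] by (simp add: sum.neutral)
    qed
    finally show "(\<Sum>c\<in>\<kappa> ` F. fscale (u (inv_into F \<kappa> c)) (class_ind F \<kappa> c)) x = u x" .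
  qed
  have "(\<Sum>c\<in>\<kappa> ` F. fscale (u (inv_into F \<kappa> c)) (class_ind F \<kappa> c))
      \<in> cfun.span (class_ind F \<kappa> ` \<kappa> ` F)"
    by (intro cfun.span_sum cfun.span_scale cfun.span_base) auto
  then show "u \<in> cfun.span (class_ind F \<kappa> ` \<kappa> ` F)" by (simp only: eq)
qed

text \<open>One inclusion holds because pure tensors are constant on the fibres of
  \<open>map \<kappa>\<close>. For the other, the indicator of such a fibre is the pure tensor of
  the indicators of the fibres of its entries, and these indicators span.\<close>

lemma tensor_power_class_funs:
  assumes "finite F"
  shows "tensor_power k (class_funs F \<kappa>) = class_funs {xs. length xs = k \<and> set xs \<subseteq> F} (map \<kappa>)"
    (is "?L = class_funs ?S _")
proof
  show "?L \<subseteq> class_funs ?S (map \<kappa>)"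
    unfolding tensor_power_def
  proof (rule cfun.span_minimal[OF _ subspace_class_funs], clarify)
    fix u assume u: "\<forall>l<k. u l \<in> class_funs F \<kappa>"
    show "pure_power k u \<in> class_funs ?S (map \<kappa>)"
    proof (rule class_funsI)
      fix xs assume xs: "xs \<notin> ?S"
      show "pure_power k u xs = 0"
      proof (cases "length xs = k")
        case True
        then obtain x where "x \<in> set xs" "x \<notin> F" using xs by auto
        then obtain l where "l < k" "xs ! l \<notin> F" using True by (auto simp: in_set_conv_nth)
        then have "u l (xs ! l) = 0"
          using class_funs_outside[of "u l" F \<kappa> "xs ! l"] u by simp
        then have "(\<Prod>l<k. u l (xs ! l)) = 0" using \<open>l < k\<close> by (intro prod_zero) auto
        then show ?thesis by (simp add: pure_power_def)
      qed (simp add: pure_power_def)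
    next
      fix xs ys assume xy: "xs \<in> ?S" "ys \<in> ?S" "map \<kappa> xs = map \<kappa> ys"
      have "u l (xs ! l) = u l (ys ! l)" if l: "l < k" for l
      proof (rule class_funs_eq[where F = F and \<kappa> = \<kappa>])
        show "u l \<in> class_funs F \<kappa>" using u l by blast
        show "xs ! l \<in> F" "ys ! l \<in> F" using xy(1,2) l nth_mem by auto
        have "map \<kappa> xs ! l = map \<kappa> ys ! l" using xy(3) by simp
        then show "\<kappa> (xs ! l) = \<kappa> (ys ! l)" using xy(1,2) l by simp
      qed
      then show "pure_power k u xs = pure_power k u ys"
        using xy(1,2) by (simp add: pure_power_def)
    qed
  qed
  have fin: "finite ?S" using finite_lists_length_eq[OF assms, of k] by (simp add: conj_commute)
  have "cfun.span (class_ind ?S (map \<kappa>) ` map \<kappa> ` ?S) \<subseteq> ?L"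
  proof (rule cfun.span_minimal)
    show "cfun.subspace ?L" unfolding tensor_power_def by (rule cfun.subspace_span)
    show "class_ind ?S (map \<kappa>) ` map \<kappa> ` ?S \<subseteq> ?L"
    proof clarify
      fix xs assume xs: "k = length xs" "set xs \<subseteq> F"
      have eq: "class_ind {ys. length ys = length xs \<and> set ys \<subseteq> F} (map \<kappa>) (map \<kappa> xs)
          = pure_power (length xs) (\<lambda>l. class_ind F \<kappa> (map \<kappa> xs ! l))"
      proof
        fix ys
        have "(set ys \<subseteq> F \<and> map \<kappa> ys = map \<kappa> xs)
            \<longleftrightarrow> (\<forall>l<length xs. ys ! l \<in> F \<and> \<kappa> (ys ! l) = map \<kappa> xs ! l)" if "length ys = length xs"
          using that by (auto simp: set_conv_nth list_eq_iff_nth_eq)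
        moreover have "(\<Prod>l<length xs. class_ind F \<kappa> (map \<kappa> xs ! l) (ys ! l))
            = (if \<forall>l<length xs. ys ! l \<in> F \<and> \<kappa> (ys ! l) = map \<kappa> xs ! l then 1 else 0)"
          by (auto simp: class_ind_def intro!: prod.neutral)
        ultimately show "class_ind {ys. length ys = length xs \<and> set ys \<subseteq> F} (map \<kappa>) (map \<kappa> xs) ys
          = pure_power (length xs) (\<lambda>l. class_ind F \<kappa> (map \<kappa> xs ! l)) ys"
          by (simp add: class_ind_def[of "{ys. length ys = length xs \<and> set ys \<subseteq> F}"] pure_power_def)
      qed
      show "class_ind {ys. length ys = length xs \<and> set ys \<subseteq> F} (map \<kappa>) (map \<kappa> xs)
          \<in> tensor_power (length xs) (class_funs F \<kappa>)"
        unfolding tensor_power_def eq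
        by (intro cfun.span_base CollectI exI[of _ "\<lambda>l. class_ind F \<kappa> (map \<kappa> xs ! l)"]
            conjI refl allI impI class_ind_in_class_funs)
    qed
  qed
  then show "class_funs ?S (map \<kappa>) \<subseteq> ?L" using class_funs_subset_span[OF fin] by blast
qed

text \<open>Two lists with the same multiset of keys agree, after permuting one of them, in the key
  of every entry. So symmetry together with constancy on the fibres of \<open>map \<kappa>\<close>
  is constancy on the fibres of the multiset.\<close>

lemma sym_power_class_funs:
  assumes "finite F"
  shows "sym_power k (class_funs F \<kappa>)
    = class_funs {xs. length xs = k \<and> set xs \<subseteq> F} (\<lambda>xs. mset (map \<kappa> xs))"
    (is "?L = class_funs ?S ?\<kappa>")
proof
  show "?L \<subseteq> class_funs ?S ?\<kappa>"
  proof
    fix T assume "T \<in> ?L"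
    then have T: "T \<in> class_funs ?S (map \<kappa>)"
      and sym: "\<And>\<pi> js. \<pi> permutes {..<k} \<Longrightarrow> length js = k \<Longrightarrow> T (permute_list \<pi> js) = T js"
      unfolding sym_power_def tensor_power_class_funs[OF assms] by auto
    show "T \<in> class_funs ?S ?\<kappa>"
    proof (rule class_funsI)
      fix xs ys assume xy: "xs \<in> ?S" "ys \<in> ?S" "mset (map \<kappa> xs) = mset (map \<kappa> ys)"
      obtain \<pi> where \<pi>: "\<pi> permutes {..<length ys}" "permute_list \<pi> (map \<kappa> ys) = map \<kappa> xs"
        using mset_eq_permutation[OF xy(3)] by auto
      have "map \<kappa> (permute_list \<pi> ys) = map \<kappa> xs"
        using \<pi> by (simp add: permute_list_map)
      moreover have "permute_list \<pi> ys \<in> ?S" using xy(2) \<pi>(1) by simp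
      ultimately have "T (permute_list \<pi> ys) = T xs" using class_funs_eq[OF T _ xy(1)] by blast
      then show "T xs = T ys" using sym[of \<pi> ys] \<pi>(1) xy(2) by simp
    qed (rule class_funs_outside[OF T])
  qed
  show "class_funs ?S ?\<kappa> \<subseteq> ?L"
  proof
    fix T assume T: "T \<in> class_funs ?S ?\<kappa>"
    have "T \<in> class_funs ?S (map \<kappa>)"
    proof (rule class_funsI)
      fix xs ys assume "xs \<in> ?S" "ys \<in> ?S" "map \<kappa> xs = map \<kappa> ys"
      then show "T xs = T ys" by (intro class_funs_eq[OF T]) simp_all
    qed (rule class_funs_outside[OF T])
    moreover have "T (permute_list \<pi> js) = T js" if "\<pi> permutes {..<k}" "length js = k" for \<pi> js
    proof (cases "set js \<subseteq> F")
      case True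
      then show ?thesis
        using that by (intro class_funs_eq[OF T]) (auto simp flip: permute_list_map)
    next
      case False
      then have "js \<notin> ?S" "permute_list \<pi> js \<notin> ?S" using that by auto
      then show ?thesis using class_funs_outside[OF T] by metis
    qed
    ultimately show "T \<in> ?L"
      unfolding sym_power_def tensor_power_class_funs[OF assms] by blast
  qed
qed

lemma tensor_prod_class_funs:
  assumes "finite F" "finite G"
  shows "tensor_prod (class_funs F \<kappa>) (class_funs G \<nu>) = class_funs (F \<times> G) (map_prod \<kappa> \<nu>)"
proof
  show "tensor_prod (class_funs F \<kappa>) (class_funs G \<nu>) \<subseteq> class_funs (F \<times> G) (map_prod \<kappa> \<nu>)"
    unfolding tensor_prod_def
  proof (rule cfun.span_minimal[OF _ subspace_class_funs], clarify)
    fix u w assume u: "u \<in> class_funs F \<kappa>" and w: "w \<in> class_funs G \<nu>"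
    show "pure_prod u w \<in> class_funs (F \<times> G) (map_prod \<kappa> \<nu>)"
    proof (rule class_funsI)
      fix x assume "x \<notin> F \<times> G"
      then show "pure_prod u w x = 0"
        using class_funs_outside[OF u] class_funs_outside[OF w] by (cases x) (auto simp: pure_prod_def)
    next
      fix x y assume "x \<in> F \<times> G" "y \<in> F \<times> G" "map_prod \<kappa> \<nu> x = map_prod \<kappa> \<nu> y"
      then show "pure_prod u w x = pure_prod u w y"
        using class_funs_eq[OF u, of "fst x" "fst y"] class_funs_eq[OF w, of "snd x" "snd y"]
        by (auto simp: pure_prod_def)
    qed
  qed
  have "cfun.span (class_ind (F \<times> G) (map_prod \<kappa> \<nu>) ` map_prod \<kappa> \<nu> ` (F \<times> G))
      \<subseteq> tensor_prod (class_funs F \<kappa>) (class_funs G \<nu>)"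
  proof (rule cfun.span_minimal)
    show "cfun.subspace (tensor_prod (class_funs F \<kappa>) (class_funs G \<nu>))"
      unfolding tensor_prod_def by (rule cfun.subspace_span)
    show "class_ind (F \<times> G) (map_prod \<kappa> \<nu>) ` map_prod \<kappa> \<nu> ` (F \<times> G)
        \<subseteq> tensor_prod (class_funs F \<kappa>) (class_funs G \<nu>)"
    proof clarify
      fix x y
      have eq: "class_ind (F \<times> G) (map_prod \<kappa> \<nu>) (\<kappa> x, \<nu> y)
          = pure_prod (class_ind F \<kappa> (\<kappa> x)) (class_ind G \<nu> (\<nu> y))"
        by (auto simp: class_ind_def pure_prod_def fun_eq_iff)
      show "class_ind (F \<times> G) (map_prod \<kappa> \<nu>) (\<kappa> x, \<nu> y)
          \<in> tensor_prod (class_funs F \<kappa>) (class_funs G \<nu>)"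
        unfolding tensor_prod_def eq
        by (intro cfun.span_base CollectI exI[of _ "class_ind F \<kappa> (\<kappa> x)"]
            exI[of _ "class_ind G \<nu> (\<nu> y)"] conjI refl class_ind_in_class_funs)
    qed
  qed
  then show "class_funs (F \<times> G) (map_prod \<kappa> \<nu>) \<subseteq> tensor_prod (class_funs F \<kappa>) (class_funs G \<nu>)"
    using class_funs_subset_span[of "F \<times> G" "map_prod \<kappa> \<nu>"] assms by blast
qed

section \<open>Coordinates of the representation space\<close>

definition index_lists :: "nat \<Rightarrow> nat \<Rightarrow> nat \<Rightarrow> nat list list set" where
  "index_lists d n N = {I. length I = n \<and> set I \<subseteq> {xs. length xs = d \<and> set xs \<subseteq> {..<N}}}"

lemma finite_index_lists: "finite (index_lists d n N)"
proof -
  have "finite {xs. length xs = d \<and> set xs \<subseteq> {..<N}}"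
    using finite_lists_length_eq[of "{..<N}" d] by (simp add: conj_commute)
  from finite_lists_length_eq[OF this, of n] show ?thesis
    by (simp add: index_lists_def conj_commute)
qed

lemma sym_sym_space_eq:
  "sym_sym_space d n N = class_funs (index_lists d n N \<times> index_lists d n N)
     (map_prod (\<lambda>I. mset (map mset I)) (\<lambda>I. mset (map mset I)))"
proof -
  have fin: "finite {xs. length xs = d \<and> set xs \<subseteq> {..<N}}"
    using finite_lists_length_eq[of "{..<N}" d] by (simp add: conj_commute)
  have "std_space N = class_funs {..<N} id"
    by (auto simp: std_space_def class_funs_def)
  then have "sym_power n (sym_power d (std_space N))
      = class_funs (index_lists d n N) (\<lambda>I. mset (map mset I))"
    by (simp add: sym_power_class_funs[OF fin] sym_power_class_funs index_lists_def)
  then show ?thesis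
    by (simp add: sym_sym_space_def tensor_prod_class_funs finite_index_lists)
qed

subsection \<open>Unitary invariants of mixed tensors\<close>

lemma mat_adjoint_index:
  assumes "g \<in> carrier_mat N N" "i < N" "j < N"
  shows "mat_adjoint g $$ (i, j) = cnj (g $$ (j, i))"
  using assms by (simp add: mat_adjoint_def mat_of_rows_def)

lemma unitary_group_iff:
  "g \<in> unitary_group N \<longleftrightarrow> g \<in> carrier_mat N N \<and>
     (\<forall>i<N. \<forall>k<N. (\<Sum>j<N. g $$ (i, j) * cnj (g $$ (k, j))) = (if i = k then 1 else 0))"
proof -
  have "g * mat_adjoint g = 1\<^sub>m N \<longleftrightarrow>
     (\<forall>i<N. \<forall>k<N. (\<Sum>j<N. g $$ (i, j) * cnj (g $$ (k, j))) = (if i = k then 1 else 0))"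
    if g: "g \<in> carrier_mat N N"
  proof -
    have a: "mat_adjoint g \<in> carrier_mat N N" using g by (simp add: mat_adjoint_def mat_of_rows_def)
    have "(g * mat_adjoint g) $$ (i, k) = (\<Sum>j<N. g $$ (i, j) * cnj (g $$ (k, j)))"
      if "i < N" "k < N" for i k
      using that g a mat_adjoint_index[OF g]
      by (simp add: scalar_prod_def atLeast0LessThan)
    then show ?thesis
      using g a by (simp add: mat_eq_iff)
  qed
  then show ?thesis by (auto simp: unitary_group_def)
qed

definition entry :: "complex mat \<Rightarrow> 'p + 'p \<Rightarrow> nat \<Rightarrow> nat \<Rightarrow> complex" where
  "entry g q i j = (case q of Inl _ \<Rightarrow> g $$ (i, j) | Inr _ \<Rightarrow> cnj (g $$ (i, j)))"

lemma entry_mat: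
  assumes "i < N" "j < N"
  shows "entry (mat N N f) q i j = (case q of Inl _ \<Rightarrow> f (i, j) | Inr _ \<Rightarrow> cnj (f (i, j)))"
  using assms by (cases q) (simp_all add: entry_def)

abbreviation index_maps :: "nat \<Rightarrow> 'p set \<Rightarrow> ('p + 'p \<Rightarrow> nat) set" where
  "index_maps N P \<equiv> PiE (P <+> P) (\<lambda>_. {..<N})"

text \<open>The maps \<open>P <+> P \<rightarrow> {..<N}\<close> index the entries of a mixed tensor: \<open>Inl p\<close> is an index of a
  vector factor, \<open>Inr p\<close> one of a conjugate factor.\<close>

definition U_invariant :: "nat \<Rightarrow> 'p set \<Rightarrow> (('p + 'p \<Rightarrow> nat) \<Rightarrow> complex) \<Rightarrow> bool" where
  "U_invariant N P t \<longleftrightarrow> (\<forall>g\<in>unitary_group N. \<forall>e\<in>index_maps N P.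
     (\<Sum>e'\<in>index_maps N P. (\<Prod>q\<in>P <+> P. entry g q (e q) (e' q)) * t e') = t e)"

text \<open>The matrix with entry \<open>z i\<close> at position (i, \<pi> i) and zeros elsewhere is
  unitary, and in the invariance equation for it only one index map contributes. Diagonal and
  permutation matrices are the two special cases.\<close>

lemma U_invariant_monomial:
  fixes t :: "('p + 'p \<Rightarrow> nat) \<Rightarrow> complex"
  assumes inv: "U_invariant N P t" and fin: "finite P" and e: "e \<in> index_maps N P"
    and \<pi>: "\<pi> permutes {..<N}" and z: "\<And>i. i < N \<Longrightarrow> norm (z i) = 1"
  shows "t e = (\<Prod>q\<in>P <+> P. case q of Inl _ \<Rightarrow> z (e q) | Inr _ \<Rightarrow> cnj (z (e q)))
    * t (restrict (\<pi> \<circ> e) (P <+> P))"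
proof -
  define g where "g = mat N N (\<lambda>(i, j). if j = \<pi> i then z i else 0)"
  have \<pi>N: "\<pi> i < N" if "i < N" for i using permutes_in_image[OF \<pi>, of i] that by simp
  have "g \<in> unitary_group N"
    unfolding unitary_group_iff
  proof (intro conjI allI impI)
    show "g \<in> carrier_mat N N" by (simp add: g_def)
    fix i k assume i: "i < N" and k: "k < N"
    have "(\<Sum>j<N. g $$ (i, j) * cnj (g $$ (k, j)))
        = (\<Sum>j<N. if j = \<pi> i then (if \<pi> i = \<pi> k then z i * cnj (z k) else 0) else 0)"
      using i k by (intro sum.cong) (auto simp: g_def)
    also have "\<dots> = (if \<pi> i = \<pi> k then z i * cnj (z k) else 0)"
      using \<pi>N[OF i] by (simp add: sum.delta)
    also have "\<dots> = (if i = k then 1 else 0)"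
    proof -
      have "\<pi> i = \<pi> k \<longleftrightarrow> i = k" using permutes_inj[OF \<pi>] by (auto dest: injD)
      moreover have "z i * cnj (z i) = 1" unfolding complex_norm_square[symmetric] z[OF i] by simp
      ultimately show ?thesis by (cases "i = k") simp_all
    qed
    finally show "(\<Sum>j<N. g $$ (i, j) * cnj (g $$ (k, j))) = (if i = k then 1 else 0)" .
  qed
  then have t: "t e = (\<Sum>e'\<in>index_maps N P. (\<Prod>q\<in>P <+> P. entry g q (e q) (e' q)) * t e')"
    using inv e unfolding U_invariant_def by simp
  let ?e = "restrict (\<pi> \<circ> e) (P <+> P)"
  let ?c = "\<Prod>q\<in>P <+> P. case q of Inl _ \<Rightarrow> z (e q) | Inr _ \<Rightarrow> cnj (z (e q))"
  have eN: "e q < N" if "q \<in> P <+> P" for q using e that by (auto simp: PiE_def Pi_def)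
  have "(\<Prod>q\<in>P <+> P. entry g q (e q) (e' q)) * t e' = (if e' = ?e then ?c * t ?e else 0)"
    if e': "e' \<in> index_maps N P" for e'
  proof (cases "e' = ?e")
    case True
    have "(\<Prod>q\<in>P <+> P. entry g q (e q) (e' q)) = ?c"
    proof (rule prod.cong[OF refl])
      fix q assume q: "q \<in> P <+> P"
      then show "entry g q (e q) (e' q) = (case q of Inl _ \<Rightarrow> z (e q) | Inr _ \<Rightarrow> cnj (z (e q)))"
        unfolding g_def using eN[OF q] \<pi>N[OF eN[OF q]] by (cases q) (simp_all add: True entry_mat)
    qed
    then show ?thesis using True by simp
  next
    case False
    have "\<exists>q\<in>P <+> P. e' q \<noteq> \<pi> (e q)"
    proof (rule ccontr)
      assume "\<not> ?thesis"
      then have "e' = ?e" using e' by (intro ext) (auto simp: PiE_def extensional_def)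
      then show False using False by simp
    qed
    then obtain q where q: "q \<in> P <+> P" "e' q \<noteq> \<pi> (e q)" by blast
    have "e' q < N" using e' q(1) by (auto simp: PiE_def Pi_def)
    then have "entry g q (e q) (e' q) = 0"
      unfolding g_def using q eN[OF q(1)] by (cases q) (simp_all add: entry_mat)
    then have "(\<Prod>q\<in>P <+> P. entry g q (e q) (e' q)) = 0"
      using q(1) fin by (intro prod_zero) auto
    then show ?thesis using False by simp
  qed
  then have "t e = (\<Sum>e'\<in>index_maps N P. if e' = ?e then ?c * t ?e else 0)"
    unfolding t by (intro sum.cong) auto
  also have "\<dots> = ?c * t ?e"
  proof -
    have "?e \<in> index_maps N P" using eN \<pi>N by auto
    moreover have "finite (index_maps N P)" using fin by (intro finite_PiE) auto
    ultimately show ?thesis by (simp add: sum.delta)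
  qed
  finally show ?thesis .
qed

text \<open>A diagonal matrix with z at position b and 1 elsewhere multiplies the value by z^m1 (cnj
  z)^m2, where m1 and m2 count the occurrences of b on the two sides. For |z| = 1 this is a power of
  z or of its conjugate with exponent the difference of m1 and m2, which is not constantly
  1.\<close>

lemma U_invariant_torus:
  fixes t :: "('p + 'p \<Rightarrow> nat) \<Rightarrow> complex"
  assumes inv: "U_invariant N P t" and fin: "finite P" and e: "e \<in> index_maps N P"
    and b: "card {p \<in> P. e (Inl p) = b} \<noteq> card {p \<in> P. e (Inr p) = b}"
  shows "t e = 0"
proof (rule ccontr)
  assume t: "t e \<noteq> 0"
  define m1 where "m1 = card {p \<in> P. e (Inl p) = b}"
  define m2 where "m2 = card {p \<in> P. e (Inr p) = b}"
  have pw: "z ^ m1 * cnj z ^ m2 = 1" if z: "norm z = 1" for z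
  proof -
    define w where "w i = (if i = b then z else 1)" for i
    have re: "restrict (id \<circ> e) (P <+> P) = e"
      using e by (auto simp: PiE_def extensional_def fun_eq_iff)
    have "(\<Prod>q\<in>P <+> P. case q of Inl _ \<Rightarrow> w (e q) | Inr _ \<Rightarrow> cnj (w (e q)))
        = (\<Prod>p\<in>P. w (e (Inl p))) * (\<Prod>p\<in>P. cnj (w (e (Inr p))))"
      using fin by (simp add: prod.Plus comp_def)
    also have "(\<Prod>p\<in>P. w (e (Inl p))) = z ^ m1"
      using fin by (simp add: w_def m1_def flip: prod.inter_filter)
    also have "(\<Prod>p\<in>P. cnj (w (e (Inr p)))) = cnj z ^ m2"
    proof -
      have "(\<Prod>p\<in>P. cnj (w (e (Inr p)))) = (\<Prod>p\<in>P. if e (Inr p) = b then cnj z else 1)"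
        by (intro prod.cong) (auto simp: w_def)
      then show ?thesis using fin by (simp add: m2_def flip: prod.inter_filter)
    qed
    finally have "t e = (z ^ m1 * cnj z ^ m2) * t e"
      using U_invariant_monomial[OF inv fin e permutes_id, of w] z unfolding re by (simp add: w_def)
    then show ?thesis using t by simp
  qed
  \<comment> \<open>The witness has k-th power \<open>cis pi\<close> = -1.\<close>
  have no_root: "\<exists>z::complex. norm z = 1 \<and> z ^ k \<noteq> 1" if "k > 0" for k :: nat
  proof (intro exI[of _ "cis (pi / k)"] conjI)
    have "cis (pi / k) ^ k = cis pi" using that by (simp add: DeMoivre)
    then show "cis (pi / k) ^ k \<noteq> 1" by simp
  qed simp
  have unit: "z * cnj z = 1" if "norm z = 1" for z
    unfolding complex_norm_square[symmetric] that by simp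
  consider "m1 > m2" | "m2 > m1" using b by (fastforce simp: m1_def m2_def)
  then show False
  proof cases
    case 1
    then obtain z :: complex where z: "norm z = 1" "z ^ (m1 - m2) \<noteq> 1" using no_root[of "m1 - m2"] by auto
    have "z ^ m1 = z ^ (m1 - m2) * z ^ m2" using 1 by (simp flip: power_add)
    then have "z ^ m1 * cnj z ^ m2 = z ^ (m1 - m2) * (z * cnj z) ^ m2"
      by (simp add: power_mult_distrib)
    then show False using pw[OF z(1)] unit[OF z(1)] z(2) by simp
  next
    case 2
    then obtain z :: complex where z: "norm z = 1" "z ^ (m2 - m1) \<noteq> 1" using no_root[of "m2 - m1"] by auto
    have "cnj z ^ m2 = cnj z ^ (m2 - m1) * cnj z ^ m1" using 2 by (simp flip: power_add)
    then have "z ^ m1 * cnj z ^ m2 = cnj z ^ (m2 - m1) * (z * cnj z) ^ m1"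
      by (simp add: power_mult_distrib)
    then have "cnj (z ^ (m2 - m1)) = 1" using pw[OF z(1)] unit[OF z(1)] by simp
    then have "z ^ (m2 - m1) = 1" by (metis complex_cnj_cnj complex_cnj_one)
    then show False using z(2) by simp
  qed
qed

text \<open>Infinitesimal invariance: the invariance equation for the rotation by \<theta> in the
  plane of a and b is differentiated at \<theta> = 0. The result sums over all ways of changing a
  single index from b to a, or, with the opposite sign, from a to b.\<close>

lemma U_invariant_rotation:
  fixes t :: "('p + 'p \<Rightarrow> nat) \<Rightarrow> complex"
  assumes inv: "U_invariant N P t" and fin: "finite P" and e: "e \<in> index_maps N P"
    and a: "a < N" and b: "b < N" and ab: "a \<noteq> b"
  shows "(\<Sum>q\<in>P <+> P. if e q = b then t (e(q := a)) else if e q = a then - t (e(q := b)) else 0) = 0"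
proof -
  define r :: "real \<Rightarrow> nat \<Rightarrow> nat \<Rightarrow> complex" where
    "r \<theta> i j = (if i = a \<and> j = a \<or> i = b \<and> j = b then of_real (cos \<theta>)
       else if i = a \<and> j = b then - of_real (sin \<theta>)
       else if i = b \<and> j = a then of_real (sin \<theta>)
       else if i = j then 1 else 0)" for \<theta> i j
  \<comment> \<open>The generator of the rotations, that is, the entrywise derivative of
    \<open>r\<close> at 0.\<close>
  define X :: "nat \<Rightarrow> nat \<Rightarrow> complex" where
    "X i j = (if i = a \<and> j = b then - 1 else if i = b \<and> j = a then 1 else 0)" for i j
  define g where "g \<theta> = mat N N (\<lambda>(i, j). r \<theta> i j)" for \<theta>
  \<comment> \<open>The rotation is a real matrix, so vector and conjugate indices contribute with
    the same sign.\<close>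
  have cnj_r: "cnj (r \<theta> i j) = r \<theta> i j" for \<theta> i j by (simp add: r_def)
  have unitary: "g \<theta> \<in> unitary_group N" for \<theta>
    unfolding unitary_group_iff
  proof (intro conjI allI impI)
    show "g \<theta> \<in> carrier_mat N N" by (simp add: g_def)
    fix i k assume i: "i < N" and k: "k < N"
    have sq: "complex_of_real (cos \<theta>) * of_real (cos \<theta>) + of_real (sin \<theta>) * of_real (sin \<theta>) = 1"
      using sin_cos_squared_add3[of \<theta>] by (metis of_real_add of_real_mult of_real_1)
    have "(\<Sum>j<N. g \<theta> $$ (i, j) * cnj (g \<theta> $$ (k, j))) = (\<Sum>j<N. r \<theta> i j * r \<theta> k j)"
      using i k by (intro sum.cong) (auto simp: g_def cnj_r)
    also have "\<dots> = (if i = k then 1 else 0)"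
    proof (cases "i = a \<or> i = b")
      case True
      have "(\<Sum>j<N. r \<theta> i j * r \<theta> k j) = (\<Sum>j\<in>{a, b}. r \<theta> i j * r \<theta> k j)"
        using True a b by (intro sum.mono_neutral_right) (auto simp: r_def)
      also have "\<dots> = r \<theta> i a * r \<theta> k a + r \<theta> i b * r \<theta> k b" using ab by simp
      also have "\<dots> = (if i = k then 1 else 0)"
        using True ab sq by (auto simp: r_def algebra_simps)
      finally show ?thesis .
    next
      case False
      have "(\<Sum>j<N. r \<theta> i j * r \<theta> k j) = (\<Sum>j<N. if j = i then r \<theta> k i else 0)"
        using False by (intro sum.cong) (auto simp: r_def)
      also have "\<dots> = r \<theta> k i" using i by simp
      also have "\<dots> = (if i = k then 1 else 0)" using False by (auto simp: r_def)
      finally show ?thesis .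
    qed
    finally show "(\<Sum>j<N. g \<theta> $$ (i, j) * cnj (g \<theta> $$ (k, j))) = (if i = k then 1 else 0)" .
  qed
  have eN: "e q < N" if "q \<in> P <+> P" for q using e that by (auto simp: PiE_def Pi_def)
  have const: "(\<Sum>e'\<in>index_maps N P. (\<Prod>q\<in>P <+> P. r \<theta> (e q) (e' q)) * t e') = t e" for \<theta>
  proof -
    have "entry (g \<theta>) q (e q) (e' q) = r \<theta> (e q) (e' q)"
      if "e' \<in> index_maps N P" "q \<in> P <+> P" for e' q
    proof -
      have "e' q < N" using that by (auto simp: PiE_def Pi_def)
      then show ?thesis
        unfolding g_def using eN[OF that(2)] by (cases q) (simp_all add: entry_mat cnj_r)
    qed
    then have "(\<Sum>e'\<in>index_maps N P. (\<Prod>q\<in>P <+> P. r \<theta> (e q) (e' q)) * t e')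
       = (\<Sum>e'\<in>index_maps N P. (\<Prod>q\<in>P <+> P. entry (g \<theta>) q (e q) (e' q)) * t e')"
      by (intro sum.cong arg_cong2[of _ _ _ _ "(*)"] prod.cong) auto
    then show ?thesis using inv e unitary unfolding U_invariant_def by simp
  qed
  have dr: "((\<lambda>\<theta>. r \<theta> i j) has_derivative (\<lambda>y. of_real y * X i j)) (at 0)" for i j
  proof -
    have c: "((\<lambda>\<theta>. complex_of_real (cos \<theta>)) has_derivative (\<lambda>y. 0)) (at 0)"
      by (auto intro!: derivative_eq_intros)
    have s: "((\<lambda>\<theta>. complex_of_real (sin \<theta>)) has_derivative of_real) (at 0)"
      by (auto intro!: derivative_eq_intros)
    have s': "((\<lambda>\<theta>. - complex_of_real (sin \<theta>)) has_derivative (\<lambda>y. - of_real y)) (at 0)"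
      by (rule has_derivative_minus[OF s])
    show ?thesis
      using ab by (cases "i = a"; cases "i = b"; cases "j = a"; cases "j = b"; cases "i = j")
        (simp_all add: r_def X_def c s s')
  qed
  have r0: "r 0 i j = (if i = j then 1 else 0)" for i j
    using ab by (cases "i = a"; cases "i = b"; cases "j = a"; cases "j = b") (simp_all add: r_def)
  have "((\<lambda>\<theta>. \<Sum>e'\<in>index_maps N P. (\<Prod>q\<in>P <+> P. r \<theta> (e q) (e' q)) * t e') has_derivative
     (\<lambda>y. \<Sum>e'\<in>index_maps N P. (\<Sum>q\<in>P <+> P. of_real y * X (e q) (e' q)
        * (\<Prod>s\<in>(P <+> P) - {q}. r 0 (e s) (e' s))) * t e')) (at 0)"
    by (intro has_derivative_sum has_derivative_mult_left has_derivative_prod dr)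
  moreover have "((\<lambda>\<theta>. \<Sum>e'\<in>index_maps N P. (\<Prod>q\<in>P <+> P. r \<theta> (e q) (e' q)) * t e') has_derivative
     (\<lambda>y. 0)) (at 0)"
    unfolding const by (rule has_derivative_const)
  ultimately have "(\<lambda>y. \<Sum>e'\<in>index_maps N P. (\<Sum>q\<in>P <+> P. of_real y * X (e q) (e' q)
        * (\<Prod>s\<in>(P <+> P) - {q}. r 0 (e s) (e' s))) * t e') = (\<lambda>y. 0)"
    by (rule has_derivative_unique)
  from fun_cong[OF this, of 1]
  have "0 = (\<Sum>e'\<in>index_maps N P. \<Sum>q\<in>P <+> P. X (e q) (e' q)
        * (\<Prod>s\<in>(P <+> P) - {q}. r 0 (e s) (e' s)) * t e')"
    by (simp add: sum_distrib_right)
  also have "\<dots> = (\<Sum>q\<in>P <+> P. \<Sum>e'\<in>index_maps N P. X (e q) (e' q)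
        * (\<Prod>s\<in>(P <+> P) - {q}. r 0 (e s) (e' s)) * t e')"
    by (rule sum.swap)
  also have "\<dots> = (\<Sum>q\<in>P <+> P. if e q = b then t (e(q := a)) else if e q = a then - t (e(q := b)) else 0)"
  proof (rule sum.cong[OF refl])
    fix q assume q: "q \<in> P <+> P"
    have finV: "finite (index_maps N P)" using fin by (intro finite_PiE) auto
    \<comment> \<open>In the product rule the factors that are not differentiated are entries of the
      identity matrix, so only index maps that agree with \<open>e\<close> away from q
      survive.\<close>
    have \<delta>: "(\<Prod>s\<in>(P <+> P) - {q}. r 0 (e s) (e' s)) = (if e' = e(q := e' q) then 1 else 0)"
      if e': "e' \<in> index_maps N P" for e'
    proof (cases "e' = e(q := e' q)")
      case True
      have "r 0 (e s) (e' s) = 1" if "s \<noteq> q" for s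
        using fun_cong[OF True, of s] that by (simp add: r0)
      then show ?thesis using True by (simp add: prod.neutral)
    next
      case False
      then obtain s where s: "e' s \<noteq> (e(q := e' q)) s" by (auto simp: fun_eq_iff)
      have "s \<in> P <+> P"
      proof (rule ccontr)
        assume "s \<notin> P <+> P"
        then show False using s e e' q by (auto simp: PiE_def extensional_def split: if_splits)
      qed
      then have "(\<Prod>s\<in>(P <+> P) - {q}. r 0 (e s) (e' s)) = 0"
        using s fin by (intro prod_zero bexI[of _ s]) (auto simp: r0 split: if_splits)
      then show ?thesis using False by simp
    qed
    have upd: "e(q := j) \<in> index_maps N P" if "j < N" for j
      using e that q by (auto simp: PiE_def Pi_def extensional_def)
    have "(\<Sum>e'\<in>index_maps N P. X (e q) (e' q) * (\<Prod>s\<in>(P <+> P) - {q}. r 0 (e s) (e' s)) * t e')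
      = (\<Sum>e'\<in>index_maps N P. if e q = b then (if e' = e(q := a) then t (e(q := a)) else 0)
          else if e q = a then (if e' = e(q := b) then - t (e(q := b)) else 0) else 0)"
    proof (rule sum.cong[OF refl])
      fix e' assume e': "e' \<in> index_maps N P"
      have 1: "e' = e(q := j) \<longleftrightarrow> e' = e(q := e' q) \<and> e' q = j" for j by (metis fun_upd_same)
      show "X (e q) (e' q) * (\<Prod>s\<in>(P <+> P) - {q}. r 0 (e s) (e' s)) * t e'
        = (if e q = b then (if e' = e(q := a) then t (e(q := a)) else 0)
          else if e q = a then (if e' = e(q := b) then - t (e(q := b)) else 0) else 0)"
        unfolding \<delta>[OF e'] 1[of a] 1[of b] using ab by (auto simp: X_def)
    qed
    also have "\<dots> = (if e q = b then t (e(q := a)) else if e q = a then - t (e(q := b)) else 0)"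
    proof -
      have "(\<Sum>e'\<in>index_maps N P. if e' = e(q := j) then x else 0) = x" if "j < N" for j and x :: complex
        using sum.delta[OF finV, of "e(q := j)" "\<lambda>_. x"] upd[OF that] by (simp only: if_True)
      note s = this[OF a] this[OF b]
      show ?thesis
        by (cases "e q = b"; cases "e q = a") (simp_all only: s if_True if_False simp_thms sum.neutral_const)
    qed
    finally show "(\<Sum>e'\<in>index_maps N P. X (e q) (e' q) * (\<Prod>s\<in>(P <+> P) - {q}. r 0 (e s) (e' s)) * t e')
      = (if e q = b then t (e(q := a)) else if e q = a then - t (e(q := b)) else 0)" .
  qed
  finally show ?thesis ..
qed

section \<open>When an invariant vanishes\<close>

lemma inj_on_extends_to_permutation:
  assumes S: "finite S" and A: "A \<subseteq> S" and f: "inj_on f A" "f ` A \<subseteq> S"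
  obtains \<pi> where "\<pi> permutes S" "\<And>x. x \<in> A \<Longrightarrow> \<pi> x = f x"
proof -
  have fA: "finite A" "finite (f ` A)" using S A f(2) finite_subset by auto
  have "card (S - A) = card (S - f ` A)"
    using S A f fA by (simp add: card_Diff_subset card_image)
  then obtain g where g: "bij_betw g (S - A) (S - f ` A)"
    using S finite_same_card_bij[of "S - A" "S - f ` A"] by auto
  define \<pi> where "\<pi> x = (if x \<in> A then f x else if x \<in> S then g x else x)" for x
  have "bij_betw \<pi> A (f ` A)"
    using f(1) by (simp add: \<pi>_def bij_betw_def inj_on_def)
  moreover have "bij_betw \<pi> (S - A) (S - f ` A)"
    using g by (rule bij_betw_cong[THEN iffD1, rotated]) (auto simp: \<pi>_def)
  ultimately have "bij_betw \<pi> (A \<union> (S - A)) (f ` A \<union> (S - f ` A))"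
    by (rule bij_betw_combine) auto
  moreover have "A \<union> (S - A) = S" "f ` A \<union> (S - f ` A) = S" using A f(2) by auto
  ultimately have "\<pi> permutes S" using A by (intro bij_imp_permutes) (auto simp: \<pi>_def)
  then show thesis by (rule that) (simp add: \<pi>_def)
qed

text \<open>The derivative of the rotations in the plane of \<open>a\<close> and \<open>b\<close>, evaluated after replacing the
  value \<open>a\<close> at \<open>Inl k\<close> by the unused value \<open>b\<close>.\<close>

lemma U_invariant_replace:
  fixes t :: "('p + 'p \<Rightarrow> nat) \<Rightarrow> complex"
  assumes inv: "U_invariant N P t" and fin: "finite P" and e: "e \<in> index_maps N P"
    and k: "k \<in> P" and b: "b < N" "\<And>q. q \<in> P <+> P \<Longrightarrow> e q \<noteq> b"
    and zero: "\<And>p. p \<in> P \<Longrightarrow> t (e(Inl k := b, Inr p := b)) = 0"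
  shows "t e = 0"
proof -
  define a where "a = e (Inl k)"
  define e1 where "e1 = e(Inl k := b)"
  have aN: "a < N" using e k by (auto simp: a_def PiE_def Pi_def)
  have ab: "a \<noteq> b" using b(2)[of "Inl k"] k by (auto simp: a_def)
  have e1: "e1 \<in> index_maps N P"
    using e k b(1) by (auto simp: e1_def PiE_def Pi_def extensional_def)
  have "(if e1 q = b then t (e1(q := a)) else if e1 q = a then - t (e1(q := b)) else 0)
      = (if q = Inl k then t e else 0)" if q: "q \<in> P <+> P" for q
  proof (cases "q = Inl k")
    case True
    then show ?thesis by (simp add: e1_def a_def)
  next
    case False
    then have nb: "e1 q \<noteq> b" using b(2)[OF q] by (simp add: e1_def)
    \<comment> \<open>Two kinds of terms have to disappear. If q is a conjugate index, the value is
      one of those assumed to be zero. If q is a vector index, b occurs among the vector indices but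
      not among the conjugate ones, and diagonal matrices kill the value. Only the term that
      restores \<open>e\<close> remains.\<close>
    have "t (e1(q := b)) = 0"
    proof (cases q)
      case (Inr p)
      then show ?thesis using zero[of p] q by (auto simp: e1_def)
    next
      case (Inl p)
      have "e1(q := b) \<in> index_maps N P"
        using e1 q b(1) by (auto simp: PiE_def Pi_def extensional_def)
      moreover have "card {x \<in> P. (e1(q := b)) (Inl x) = b} \<noteq> card {x \<in> P. (e1(q := b)) (Inr x) = b}"
      proof -
        have "{x \<in> P. (e1(q := b)) (Inr x) = b} = {}"
          using b(2) Inl by (auto simp: e1_def)
        moreover have "k \<in> {x \<in> P. (e1(q := b)) (Inl x) = b}" using k by (simp add: e1_def)
        then have "card {x \<in> P. (e1(q := b)) (Inl x) = b} \<noteq> 0"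
          using fin by (subst card_0_eq) auto
        ultimately show ?thesis by (simp only: card.empty not_False_eq_True)
      qed
      ultimately show ?thesis by (rule U_invariant_torus[OF inv fin])
    qed
    then show ?thesis using nb False by simp
  qed
  then have "(\<Sum>q\<in>P <+> P. if q = Inl k then t e else 0) = 0"
    using U_invariant_rotation[OF inv fin e1 aN b(1) ab] by simp
  then show ?thesis using fin InlI[OF k, of P] by (simp add: sum.delta)
qed

lemma U_invariant_eq_0:
  fixes t :: "('p + 'p \<Rightarrow> nat) \<Rightarrow> complex"
  assumes inv: "U_invariant N P t" and fin: "finite P" and N: "card P \<le> N"
    and f: "inj_on f P" "\<And>p. p \<in> P \<Longrightarrow> f p < N"
    and base: "\<And>e \<sigma>. e \<in> index_maps N P \<Longrightarrow> \<sigma> permutes P \<Longrightarrow> (\<And>p. p \<in> P \<Longrightarrow> e (Inl p) = f p)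
       \<Longrightarrow> (\<And>p. p \<in> P \<Longrightarrow> e (Inr p) = f (\<sigma> p)) \<Longrightarrow> t e = 0"
    and e: "e \<in> index_maps N P"
  shows "t e = 0"
  using e
proof (induction "card P - card ((\<lambda>p. e (Inl p)) ` P)" arbitrary: e rule: less_induct)
  case less
  note e = less.prems
  let ?u = "\<lambda>p. e (Inl p)"
  have uN: "e (Inl p) < N" "e (Inr p) < N" if "p \<in> P" for p
    using e that by (auto simp: PiE_def Pi_def)
  show ?case
  proof (cases "inj_on ?u P")
    case True
    \<comment> \<open>The map sending each vector index \<open>e (Inl p)\<close> to
      \<open>f p\<close> is well defined by injectivity; it extends to a permutation of all N
      values, whose matrix moves \<open>e\<close> to a map with vector indices
      \<open>f\<close>.\<close>
    define h where "h = f \<circ> the_inv_into P ?u"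
    have h: "h (e (Inl p)) = f p" if "p \<in> P" for p
      using the_inv_into_f_f[OF True that] by (simp add: h_def)
    have i1: "inj_on h (?u ` P)"
      using h f(1) by (auto intro!: inj_onI dest: inj_onD)
    have i2: "h ` ?u ` P \<subseteq> {..<N}" using h f(2) by auto
    have i3: "?u ` P \<subseteq> {..<N}" using uN by auto
    obtain \<pi> where \<pi>: "\<pi> permutes {..<N}" "\<And>x. x \<in> ?u ` P \<Longrightarrow> \<pi> x = h x"
      using inj_on_extends_to_permutation[OF finite_lessThan i3 i1 i2] by blast
    define E where "E = restrict (\<pi> \<circ> e) (P <+> P)"
    have te: "t e = t E"
      using U_invariant_monomial[OF inv fin e \<pi>(1), of "\<lambda>_. 1"] by (simp add: E_def prod.Plus[OF fin fin])
    have e2: "E \<in> index_maps N P"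
      using uN permutes_in_image[OF \<pi>(1)] by (auto simp: E_def)
    have l: "E (Inl p) = f p" if "p \<in> P" for p
      using that \<pi>(2)[of "e (Inl p)"] h[OF that] by (auto simp: E_def)
    show "t e = 0"
    proof (rule ccontr)
      assume "t e \<noteq> 0"
      then have cnt: "card {p \<in> P. E (Inl p) = b} = card {p \<in> P. E (Inr p) = b}" for b
        using U_invariant_torus[OF inv fin e2] te by auto
      \<comment> \<open>A nonzero value forces each b to occur equally often on both sides, so the
        conjugate indices are a rearrangement of the vector indices.\<close>
      have "image_mset (\<lambda>p. E (Inr p)) (mset_set P) = image_mset (\<lambda>p. E (Inl p)) (mset_set P)"
      proof (rule multiset_eqI)
        fix b
        have "count (image_mset g (mset_set P)) b = card {p \<in> P. g p = b}" for g :: "'p \<Rightarrow> nat"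
          using fin by (simp add: count_image_mset vimage_def Int_def conj_commute)
        then show "count (image_mset (\<lambda>p. E (Inr p)) (mset_set P)) b
            = count (image_mset (\<lambda>p. E (Inl p)) (mset_set P)) b"
          using cnt[of b] by simp
      qed
      then obtain \<sigma> where \<sigma>: "\<sigma> permutes P" "\<forall>p\<in>P. E (Inr p) = E (Inl (\<sigma> p))"
        by (rule image_mset_eq_implies_permutes[OF fin])
      have "t E = 0"
      proof (rule base[OF e2 \<sigma>(1)])
        show "E (Inl p) = f p" if "p \<in> P" for p using l[OF that] .
        show "E (Inr p) = f (\<sigma> p)" if "p \<in> P" for p
        proof -
          have "\<sigma> p \<in> P" using permutes_in_image[OF \<sigma>(1)] that by blast
          then show ?thesis using \<sigma>(2) that l by metis
        qed
      qed
      then show False using te \<open>t e \<noteq> 0\<close> by simp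
    qed
  next
    case False
    then obtain k k' where k: "k \<in> P" "k' \<in> P" "k \<noteq> k'" "e (Inl k) = e (Inl k')"
      by (auto simp: inj_on_def)
    have lt: "card (?u ` P) < card P"
      using False fin by (metis card_image_le eq_card_imp_inj_on le_neq_implies_less)
    have "\<exists>b<N. b \<notin> ?u ` P"
    proof (rule ccontr)
      assume "\<not> ?thesis"
      then have "{..<N} \<subseteq> ?u ` P" by blast
      then have "N \<le> card (?u ` P)" using fin card_mono[of "?u ` P" "{..<N}"] by simp
      then show False using lt N by simp
    qed
    then obtain b where b: "b < N" "b \<notin> ?u ` P" by blast
    show "t e = 0"
    proof (cases "b \<in> (\<lambda>p. e (Inr p)) ` P")
      case True
      have "card {p \<in> P. e (Inl p) = b} = 0" using b(2) by (auto simp: card_eq_0_iff)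
      moreover have "card {p \<in> P. e (Inr p) = b} \<noteq> 0" using True fin by (subst card_0_eq) auto
      ultimately show ?thesis by (intro U_invariant_torus[OF inv fin e, of b]) simp
    next
      case nr: False
      show ?thesis
      proof (rule U_invariant_replace[OF inv fin e k(1) b(1)])
        show "e q \<noteq> b" if "q \<in> P <+> P" for q using that b(2) nr by auto
        fix p assume p: "p \<in> P"
        let ?e = "e(Inl k := b, Inr p := b)"
        \<comment> \<open>Overwriting the index at \<open>k\<close> loses no value, because
          \<open>k'\<close> still carries it.\<close>
        have "(\<lambda>p. ?e (Inl p)) ` P = insert b (?u ` P)"
        proof -
          have "?e (Inl x) = (if x = k then b else e (Inl x))" for x by simp
          moreover have "?u ` P = ?u ` (P - {k})" using k by (auto simp: image_iff)
          ultimately show ?thesis using k(1) by (auto simp: image_iff)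
        qed
        then have "card ((\<lambda>p. ?e (Inl p)) ` P) = Suc (card (?u ` P))"
          using b(2) fin by simp
        moreover have "?e \<in> index_maps N P"
          using e k(1) p b(1) by (auto simp: PiE_def Pi_def extensional_def)
        ultimately show "t ?e = 0" using less.hyps[of ?e] lt by simp
      qed
    qed
  qed
qed

subsection \<open>Maps on index pairs and lists of lists\<close>

definition sites :: "nat \<Rightarrow> nat \<Rightarrow> (nat \<times> nat) set" where
  "sites d n = {1..n} \<times> {1..d}"

definition to_lists :: "nat \<Rightarrow> nat \<Rightarrow> (nat \<times> nat \<Rightarrow> 'a) \<Rightarrow> 'a list list" where
  "to_lists d n f = map (\<lambda>a. map (\<lambda>\<alpha>. f (a, \<alpha>)) [1..<Suc d]) [1..<Suc n]"

text \<open>Pairs are numbered from 1 and list positions from 0, hence the subtractions.\<close>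

definition of_lists :: "'a list list \<Rightarrow> nat \<times> nat \<Rightarrow> 'a" where
  "of_lists I = (\<lambda>(a, \<alpha>). I ! (a - 1) ! (\<alpha> - 1))"

lemma finite_sites: "finite (sites d n)" and card_sites: "card (sites d n) = d * n"
  by (simp_all add: sites_def card_cartesian_product)

lemma length_to_lists [simp]: "length (to_lists d n f) = n"
  by (simp add: to_lists_def)

lemma length_to_lists_nth [simp]: "l < n \<Longrightarrow> length (to_lists d n f ! l) = d"
  by (simp add: to_lists_def del: upt_Suc)

lemma to_lists_nth [simp]: "l < n \<Longrightarrow> k < d \<Longrightarrow> to_lists d n f ! l ! k = f (Suc l, Suc k)"
  by (simp add: to_lists_def del: upt_Suc)

lemma of_lists_to_lists: "p \<in> sites d n \<Longrightarrow> of_lists (to_lists d n f) p = f p"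
  by (auto simp: sites_def of_lists_def)

lemma to_lists_cong: "(\<And>p. p \<in> sites d n \<Longrightarrow> f p = g p) \<Longrightarrow> to_lists d n f = to_lists d n g"
  by (auto simp: to_lists_def sites_def simp del: upt_Suc)

lemma to_lists_in_index_lists:
  assumes "\<And>p. p \<in> sites d n \<Longrightarrow> f p < N"
  shows "to_lists d n f \<in> index_lists d n N"
  using assms by (auto simp: index_lists_def to_lists_def sites_def simp del: upt_Suc)

lemma index_lists_nth:
  assumes "I \<in> index_lists d n N" "l < n"
  shows "length (I ! l) = d" "k < d \<Longrightarrow> I ! l ! k < N"
proof -
  have "I ! l \<in> set I" using assms by (simp add: index_lists_def)
  then have "I ! l \<in> {xs. length xs = d \<and> set xs \<subseteq> {..<N}}"
    using assms(1) unfolding index_lists_def by blast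
  then have len: "length (I ! l) = d" and sub: "set (I ! l) \<subseteq> {..<N}" by blast+
  show "length (I ! l) = d" by (rule len)
  assume "k < d"
  then have "I ! l ! k \<in> set (I ! l)" using len by simp
  then show "I ! l ! k < N" using sub by auto
qed

lemma of_lists_less:
  assumes "I \<in> index_lists d n N" "p \<in> sites d n"
  shows "of_lists I p < N"
  using assms(2) index_lists_nth(2)[OF assms(1), of "fst p - 1" "snd p - 1"]
  by (auto simp: sites_def of_lists_def)

lemma to_lists_of_lists:
  assumes "I \<in> index_lists d n N"
  shows "to_lists d n (of_lists I) = I"
proof (rule nth_equalityI)
  show "length (to_lists d n (of_lists I)) = length I" using assms by (simp add: index_lists_def)
  fix l assume "l < length (to_lists d n (of_lists I))"
  then have l: "l < n" by simp
  show "to_lists d n (of_lists I) ! l = I ! l"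
    using l index_lists_nth(1)[OF assms l] by (intro nth_equalityI) (auto simp: of_lists_def)
qed

text \<open>The bridge between the index maps of \<open>U_invariant\<close>, on which permutations
  act by composition, and the nested lists on which the tensors are functions.\<close>

definition enc :: "nat \<Rightarrow> nat \<Rightarrow> ((nat \<times> nat) + (nat \<times> nat) \<Rightarrow> nat) \<Rightarrow> nat list list \<times> nat list list" where
  "enc d n e = (to_lists d n (\<lambda>p. e (Inl p)), to_lists d n (\<lambda>p. e (Inr p)))"

lemma bij_betw_enc:
  "bij_betw (enc d n) (index_maps N (sites d n)) (index_lists d n N \<times> index_lists d n N)"
proof (rule bij_betw_byWitness[where f' = "\<lambda>(I, J).
    restrict (case_sum (of_lists I) (of_lists J)) (sites d n <+> sites d n)"])
  show "\<forall>e\<in>index_maps N (sites d n). (\<lambda>(I, J).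
    restrict (case_sum (of_lists I) (of_lists J)) (sites d n <+> sites d n)) (enc d n e) = e"
  proof (intro ballI ext)
    fix e q assume e: "e \<in> index_maps N (sites d n)"
    show "(\<lambda>(I, J). restrict (case_sum (of_lists I) (of_lists J)) (sites d n <+> sites d n)) (enc d n e) q = e q"
    proof (cases "q \<in> sites d n <+> sites d n")
      case True
      then show ?thesis by (auto simp: enc_def of_lists_to_lists)
    next
      case False
      then show ?thesis using e by (simp add: enc_def PiE_def extensional_def)
    qed
  qed
  show "\<forall>x\<in>index_lists d n N \<times> index_lists d n N. enc d n ((\<lambda>(I, J).
    restrict (case_sum (of_lists I) (of_lists J)) (sites d n <+> sites d n)) x) = x"
  proof clarify
    fix I J assume I: "I \<in> index_lists d n N" and J: "J \<in> index_lists d n N"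
    let ?e = "restrict (case_sum (of_lists I) (of_lists J)) (sites d n <+> sites d n)"
    have "to_lists d n (\<lambda>p. ?e (Inl p)) = to_lists d n (of_lists I)"
      by (rule to_lists_cong) auto
    moreover have "to_lists d n (\<lambda>p. ?e (Inr p)) = to_lists d n (of_lists J)"
      by (rule to_lists_cong) auto
    ultimately show "enc d n ?e = (I, J)"
      by (simp only: enc_def to_lists_of_lists[OF I] to_lists_of_lists[OF J])
  qed
  show "enc d n ` index_maps N (sites d n) \<subseteq> index_lists d n N \<times> index_lists d n N"
    by (auto simp: enc_def PiE_def Pi_def intro!: to_lists_in_index_lists)
  show "(\<lambda>(I, J). restrict (case_sum (of_lists I) (of_lists J)) (sites d n <+> sites d n))
     ` (index_lists d n N \<times> index_lists d n N) \<subseteq> index_maps N (sites d n)"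
    by (auto simp: of_lists_less)
qed

lemma mset_to_lists:
  "mset (map mset (to_lists d n f))
    = image_mset (\<lambda>a. image_mset (\<lambda>\<alpha>. f (a, \<alpha>)) (mset_set {1..d})) (mset_set {1..n})"
  by (simp add: to_lists_def comp_def atLeastLessThanSuc_atLeastAtMost del: upt_Suc)

lemma image_mset_permutes:
  "p permutes A \<Longrightarrow> image_mset p (mset_set A) = mset_set A"
  by (simp add: image_mset_mset_set permutes_inj_on permutes_image)

text \<open>The fibres of the key that describes Sym^n(Sym^d V) are the orbits of the wreath
  product. Equality of the outer multisets provides the permutation \<gamma> of the rows, and
  equality of the multisets of matched rows provides a permutation inside each row.\<close>

lemma mset_to_lists_eq_iff:
  "mset (map mset (to_lists d n f)) = mset (map mset (to_lists d n g))
    \<longleftrightarrow> (\<exists>w\<in>wreath d n. \<forall>p\<in>sites d n. g p = f (w p))"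
proof
  assume "mset (map mset (to_lists d n f)) = mset (map mset (to_lists d n g))"
  then have eq: "image_mset (\<lambda>a. image_mset (\<lambda>\<alpha>. g (a, \<alpha>)) (mset_set {1..d})) (mset_set {1..n})
     = image_mset (\<lambda>a. image_mset (\<lambda>\<alpha>. f (a, \<alpha>)) (mset_set {1..d})) (mset_set {1..n})"
    by (simp only: mset_to_lists)
  obtain \<gamma> where \<gamma>: "\<gamma> permutes {1..n}"
    "\<forall>a\<in>{1..n}. image_mset (\<lambda>\<alpha>. g (a, \<alpha>)) (mset_set {1..d}) = image_mset (\<lambda>\<alpha>. f (\<gamma> a, \<alpha>)) (mset_set {1..d})"
    by (rule image_mset_eq_implies_permutes[OF _ eq]) auto
  have "\<exists>\<delta>. \<delta> permutes {1..d} \<and> (\<forall>\<alpha>\<in>{1..d}. g (a, \<alpha>) = f (\<gamma> a, \<delta> \<alpha>))" if a: "a \<in> {1..n}" for a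
    using image_mset_eq_implies_permutes[OF _ \<gamma>(2)[rule_format, OF a]] by auto
  then obtain \<delta> where \<delta>: "\<And>a. a \<in> {1..n} \<Longrightarrow> \<delta> a permutes {1..d}"
    "\<And>a \<alpha>. a \<in> {1..n} \<Longrightarrow> \<alpha> \<in> {1..d} \<Longrightarrow> g (a, \<alpha>) = f (\<gamma> a, \<delta> a \<alpha>)"
    by metis
  define w where "w = (\<lambda>(a, \<alpha>). if (a, \<alpha>) \<in> sites d n then (\<gamma> a, \<delta> a \<alpha>) else (a, \<alpha>))"
  have w: "w (a, \<alpha>) = (\<gamma> a, \<delta> a \<alpha>)" if "a \<in> {1..n}" "\<alpha> \<in> {1..d}" for a \<alpha>
    using that by (simp add: w_def sites_def)
  have "inj_on w (sites d n)"
  proof (rule inj_onI)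
    fix x y assume xy: "x \<in> sites d n" "y \<in> sites d n" "w x = w y"
    obtain a \<alpha> b \<beta> where x: "x = (a, \<alpha>)" "y = (b, \<beta>)" by (cases x, cases y)
    then have ab: "a \<in> {1..n}" "\<alpha> \<in> {1..d}" "b \<in> {1..n}" "\<beta> \<in> {1..d}"
      using xy(1,2) unfolding sites_def by blast+
    then have "\<gamma> a = \<gamma> b" "\<delta> a \<alpha> = \<delta> b \<beta>" using xy(3) x w by auto
    then have "a = b" using permutes_inj[OF \<gamma>(1)] by (auto dest: injD)
    moreover from this have "\<alpha> = \<beta>"
      using \<open>\<delta> a \<alpha> = \<delta> b \<beta>\<close> permutes_inj[OF \<delta>(1)[OF ab(1)]] by (auto dest: injD)
    ultimately show "x = y" using x by simp
  qed
  moreover have "w ` sites d n \<subseteq> sites d n"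
  proof (rule image_subsetI)
    fix x assume "x \<in> sites d n"
    then obtain a \<alpha> where x: "x = (a, \<alpha>)" "a \<in> {1..n}" "\<alpha> \<in> {1..d}" unfolding sites_def by blast
    then have "\<gamma> a \<in> {1..n}" "\<delta> a \<alpha> \<in> {1..d}"
      using permutes_in_image[OF \<gamma>(1)] permutes_in_image[OF \<delta>(1)[OF x(2)]] by blast+
    then show "w x \<in> sites d n" using x w unfolding sites_def by simp
  qed
  ultimately have "w permutes sites d n"
    using finite_sites[of d n] by (intro bij_imp_permutes) (simp_all add: bij_betw_def endo_inj_surj, auto simp: w_def)
  then have "w \<in> wreath d n"
    unfolding wreath_def perms_def sites_def using \<gamma>(1) \<delta>(1) w by blast
  moreover have "\<forall>p\<in>sites d n. g p = f (w p)" using \<delta>(2) w by (auto simp: sites_def)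
  ultimately show "\<exists>w\<in>wreath d n. \<forall>p\<in>sites d n. g p = f (w p)" by blast
next
  assume "\<exists>w\<in>wreath d n. \<forall>p\<in>sites d n. g p = f (w p)"
  then obtain w where "w \<in> wreath d n" and g: "\<And>p. p \<in> sites d n \<Longrightarrow> g p = f (w p)" by blast
  then obtain \<gamma> \<delta> where \<gamma>: "\<gamma> permutes {1..n}" and \<delta>: "\<And>a. a \<in> {1..n} \<Longrightarrow> \<delta> a permutes {1..d}"
    and w: "\<And>a \<alpha>. a \<in> {1..n} \<Longrightarrow> \<alpha> \<in> {1..d} \<Longrightarrow> w (a, \<alpha>) = (\<gamma> a, \<delta> a \<alpha>)"
    unfolding wreath_def by blast
  define row where "row a = image_mset (\<lambda>\<alpha>. f (a, \<alpha>)) (mset_set {1..d})" for a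
  have "image_mset (\<lambda>\<alpha>. g (a, \<alpha>)) (mset_set {1..d}) = row (\<gamma> a)" if a: "a \<in> {1..n}" for a
  proof -
    have "image_mset (\<lambda>\<alpha>. g (a, \<alpha>)) (mset_set {1..d})
        = image_mset (\<lambda>\<alpha>. f (\<gamma> a, \<alpha>)) (image_mset (\<delta> a) (mset_set {1..d}))"
      unfolding multiset.map_comp using a g w by (intro image_mset_cong) (auto simp: sites_def)
    then show ?thesis by (simp only: image_mset_permutes[OF \<delta>[OF a]] row_def)
  qed
  then have "image_mset (\<lambda>a. image_mset (\<lambda>\<alpha>. g (a, \<alpha>)) (mset_set {1..d})) (mset_set {1..n})
      = image_mset row (image_mset \<gamma> (mset_set {1..n}))"
    unfolding multiset.map_comp by (intro image_mset_cong) auto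
  then show "mset (map mset (to_lists d n f)) = mset (map mset (to_lists d n g))"
    by (simp only: mset_to_lists image_mset_permutes[OF \<gamma>] row_def[abs_def])
qed

section \<open>The group action in coordinates\<close>

lemma power_op_to_lists:
  "power_op n (power_op d A) (to_lists d n f) (to_lists d n f') = (\<Prod>p\<in>sites d n. A (f p) (f' p))"
proof -
  have "power_op n (power_op d A) (to_lists d n f) (to_lists d n f')
      = (\<Prod>l<n. \<Prod>k<d. A (f (Suc l, Suc k)) (f' (Suc l, Suc k)))"
    by (simp add: power_op_def)
  also have "\<dots> = (\<Prod>p\<in>sites d n. A (f p) (f' p))"
    unfolding sites_def prod.cartesian_product' by (simp add: prod.atLeast1_atMost_eq)
  finally show ?thesis .
qed

lemma power_op_outside:
  assumes "\<And>i j. A i j \<noteq> 0 \<Longrightarrow> i < N" and I: "I \<notin> index_lists d n N"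
  shows "power_op n (power_op d A) I I' = 0"
proof (rule ccontr)
  assume nz: "power_op n (power_op d A) I I' \<noteq> 0"
  then have len: "length I = n" and row: "\<And>l. l < n \<Longrightarrow> power_op d A (I ! l) (I' ! l) \<noteq> 0"
    by (auto simp: power_op_def split: if_splits)
  have "length (I ! l) = d \<and> set (I ! l) \<subseteq> {..<N}" if l: "l < n" for l
  proof
    show "length (I ! l) = d" using row[OF l] by (auto simp: power_op_def split: if_splits)
    have "A (I ! l ! k) (I' ! l ! k) \<noteq> 0" if "k < d" for k
      using row[OF l] that by (auto simp: power_op_def split: if_splits)
    then show "set (I ! l) \<subseteq> {..<N}"
      using assms(1) \<open>length (I ! l) = d\<close> by (auto simp: set_conv_nth)
  qed
  then have "x \<in> {xs. length xs = d \<and> set xs \<subseteq> {..<N}}" if "x \<in> set I" for x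
    using that len unfolding in_set_conv_nth by blast
  then have "I \<in> index_lists d n N" using len unfolding index_lists_def by blast
  then show False using I by simp
qed

lemma sym_sym_action_outside:
  assumes "x \<notin> index_lists d n N \<times> index_lists d n N"
  shows "sym_sym_action d n N g T x = 0"
proof -
  have m: "mat_op N h i j \<noteq> 0 \<Longrightarrow> i < N" for h i j by (auto simp: mat_op_def split: if_splits)
  have po: "power_op n (power_op d (mat_op N h)) K K' = 0" if "K \<notin> index_lists d n N" for h K K'
    by (rule power_op_outside[OF m that])
  obtain I J where x: "x = (I, J)" by (cases x)
  have "I \<notin> index_lists d n N \<or> J \<notin> index_lists d n N" using assms x by blast
  then have "power_op n (power_op d (mat_op N g)) I I' = 0
      \<or> power_op n (power_op d (mat_op N (map_mat cnj g))) J J' = 0" for I' J'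
    using po[of I g] po[of J "map_mat cnj g"] by blast
  then have z: "power_op n (power_op d (mat_op N g)) I I'
      * power_op n (power_op d (mat_op N (map_mat cnj g))) J J' = 0" for I' J'
    by simp
  show ?thesis
    unfolding sym_sym_action_def op_apply_def x prod_op_def by (simp add: z split_beta)
qed

text \<open>\<open>op_apply\<close> sums over the support of its argument. As \<open>T\<close>
  vanishes outside the index lists, the sum may be taken over all of them and then transported to
  index maps by \<open>enc\<close>.\<close>

lemma sym_sym_action_enc:
  assumes g: "g \<in> carrier_mat N N" and T: "\<And>x. x \<notin> index_lists d n N \<times> index_lists d n N \<Longrightarrow> T x = 0"
    and e: "e \<in> index_maps N (sites d n)"
  shows "sym_sym_action d n N g T (enc d n e) = (\<Sum>e'\<in>index_maps N (sites d n).
     (\<Prod>q\<in>sites d n <+> sites d n. entry g q (e q) (e' q)) * T (enc d n e'))"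
proof -
  define A where "A = prod_op (power_op n (power_op d (mat_op N g)))
       (power_op n (power_op d (mat_op N (map_mat cnj g))))"
  have "sym_sym_action d n N g T (enc d n e) = (\<Sum>x | T x \<noteq> 0. A (enc d n e) x * T x)"
    by (simp add: sym_sym_action_def op_apply_def A_def)
  also have "\<dots> = (\<Sum>x\<in>index_lists d n N \<times> index_lists d n N. A (enc d n e) x * T x)"
    using T by (intro sum.mono_neutral_left) (auto simp: finite_index_lists)
  also have "\<dots> = (\<Sum>e'\<in>index_maps N (sites d n). A (enc d n e) (enc d n e') * T (enc d n e'))"
    by (rule sum.reindex_bij_betw[OF bij_betw_enc, symmetric])
  also have "\<dots> = (\<Sum>e'\<in>index_maps N (sites d n).
     (\<Prod>q\<in>sites d n <+> sites d n. entry g q (e q) (e' q)) * T (enc d n e'))"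
  proof (rule sum.cong[OF refl])
    fix e' assume e': "e' \<in> index_maps N (sites d n)"
    have lt: "e (Inl p) < N" "e (Inr p) < N" "e' (Inl p) < N" "e' (Inr p) < N" if "p \<in> sites d n" for p
      using e e' that by (auto simp: PiE_def Pi_def)
    have "A (enc d n e) (enc d n e') = (\<Prod>p\<in>sites d n. mat_op N g (e (Inl p)) (e' (Inl p)))
        * (\<Prod>p\<in>sites d n. mat_op N (map_mat cnj g) (e (Inr p)) (e' (Inr p)))"
      by (simp add: A_def prod_op_def enc_def power_op_to_lists)
    also have "(\<Prod>p\<in>sites d n. mat_op N g (e (Inl p)) (e' (Inl p)))
        = (\<Prod>p\<in>sites d n. entry g (Inl p) (e (Inl p)) (e' (Inl p)))"
      using lt by (intro prod.cong) (simp_all add: mat_op_def entry_def)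
    also have "(\<Prod>p\<in>sites d n. mat_op N (map_mat cnj g) (e (Inr p)) (e' (Inr p)))
        = (\<Prod>p\<in>sites d n. entry g (Inr p) (e (Inr p)) (e' (Inr p)))"
      using lt g by (intro prod.cong) (simp_all add: mat_op_def entry_def)
    finally show "A (enc d n e) (enc d n e') * T (enc d n e')
        = (\<Prod>q\<in>sites d n <+> sites d n. entry g q (e q) (e' q)) * T (enc d n e')"
      by (simp add: prod.Plus finite_sites comp_def)
  qed
  finally show ?thesis .
qed

text \<open>Outside the index lists both \<open>T\<close> and its transform vanish, so the equation
  of tensors reduces to the scalar equations indexed by index maps.\<close>

lemma invariants_iff:
  "T \<in> invariants d n N \<longleftrightarrow>
     T \<in> sym_sym_space d n N \<and> U_invariant N (sites d n) (\<lambda>e. T (enc d n e))"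
proof -
  have "(\<forall>g\<in>unitary_group N. sym_sym_action d n N g T = T)
      \<longleftrightarrow> U_invariant N (sites d n) (\<lambda>e. T (enc d n e))" if "T \<in> sym_sym_space d n N"
  proof -
    let ?L = "index_lists d n N \<times> index_lists d n N"
    have T: "T x = 0" if "x \<notin> ?L" for x
      using \<open>T \<in> sym_sym_space d n N\<close> class_funs_outside[OF _ that] unfolding sym_sym_space_eq by blast
    have act: "sym_sym_action d n N g T (enc d n e) = (\<Sum>e'\<in>index_maps N (sites d n).
       (\<Prod>q\<in>sites d n <+> sites d n. entry g q (e q) (e' q)) * T (enc d n e'))"
      if "g \<in> unitary_group N" "e \<in> index_maps N (sites d n)" for g e
      using that by (intro sym_sym_action_enc T) (auto simp: unitary_group_def)
    have "sym_sym_action d n N g T = T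
       \<longleftrightarrow> (\<forall>e\<in>index_maps N (sites d n). sym_sym_action d n N g T (enc d n e) = T (enc d n e))" for g
    proof
      assume eq: "\<forall>e\<in>index_maps N (sites d n). sym_sym_action d n N g T (enc d n e) = T (enc d n e)"
      show "sym_sym_action d n N g T = T"
      proof
        fix x
        show "sym_sym_action d n N g T x = T x"
        proof (cases "x \<in> ?L")
          case True
          then obtain e where "e \<in> index_maps N (sites d n)" "x = enc d n e"
            using bij_betw_imp_surj_on[OF bij_betw_enc[of d n N]] by blast
          then show ?thesis using eq by simp
        next
          case False
          then show ?thesis by (simp add: T sym_sym_action_outside)
        qed
      qed
    qed simp
    then show ?thesis unfolding U_invariant_def using act by simp
  qed
  then show ?thesis by (auto simp: invariants_def)
qed

subsection \<open>The dimension of the space of invariants\<close>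

text \<open>The matrix of a permutation of the dn tensor factors, written as a mixed tensor. A
  single one is in general not symmetric under the wreath product; only sums over double cosets
  are.\<close>

definition perm_tensor :: "nat \<Rightarrow> nat \<Rightarrow> nat \<Rightarrow> (nat \<times> nat \<Rightarrow> nat \<times> nat)
    \<Rightarrow> nat list list \<times> nat list list \<Rightarrow> complex" where
  "perm_tensor d n N \<sigma> = (\<lambda>(I, J). if I \<in> index_lists d n N \<and> J \<in> index_lists d n N
     \<and> (\<forall>p\<in>sites d n. of_lists J p = of_lists I (\<sigma> p)) then 1 else 0)"

lemma perms_iff: "\<sigma> \<in> perms d n \<longleftrightarrow> \<sigma> permutes sites d n"
  by (simp add: perms_def sites_def)

lemma wreath_permutes: "w \<in> wreath d n \<Longrightarrow> w permutes sites d n"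
  by (simp add: wreath_def perms_iff)

lemma enc_in:
  assumes "e \<in> index_maps N (sites d n)"
  shows "enc d n e \<in> index_lists d n N \<times> index_lists d n N"
  by (rule bij_betw_apply[OF bij_betw_enc assms])

lemma perm_tensor_enc:
  assumes "e \<in> index_maps N (sites d n)" "\<sigma> permutes sites d n"
  shows "perm_tensor d n N \<sigma> (enc d n e)
    = (if \<forall>p\<in>sites d n. e (Inr p) = e (Inl (\<sigma> p)) then 1 else 0)"
proof -
  have "\<sigma> p \<in> sites d n" if "p \<in> sites d n" for p using permutes_in_image[OF assms(2)] that by blast
  then show ?thesis
    using enc_in[OF assms(1)] by (simp add: perm_tensor_def enc_def of_lists_to_lists)
qed

text \<open>Only index maps whose conjugate part is the vector part composed with \<sigma>
  contribute, so the sum runs over the vector part alone and factorizes. Each factor is the inner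
  product of two rows of \<open>g\<close>, which unitarity turns into a Kronecker delta.\<close>

lemma U_invariant_perm:
  assumes \<sigma>: "\<sigma> permutes P" and fin: "finite P"
  shows "U_invariant N P (\<lambda>e. if \<forall>p\<in>P. e (Inr p) = e (Inl (\<sigma> p)) then 1 else 0)"
  unfolding U_invariant_def
proof (intro ballI)
  fix g e assume g: "g \<in> unitary_group N" and e: "e \<in> index_maps N P"
  let ?i = "inv_into UNIV \<sigma>"
  have i: "?i permutes P" by (rule permutes_inv[OF \<sigma>])
  have \<sigma>P: "\<sigma> p \<in> P" "?i p \<in> P" if "p \<in> P" for p
    using permutes_in_image[OF \<sigma>] permutes_in_image[OF i] that by blast+
  have eN: "e (Inl p) < N" "e (Inr p) < N" if "p \<in> P" for p
    using e that by (auto simp: PiE_def Pi_def)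
  have finV: "finite (index_maps N P)" using fin by (intro finite_PiE) auto
  have "(\<Sum>e'\<in>index_maps N P. (\<Prod>q\<in>P <+> P. entry g q (e q) (e' q)) *
        (if \<forall>p\<in>P. e' (Inr p) = e' (Inl (\<sigma> p)) then 1 else 0))
      = (\<Sum>e'\<in>{e' \<in> index_maps N P. \<forall>p\<in>P. e' (Inr p) = e' (Inl (\<sigma> p))}.
          \<Prod>q\<in>P <+> P. entry g q (e q) (e' q))"
    unfolding sum.inter_filter[OF finV] by (intro sum.cong refl) simp
  also have "\<dots> = (\<Sum>f\<in>PiE P (\<lambda>_. {..<N}). \<Prod>p\<in>P. g $$ (e (Inl p), f p) * cnj (g $$ (e (Inr (?i p)), f p)))"
  proof (rule sum.reindex_bij_witness[of _ "\<lambda>f. restrict (case_sum f (f \<circ> \<sigma>)) (P <+> P)"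
        "\<lambda>e'. restrict (\<lambda>p. e' (Inl p)) P"])
    fix e' assume e': "e' \<in> {e' \<in> index_maps N P. \<forall>p\<in>P. e' (Inr p) = e' (Inl (\<sigma> p))}"
    let ?f = "restrict (\<lambda>p. e' (Inl p)) P"
    show "restrict (case_sum ?f (?f \<circ> \<sigma>)) (P <+> P) = e'"
    proof
      fix q
      show "restrict (case_sum ?f (?f \<circ> \<sigma>)) (P <+> P) q = e' q"
        using e' \<sigma>P by (cases "q \<in> P <+> P") (auto simp: PiE_def extensional_def)
    qed
    show "?f \<in> PiE P (\<lambda>_. {..<N})" using e' by (auto simp: PiE_def Pi_def)
    have "(\<Prod>q\<in>P <+> P. entry g q (e q) (e' q))
       = (\<Prod>p\<in>P. g $$ (e (Inl p), ?f p)) * (\<Prod>p\<in>P. cnj (g $$ (e (Inr p), ?f (\<sigma> p))))"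
      using e' \<sigma>P by (simp add: prod.Plus[OF fin fin] entry_def)
    also have "(\<Prod>p\<in>P. cnj (g $$ (e (Inr p), ?f (\<sigma> p))))
       = (\<Prod>p\<in>P. cnj (g $$ (e (Inr (?i p)), ?f p)))"
      using prod.permute[OF \<sigma>, of "\<lambda>p. cnj (g $$ (e (Inr (?i p)), ?f p))"]
      by (simp add: comp_def permutes_inverses[OF \<sigma>])
    finally show "(\<Prod>p\<in>P. g $$ (e (Inl p), ?f p) * cnj (g $$ (e (Inr (?i p)), ?f p)))
       = (\<Prod>q\<in>P <+> P. entry g q (e q) (e' q))"
      by (simp only: prod.distrib)
  next
    fix f assume f: "f \<in> PiE P (\<lambda>_. {..<N})"
    show "restrict (\<lambda>p. restrict (case_sum f (f \<circ> \<sigma>)) (P <+> P) (Inl p)) P = f"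
      using f by (auto simp: PiE_def extensional_def fun_eq_iff)
    show "restrict (case_sum f (f \<circ> \<sigma>)) (P <+> P)
        \<in> {e' \<in> index_maps N P. \<forall>p\<in>P. e' (Inr p) = e' (Inl (\<sigma> p))}"
      using f \<sigma>P by (auto simp: PiE_def Pi_def)
  qed
  also have "\<dots> = (\<Prod>p\<in>P. \<Sum>j<N. g $$ (e (Inl p), j) * cnj (g $$ (e (Inr (?i p)), j)))"
    by (rule prod_sum_PiE[symmetric]) (use fin in auto)
  also have "\<dots> = (\<Prod>p\<in>P. if e (Inl p) = e (Inr (?i p)) then 1 else 0)"
    using g eN \<sigma>P by (intro prod.cong refl) (simp add: unitary_group_iff)
  also have "\<dots> = (if \<forall>p\<in>P. e (Inl p) = e (Inr (?i p)) then 1 else 0)"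
    using fin by (auto intro!: prod.neutral)
  also have "(\<forall>p\<in>P. e (Inl p) = e (Inr (?i p))) \<longleftrightarrow> (\<forall>p\<in>P. e (Inr p) = e (Inl (\<sigma> p)))"
    using \<sigma>P permutes_inverses[OF \<sigma>] by metis
  finally show "(\<Sum>e'\<in>index_maps N P. (\<Prod>q\<in>P <+> P. entry g q (e q) (e' q)) *
        (if \<forall>p\<in>P. e' (Inr p) = e' (Inl (\<sigma> p)) then 1 else 0))
      = (if \<forall>p\<in>P. e (Inr p) = e (Inl (\<sigma> p)) then 1 else 0)" .
qed

lemma U_invariant_cong:
  assumes "U_invariant N P t" "\<And>e. e \<in> index_maps N P \<Longrightarrow> t e = t' e"
  shows "U_invariant N P t'"
  using assms(1) unfolding U_invariant_def by (simp add: assms(2) cong: sum.cong)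

lemma U_invariant_sum:
  assumes "\<And>i. i \<in> S \<Longrightarrow> U_invariant N P (t i)"
  shows "U_invariant N P (\<lambda>e. \<Sum>i\<in>S. c i * t i e)"
  unfolding U_invariant_def
proof (intro ballI)
  fix g e assume ge: "g \<in> unitary_group N" "e \<in> index_maps N P"
  define A where "A e' = (\<Prod>q\<in>P <+> P. entry g q (e q) (e' q))" for e'
  have "(\<Sum>e'\<in>index_maps N P. A e' * (\<Sum>i\<in>S. c i * t i e'))
      = (\<Sum>e'\<in>index_maps N P. \<Sum>i\<in>S. c i * (A e' * t i e'))"
    by (simp add: sum_distrib_left mult_ac)
  also have "\<dots> = (\<Sum>i\<in>S. c i * (\<Sum>e'\<in>index_maps N P. A e' * t i e'))"
    by (subst sum.swap) (simp add: sum_distrib_left)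
  also have "\<dots> = (\<Sum>i\<in>S. c i * t i e)"
    using assms ge unfolding U_invariant_def A_def by (intro sum.cong refl) simp
  finally show "(\<Sum>e'\<in>index_maps N P. (\<Prod>q\<in>P <+> P. entry g q (e q) (e' q)) * (\<Sum>i\<in>S. c i * t i e'))
      = (\<Sum>i\<in>S. c i * t i e)" by (simp add: A_def)
qed

lemma U_invariant_diff:
  assumes "U_invariant N P t" "U_invariant N P t'"
  shows "U_invariant N P (\<lambda>e. t e - t' e)"
  using assms unfolding U_invariant_def by (simp add: right_diff_distrib sum_subtractf)

section \<open>Tensors attached to double cosets\<close>

definition dcoset_tensor :: "nat \<Rightarrow> nat \<Rightarrow> nat \<Rightarrow> (nat \<times> nat \<Rightarrow> nat \<times> nat) set
    \<Rightarrow> nat list list \<times> nat list list \<Rightarrow> complex" where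
  "dcoset_tensor d n N C = (\<Sum>\<sigma>\<in>C. perm_tensor d n N \<sigma>)"

lemma dcoset_closed:
  assumes "C \<in> perms d n // dcoset_rel d n" "\<tau> \<in> C" "w \<in> wreath d n" "w' \<in> wreath d n"
  shows "w \<circ> \<tau> \<circ> w' \<in> C"
proof -
  have "\<tau> \<in> perms d n" using in_quotient_imp_subset[OF equiv_dcoset_rel assms(1)] assms(2) by blast
  moreover have "w \<circ> \<tau> \<circ> w' \<in> perms d n"
    using calculation assms(3,4) by (auto simp: wreath_def perms_def intro!: permutes_compose)
  ultimately have "(\<tau>, w \<circ> \<tau> \<circ> w') \<in> dcoset_rel d n"
    using assms(3,4) unfolding dcoset_rel_def by blast
  then show ?thesis by (rule in_quotient_imp_closed[OF equiv_dcoset_rel assms(1,2)])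
qed

text \<open>Rearranging I by w and J by w' in the wreath product replaces \<tau> by w \<tau>
  w'^(-1). This map permutes the double coset, so the sum over it does not change.\<close>

lemma dcoset_tensor_in_sym_sym_space:
  assumes C: "C \<in> perms d n // dcoset_rel d n"
  shows "dcoset_tensor d n N C \<in> sym_sym_space d n N"
  unfolding sym_sym_space_eq
proof (rule class_funsI)
  fix x assume "x \<notin> index_lists d n N \<times> index_lists d n N"
  then show "dcoset_tensor d n N C x = 0"
    by (cases x) (auto simp: dcoset_tensor_def fun_sum_apply perm_tensor_def intro!: sum.neutral)
next
  let ?key = "\<lambda>I. mset (map mset I)"
  fix x y
  assume x: "x \<in> index_lists d n N \<times> index_lists d n N" and y: "y \<in> index_lists d n N \<times> index_lists d n N"
    and key: "map_prod ?key ?key x = map_prod ?key ?key y"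
  obtain I J I' J' where xy: "x = (I, J)" "y = (I', J')" by (cases x, cases y)
  have w_ex: "\<exists>w\<in>wreath d n. \<forall>p\<in>sites d n. of_lists K' p = of_lists K (w p)"
    if "K \<in> index_lists d n N" "K' \<in> index_lists d n N" "?key K = ?key K'" for K K' :: "nat list list"
    using that mset_to_lists_eq_iff[of d n "of_lists K" "of_lists K'"] by (simp add: to_lists_of_lists)
  obtain w where w: "w \<in> wreath d n" "\<And>p. p \<in> sites d n \<Longrightarrow> of_lists I' p = of_lists I (w p)"
    using w_ex[of I I'] x y key xy by auto
  obtain w' where w': "w' \<in> wreath d n" "\<And>p. p \<in> sites d n \<Longrightarrow> of_lists J' p = of_lists J (w' p)"
    using w_ex[of J J'] x y key xy by auto
  let ?iw = "inv_into UNIV w" and ?iw' = "inv_into UNIV w'"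
  have iw: "?iw \<in> wreath d n" "?iw' \<in> wreath d n" using w w' wreath_inv by blast+
  have pw: "?iw (w p) = p" "w (?iw p) = p" "?iw' (w' p) = p" "w' (?iw' p) = p" for p
    using wreath_inverses[OF w(1), THEN fun_cong] wreath_inverses[OF w'(1), THEN fun_cong] by simp_all
  have eq: "perm_tensor d n N \<tau> (I', J') = perm_tensor d n N (w \<circ> \<tau> \<circ> ?iw') (I, J)" if "\<tau> \<in> C" for \<tau>
  proof -
    have "\<tau> \<in> perms d n" using in_quotient_imp_subset[OF equiv_dcoset_rel C] that by blast
    then have \<tau>: "\<tau> p \<in> sites d n" if "p \<in> sites d n" for p
      using permutes_in_image that by (fastforce simp: perms_iff)
    have s: "w' p \<in> sites d n" "?iw' p \<in> sites d n" if "p \<in> sites d n" for p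
      using permutes_in_image[OF wreath_permutes] w'(1) iw(2) that by blast+
    have "(\<forall>p\<in>sites d n. of_lists J' p = of_lists I' (\<tau> p))
       \<longleftrightarrow> (\<forall>p\<in>sites d n. of_lists J (w' p) = of_lists I (w (\<tau> p)))"
      using w(2) w'(2) \<tau> by simp
    also have "\<dots> \<longleftrightarrow> (\<forall>p\<in>sites d n. of_lists J p = of_lists I (w (\<tau> (?iw' p))))"
      using s pw by metis
    finally show ?thesis using x y xy by (simp add: perm_tensor_def)
  qed
  have "bij_betw (\<lambda>\<tau>. w \<circ> \<tau> \<circ> ?iw') C C"
    by (rule bij_betw_byWitness[where f' = "\<lambda>\<tau>. ?iw \<circ> \<tau> \<circ> w'"])
      (use dcoset_closed[OF C] w(1) w'(1) iw pw in \<open>auto simp: fun_eq_iff\<close>)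
  from sum.reindex_bij_betw[OF this, of "\<lambda>\<tau>. perm_tensor d n N \<tau> (I, J)"]
  have "(\<Sum>\<tau>\<in>C. perm_tensor d n N \<tau> (I', J')) = (\<Sum>\<tau>\<in>C. perm_tensor d n N \<tau> (I, J))"
    by (simp add: eq)
  then show "dcoset_tensor d n N C x = dcoset_tensor d n N C y"
    by (simp add: dcoset_tensor_def fun_sum_apply xy)
qed

lemma dcoset_tensor_in_invariants:
  assumes C: "C \<in> perms d n // dcoset_rel d n"
  shows "dcoset_tensor d n N C \<in> invariants d n N"
proof -
  have \<sigma>: "\<sigma> permutes sites d n" if "\<sigma> \<in> C" for \<sigma>
    using in_quotient_imp_subset[OF equiv_dcoset_rel C] that by (auto simp: perms_iff)
  have "U_invariant N (sites d n) (\<lambda>e. perm_tensor d n N \<sigma> (enc d n e))" if "\<sigma> \<in> C" for \<sigma>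
    by (rule U_invariant_cong[OF U_invariant_perm[OF \<sigma>[OF that] finite_sites]])
      (simp add: perm_tensor_enc \<sigma>[OF that])
  then have "U_invariant N (sites d n) (\<lambda>e. \<Sum>\<sigma>\<in>C. 1 * perm_tensor d n N \<sigma> (enc d n e))"
    by (rule U_invariant_sum)
  then show ?thesis
    unfolding invariants_iff using dcoset_tensor_in_sym_sym_space[OF C]
    by (simp add: dcoset_tensor_def fun_sum_apply)
qed

text \<open>The tensors of the double cosets form a basis. Evaluation at the index maps given by an
  injective \<open>f\<close> and \<open>f \<circ> \<sigma>\<close> separates them, and an invariant
  is recovered from its values at these points by interpolation.\<close>

lemma dim_invariants:
  assumes N: "d * n \<le> N"
  shows "cfun.dim (invariants d n N) = Z_sym d n"
proof -
  define P where "P = sites d n"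
  define Q where "Q = perms d n // dcoset_rel d n"
  have fin: "finite P" unfolding P_def by (rule finite_sites)
  have "card P \<le> card {..<N}" using N by (simp add: P_def card_sites)
  then obtain f where f: "f ` P \<subseteq> {..<N}" "inj_on f P" using card_le_inj[OF fin] by blast
  have fN: "f p < N" if "p \<in> P" for p using f(1) that by auto
  define pt where "pt g h = restrict (case_sum g h) (P <+> P)" for g h :: "nat \<times> nat \<Rightarrow> nat"
  have pt_in: "pt g h \<in> index_maps N P" if "\<And>p. p \<in> P \<Longrightarrow> g p < N \<and> h p < N" for g h
    using that by (auto simp: pt_def)
  have pt_app: "pt g h (Inl p) = g p" "pt g h (Inr p) = h p" if "p \<in> P" for g h p
    using that by (auto simp: pt_def)
  have perm_in: "\<sigma> p \<in> P" if "\<sigma> \<in> perms d n" "p \<in> P" for \<sigma> p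
    using permutes_in_image that by (fastforce simp: perms_iff P_def)
  have pt_perm: "pt f (f \<circ> \<sigma>) \<in> index_maps N P" if "\<sigma> \<in> perms d n" for \<sigma>
    using fN perm_in[OF that] by (intro pt_in) simp
  have perm_eqI: "\<sigma> = \<tau>" if "\<sigma> \<in> perms d n" "\<tau> \<in> perms d n" "\<And>p. p \<in> P \<Longrightarrow> \<sigma> p = \<tau> p" for \<sigma> \<tau>
    using that permutes_not_in[of \<sigma> P] permutes_not_in[of \<tau> P]
    by (intro ext) (metis P_def perms_iff)
  \<comment> \<open>Injectivity of \<open>f\<close> makes the evaluation points dual to the
    permutation tensors; independence and interpolation both rest on this.\<close>
  have eval: "perm_tensor d n N \<tau> (enc d n (pt f (f \<circ> \<sigma>))) = (if \<tau> = \<sigma> then 1 else 0)"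
    if \<sigma>: "\<sigma> \<in> perms d n" and \<tau>: "\<tau> \<in> perms d n" for \<sigma> \<tau>
  proof -
    have "(\<forall>p\<in>P. pt f (f \<circ> \<sigma>) (Inr p) = pt f (f \<circ> \<sigma>) (Inl (\<tau> p))) \<longleftrightarrow> (\<forall>p\<in>P. \<sigma> p = \<tau> p)"
      using perm_in[OF \<sigma>] perm_in[OF \<tau>] inj_on_eq_iff[OF f(2)] by (simp add: pt_app)
    also have "\<dots> \<longleftrightarrow> \<tau> = \<sigma>" using perm_eqI[OF \<sigma> \<tau>] by auto
    finally show ?thesis
      using perm_tensor_enc[OF pt_perm[OF \<sigma>, unfolded P_def], of \<tau>] \<tau> by (simp add: perms_iff P_def)
  qed
  have subP: "C \<subseteq> perms d n" if "C \<in> Q" for C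
    using in_quotient_imp_subset[OF equiv_dcoset_rel] that by (simp add: Q_def)
  have finC: "finite C" if "C \<in> Q" for C using subP[OF that] finite_perms finite_subset by blast
  have eval_C: "dcoset_tensor d n N C (enc d n (pt f (f \<circ> \<sigma>))) = (if \<sigma> \<in> C then 1 else 0)"
    if C: "C \<in> Q" and \<sigma>: "\<sigma> \<in> perms d n" for C \<sigma>
  proof -
    have "dcoset_tensor d n N C (enc d n (pt f (f \<circ> \<sigma>))) = (\<Sum>\<tau>\<in>C. if \<tau> = \<sigma> then 1 else 0)"
      unfolding dcoset_tensor_def fun_sum_apply
      using subP[OF C] \<sigma> by (intro sum.cong refl eval) auto
    then show ?thesis using finC[OF C] by (simp add: sum.delta)
  qed
  have ne: "\<exists>\<sigma>. \<sigma> \<in> C \<and> \<sigma> \<in> perms d n" if "C \<in> Q" for C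
  proof -
    have "C \<noteq> {}"
      using in_quotient_imp_non_empty[OF equiv_dcoset_rel, of C d n] that by (simp add: Q_def)
    then show ?thesis using subP[OF that] by blast
  qed
  have disj: "C = D" if "C \<in> Q" "D \<in> Q" "\<sigma> \<in> C" "\<sigma> \<in> D" for C D \<sigma>
    using quotient_disj[OF equiv_dcoset_rel] that unfolding Q_def by blast
  show ?thesis
  proof (rule cfun.dim_unique)
    show "dcoset_tensor d n N ` Q \<subseteq> invariants d n N"
      using dcoset_tensor_in_invariants by (auto simp: Q_def)
    have "inj_on (dcoset_tensor d n N) Q"
    proof (rule inj_onI)
      fix C D assume CD: "C \<in> Q" "D \<in> Q" "dcoset_tensor d n N C = dcoset_tensor d n N D"
      obtain \<sigma> where \<sigma>: "\<sigma> \<in> C" "\<sigma> \<in> perms d n" using ne[OF CD(1)] by blast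
      have "\<sigma> \<in> D" using eval_C[OF CD(1) \<sigma>(2)] eval_C[OF CD(2) \<sigma>(2)] CD(3) \<sigma>(1)
        by (simp split: if_splits)
      then show "C = D" using disj CD(1,2) \<sigma>(1) by blast
    qed
    then show "card (dcoset_tensor d n N ` Q) = Z_sym d n"
      by (simp add: card_image Z_sym_def Q_def)
    show "cfun.independent (dcoset_tensor d n N ` Q)"
      unfolding cfun.dependent_explicit
    proof clarify
      fix t u v assume t: "finite t" "t \<subseteq> dcoset_tensor d n N ` Q" "(\<Sum>v\<in>t. fscale (u v) v) = 0"
        and v: "v \<in> t" "u v \<noteq> 0"
      then obtain C where C: "C \<in> Q" "dcoset_tensor d n N C \<in> t" "u (dcoset_tensor d n N C) \<noteq> 0"
        by blast
      obtain \<sigma> where \<sigma>: "\<sigma> \<in> C" "\<sigma> \<in> perms d n" using ne[OF C(1)] by blast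
      have "0 = (\<Sum>v\<in>t. u v * v (enc d n (pt f (f \<circ> \<sigma>))))"
        using fun_cong[OF t(3), of "enc d n (pt f (f \<circ> \<sigma>))"] by (simp add: fun_sum_apply fscale_def)
      also have "\<dots> = (\<Sum>v\<in>t. if v = dcoset_tensor d n N C then u v else 0)"
      proof (rule sum.cong[OF refl])
        fix v assume "v \<in> t"
        then obtain D where D: "D \<in> Q" "v = dcoset_tensor d n N D" using t(2) by blast
        have "\<sigma> \<in> D \<longleftrightarrow> v = dcoset_tensor d n N C"
        proof
          assume "\<sigma> \<in> D"
          then show "v = dcoset_tensor d n N C" using disj[OF C(1) D(1) \<sigma>(1)] D(2) by simp
        next
          assume "v = dcoset_tensor d n N C"
          then show "\<sigma> \<in> D"
            using eval_C[OF C(1) \<sigma>(2)] eval_C[OF D(1) \<sigma>(2)] D(2) \<sigma>(1) by (simp split: if_splits)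
        qed
        then show "u v * v (enc d n (pt f (f \<circ> \<sigma>))) = (if v = dcoset_tensor d n N C then u v else 0)"
          using eval_C[OF D(1) \<sigma>(2)] D(2) by simp
      qed
      also have "\<dots> = u (dcoset_tensor d n N C)" using t(1) C(2) by (simp add: sum.delta)
      finally show False using C(3) by simp
    qed
    show "invariants d n N \<subseteq> cfun.span (dcoset_tensor d n N ` Q)"
    proof
      fix T assume "T \<in> invariants d n N"
      then have T: "T \<in> sym_sym_space d n N" and inv: "U_invariant N P (\<lambda>e. T (enc d n e))"
        unfolding invariants_iff P_def by auto
      define c where "c \<sigma> = T (enc d n (pt f (f \<circ> \<sigma>)))" for \<sigma>
      have expand: "T (enc d n e) = (\<Sum>\<sigma>\<in>perms d n. c \<sigma> * perm_tensor d n N \<sigma> (enc d n e))"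
        if e: "e \<in> index_maps N P" for e
      proof -
        \<comment> \<open>The interpolation error is invariant and vanishes at all evaluation
          points, so it is zero by \<open>U_invariant_eq_0\<close>.\<close>
        let ?t = "\<lambda>e. T (enc d n e) - (\<Sum>\<sigma>\<in>perms d n. c \<sigma> * perm_tensor d n N \<sigma> (enc d n e))"
        have "U_invariant N P (\<lambda>e. perm_tensor d n N \<sigma> (enc d n e))" if "\<sigma> \<in> perms d n" for \<sigma>
          unfolding P_def
          by (rule U_invariant_cong[OF U_invariant_perm[OF that[unfolded perms_iff] finite_sites]])
            (simp add: perm_tensor_enc that[unfolded perms_iff])
        then have "U_invariant N P ?t" by (intro U_invariant_diff inv U_invariant_sum)
        then have "?t e = 0"
        proof (rule U_invariant_eq_0[OF _ fin _ f(2) fN _ e])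
          show "card P \<le> N" using N by (simp add: P_def card_sites)
          fix e \<sigma> assume e: "e \<in> index_maps N P" and \<sigma>: "\<sigma> permutes P"
            and l: "\<And>p. p \<in> P \<Longrightarrow> e (Inl p) = f p" and r: "\<And>p. p \<in> P \<Longrightarrow> e (Inr p) = f (\<sigma> p)"
          have \<sigma>': "\<sigma> \<in> perms d n" using \<sigma> by (simp add: perms_iff P_def)
          have "e = pt f (f \<circ> \<sigma>)"
          proof
            fix q
            show "e q = pt f (f \<circ> \<sigma>) q"
              using e l r by (cases "q \<in> P <+> P") (auto simp: pt_def PiE_def extensional_def)
          qed
          moreover have "(\<Sum>\<tau>\<in>perms d n. c \<tau> * perm_tensor d n N \<tau> (enc d n (pt f (f \<circ> \<sigma>))))
              = (\<Sum>\<tau>\<in>perms d n. if \<tau> = \<sigma> then c \<tau> else 0)"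
            using eval[OF \<sigma>'] by (intro sum.cong refl) simp
          ultimately show "?t e = 0" using \<sigma>' by (simp add: sum.delta finite_perms c_def)
        qed
        then show ?thesis by simp
      qed
      have c_const: "c (w \<circ> \<sigma> \<circ> w') = c \<sigma>"
        if \<sigma>: "\<sigma> \<in> perms d n" and w: "w \<in> wreath d n" "w' \<in> wreath d n" for \<sigma> w w'
      proof -
        have wp: "w \<in> perms d n" "w' \<in> perms d n" using w by (simp_all add: wreath_def)
        have comp: "w \<circ> \<sigma> \<circ> w' \<in> perms d n"
          using \<sigma> wp by (auto simp: perms_def intro!: permutes_compose)
        \<comment> \<open>An intermediate index map. Its two parts arise from \<open>f\<close> and
          from \<open>f \<circ> (w \<circ> \<sigma> \<circ> w')\<close> by the wreath product, so
          \<open>T\<close> has the same value there. Since \<open>f \<circ> w\<close> is again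
          injective on pairs, only \<sigma> contributes to the expansion at this map, which gives
          \<open>c \<sigma>\<close>.\<close>
        let ?e = "pt (f \<circ> w) (f \<circ> w \<circ> \<sigma>)"
        have e: "?e \<in> index_maps N P"
          using fN perm_in[OF \<sigma>] perm_in[OF wp(1)] by (intro pt_in) simp
        have l: "to_lists d n (\<lambda>p. pt g h (Inl p)) = to_lists d n g"
          "to_lists d n (\<lambda>p. pt g h (Inr p)) = to_lists d n h" for g h
          by (rule to_lists_cong, simp add: pt_app P_def)+
        have "T (enc d n (pt f (f \<circ> (w \<circ> \<sigma> \<circ> w')))) = T (enc d n ?e)"
        proof (rule class_funs_eq[OF T[unfolded sym_sym_space_eq]])
          show "enc d n (pt f (f \<circ> (w \<circ> \<sigma> \<circ> w'))) \<in> index_lists d n N \<times> index_lists d n N"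
            using enc_in pt_perm[OF comp] by (simp add: P_def)
          show "enc d n ?e \<in> index_lists d n N \<times> index_lists d n N"
            using enc_in e by (simp add: P_def)
          have 1: "mset (map mset (to_lists d n f)) = mset (map mset (to_lists d n (f \<circ> w)))"
            unfolding mset_to_lists_eq_iff using w(1) by (intro bexI[of _ w]) simp_all
          have 2: "mset (map mset (to_lists d n (f \<circ> w \<circ> \<sigma>)))
              = mset (map mset (to_lists d n (f \<circ> (w \<circ> \<sigma> \<circ> w'))))"
            unfolding mset_to_lists_eq_iff using w(2) by (intro bexI[of _ w']) simp_all
          show "map_prod (\<lambda>I. mset (map mset I)) (\<lambda>I. mset (map mset I)) (enc d n (pt f (f \<circ> (w \<circ> \<sigma> \<circ> w'))))
            = map_prod (\<lambda>I. mset (map mset I)) (\<lambda>I. mset (map mset I)) (enc d n ?e)"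
            unfolding enc_def l map_prod_simp using 1 2 by (simp only:)
        qed
        also have "\<dots> = (\<Sum>\<tau>\<in>perms d n. c \<tau> * perm_tensor d n N \<tau> (enc d n ?e))" by (rule expand[OF e])
        also have "\<dots> = (\<Sum>\<tau>\<in>perms d n. if \<tau> = \<sigma> then c \<tau> else 0)"
        proof (rule sum.cong[OF refl])
          fix \<tau> assume \<tau>: "\<tau> \<in> perms d n"
          have "?e (Inr p) = ?e (Inl (\<tau> p)) \<longleftrightarrow> \<sigma> p = \<tau> p" if p: "p \<in> P" for p
          proof -
            have s: "\<sigma> p \<in> P" "\<tau> p \<in> P" using perm_in[OF \<sigma> p] perm_in[OF \<tau> p] .
            then have "?e (Inr p) = ?e (Inl (\<tau> p)) \<longleftrightarrow> f (w (\<sigma> p)) = f (w (\<tau> p))"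
              using p by (simp add: pt_app)
            also have "\<dots> \<longleftrightarrow> w (\<sigma> p) = w (\<tau> p)"
              using inj_on_eq_iff[OF f(2) perm_in[OF wp(1) s(1)] perm_in[OF wp(1) s(2)]] .
            also have "\<dots> \<longleftrightarrow> \<sigma> p = \<tau> p" using bij_is_inj[OF wreath_bij[OF w(1)]] by (auto dest: injD)
            finally show ?thesis .
          qed
          then have "(\<forall>p\<in>P. ?e (Inr p) = ?e (Inl (\<tau> p))) \<longleftrightarrow> \<tau> = \<sigma>"
            using perm_eqI[OF \<sigma> \<tau>] by auto
          then show "c \<tau> * perm_tensor d n N \<tau> (enc d n ?e) = (if \<tau> = \<sigma> then c \<tau> else 0)"
            using perm_tensor_enc[OF e[unfolded P_def], of \<tau>] \<tau> by (simp add: perms_iff P_def)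
        qed
        also have "\<dots> = c \<sigma>" using \<sigma> by (simp add: sum.delta finite_perms)
        finally show ?thesis by (simp add: c_def)
      qed
      define rep where "rep C = (SOME \<sigma>. \<sigma> \<in> C)" for C :: "(nat \<times> nat \<Rightarrow> nat \<times> nat) set"
      have c_rep: "c \<sigma> = c (rep C)" if C: "C \<in> Q" and \<sigma>: "\<sigma> \<in> C" for C \<sigma>
      proof -
        have "rep C \<in> C" unfolding rep_def by (rule someI[of "\<lambda>s. s \<in> C", OF \<sigma>])
        then have "(rep C, \<sigma>) \<in> dcoset_rel d n"
          using in_quotient_imp_in_rel[OF equiv_dcoset_rel, of C d n "rep C" \<sigma>] C \<sigma> by (simp add: Q_def)
        then obtain w w' where "rep C \<in> perms d n" "w \<in> wreath d n" "w' \<in> wreath d n" "\<sigma> = w \<circ> rep C \<circ> w'"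
          unfolding dcoset_rel_def by blast
        then show ?thesis using c_const by simp
      qed
      \<comment> \<open>The coefficients are constant on double cosets, so the expansion over single
        permutations groups into one over double cosets.\<close>
      have "T = (\<Sum>C\<in>Q. fscale (c (rep C)) (dcoset_tensor d n N C))"
      proof
        fix x
        show "T x = (\<Sum>C\<in>Q. fscale (c (rep C)) (dcoset_tensor d n N C)) x"
        proof (cases "x \<in> index_lists d n N \<times> index_lists d n N")
          case True
          then obtain e where e: "e \<in> index_maps N P" "x = enc d n e"
            using bij_betw_imp_surj_on[OF bij_betw_enc[of d n N]] unfolding P_def by blast
          have "T x = (\<Sum>\<sigma>\<in>perms d n. c \<sigma> * perm_tensor d n N \<sigma> x)" using expand[OF e(1)] e(2) by simp
          also have "\<dots> = (\<Sum>C\<in>Q. \<Sum>\<sigma>\<in>C. c \<sigma> * perm_tensor d n N \<sigma> x)"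
            unfolding Q_def by (rule sum_quotient[OF finite_perms equiv_dcoset_rel])
          also have "\<dots> = (\<Sum>C\<in>Q. \<Sum>\<sigma>\<in>C. c (rep C) * perm_tensor d n N \<sigma> x)"
            by (intro sum.cong refl) (simp only: c_rep)
          finally show ?thesis
            by (simp add: fun_sum_apply fscale_def dcoset_tensor_def sum_distrib_left)
        next
          case False
          have "T x = 0" using class_funs_outside[OF T[unfolded sym_sym_space_eq] False] .
          moreover have "dcoset_tensor d n N C x = 0" if "C \<in> Q" for C
            using class_funs_outside[OF dcoset_tensor_in_sym_sym_space[unfolded sym_sym_space_eq] False] that
            by (simp add: Q_def)
          ultimately show ?thesis by (simp add: fun_sum_apply fscale_def)
        qed
      qed
      moreover have "(\<Sum>C\<in>Q. fscale (c (rep C)) (dcoset_tensor d n N C))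
          \<in> cfun.span (dcoset_tensor d n N ` Q)"
        by (intro cfun.span_sum cfun.span_scale cfun.span_base) auto
      ultimately show "T \<in> cfun.span (dcoset_tensor d n N ` Q)" by simp
    qed
  qed
qed

theorem mainTheorem8:
  fixes d n :: nat
  assumes "d \<ge> 2" and "n \<ge> 1"
  shows "of_nat (Z_sym d n) =
           (\<Sum>p\<in>partitions (d * n). (coeff_tx (Z_series d) n p)\<^sup>2 * of_nat (Sym (d * n) p))
         \<and> (\<exists>N\<^sub>0. \<forall>N\<ge>N\<^sub>0. cfun.dim (invariants d n N) = Z_sym d n)"
proof
  show "of_nat (Z_sym d n) =
      (\<Sum>p\<in>partitions (d * n). (coeff_tx (Z_series d) n p)\<^sup>2 * of_nat (Sym (d * n) p))"
    using assms(1) by (intro Z_sym_formula) simp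
  show "\<exists>N\<^sub>0. \<forall>N\<ge>N\<^sub>0. cfun.dim (invariants d n N) = Z_sym d n"
    \<comment> \<open>The threshold is \<open>d * n\<close>, the number of index pairs.\<close>
    using dim_invariants by blast
qed

end
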